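(* Let $\{Z_k\}_{k\in\mathbb{N}_+}$ be a (time-homogeneous, not necessarily reversible) Markov chain on a Polish space $\Omega$ with invariant distribution $\mu$. Suppose that the corresponding transition operator $\mathbf{P}$ has iterated Poincaré gap $\eta_p>0$. Let $\nu$ be the initial distribution of the chain, i.e. $Z_1\sim\nu$, and suppose that $\nu$ is absolutely continuous with respect to $\mu$ and that its density $\nu/\mu$ has a finite $p$-moment, i.e. $\|\nu/\mu\|_{L_{p,\mu}}<\infty$, for some $p\in[1,+\infty]$. Let $f:\Omega\to\mathbb{R}$ be a measurable function such that $\mathbb{E}_\mu[f]=0$, $|f|\le M$, and $\operatorname{Var}_\mu[f]\le\sigma^2$ for some $M,\sigma\in(0,+\infty)$. Then, for all $n\in\mathbb{N}_+$ and all $\delta\ge 0$, $$\mathbb{P}\left\{\left|\frac1n\sum_{k=1}^n f(Z_k)\right|\ge\delta\right\}\le 2\,\|\nu/\mu\|_{L_{p,\mu}}\exp\left(-\frac{n\,\eta_p\,\delta^2}{4qM\sqrt{(2+6\eta_p)^2\sigma^2+\delta^2}}\right),$$ where $q=p/(p-1)\in[1,+\infty]$.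
   Context: $L_{2,\mu}$ is the Hilbert space of (square-integrable) real-valued functions on $\Omega$ with inner product $\langle f,g\rangle_\mu=\mathbb{E}_\mu[f\cdot g]$ and norm $\|f\|_\mu=\langle f,f\rangle_\mu^{1/2}$; $L_{2,\mu}^0=\{f\in L_{2,\mu}:\mathbb{E}_\mu[f]=0\}$, assumed nonzero. The transition operator is $\mathbf{P}h(z)=\mathbb{E}[h(Z_2)\mid Z_1=z]$, and $\mu$ is invariant: $\mathbb{E}_\mu[\mathbf{P}h]=\mathbb{E}_\mu[h]$ for all $h\in L_{2,\mu}$. With $\mathbf{L}=\mathbf{P}-\mathbf{I}$ ($\mathbf{I}$ the identity operator), the iterated Poincaré gap of $\mathbf{P}$ is $$\eta_p:=\inf_{h\in L_{2,\mu}^0,\,h\ne0}\frac{\|\mathbf{L}h\|_\mu}{\|h\|_\mu}.$$ Equivalently, $\eta_p$ is the largest constant such that $\eta_p^2\operatorname{Var}_\mu[h]\le\mathbb{E}_\mu[(\mathbf{L}h)^2]$ for all $h\in L_{2,\mu}$. $\nu/\mu$ denotes the Radon–Nikodym density $d\nu/d\mu$, and $\|\cdot\|_{L_{p,\mu}}$ is the $L^p(\mu)$ norm (essential supremum if $p=+\infty$). Conventions: $q=1$ if $p=+\infty$; $q=+\infty$ if $p=1$, in which case the exponential is read as $1$. *)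

theory Defs
  imports "HOL-Probability.Probability"
begin

section \<open>The Hilbert space of square-integrable functions\<close>

text \<open>Elements of the Hilbert space are represented by functions, not by equivalence classes
  modulo null sets; accordingly \<open>h \<noteq> 0\<close> is expressed below as \<open>L2_norm \<mu> h \<noteq> 0\<close>.\<close>

definition L2 :: "'a measure \<Rightarrow> ('a \<Rightarrow> real) set" where
  "L2 \<mu> = {h \<in> borel_measurable \<mu>. integrable \<mu> (\<lambda>x. (h x)\<^sup>2)}"

definition L2_inner :: "'a measure \<Rightarrow> ('a \<Rightarrow> real) \<Rightarrow> ('a \<Rightarrow> real) \<Rightarrow> real" where
  "L2_inner \<mu> f g = (\<integral>x. f x * g x \<partial>\<mu>)"

definition L2_norm :: "'a measure \<Rightarrow> ('a \<Rightarrow> real) \<Rightarrow> real" where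
  "L2_norm \<mu> f = sqrt (L2_inner \<mu> f f)"

definition L2_0 :: "'a measure \<Rightarrow> ('a \<Rightarrow> real) set" where
  "L2_0 \<mu> = {h \<in> L2 \<mu>. (\<integral>x. h x \<partial>\<mu>) = 0}"

section \<open>The norms of the Lebesgue spaces\<close>

definition Lp_norm :: "ennreal \<Rightarrow> 'a measure \<Rightarrow> ('a \<Rightarrow> real) \<Rightarrow> ennreal" where
  "Lp_norm p \<mu> g =
     (if p = \<infinity> then esssup \<mu> (\<lambda>x. ennreal \<bar>g x\<bar>)
      else let I = (\<integral>\<^sup>+x. ennreal (\<bar>g x\<bar> powr enn2real p) \<partial>\<mu>)
           in if I = \<infinity> then \<infinity> else ennreal (enn2real I powr (1 / enn2real p)))"

definition conj_exponent :: "ennreal \<Rightarrow> ennreal" where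
  "conj_exponent p = (if p = \<infinity> then 1 else if p = 1 then \<infinity> else p / (p - 1))"

text \<open>The library's \<open>RN_deriv\<close> takes extended nonnegative values; for probability measures it is
  finite almost everywhere, so the passage to real values only changes a null set.\<close>

definition rn_density :: "'a measure \<Rightarrow> 'a measure \<Rightarrow> 'a \<Rightarrow> real" where
  "rn_density \<nu> \<mu> x = enn2real (RN_deriv \<mu> \<nu> x)"

section \<open>Markov chains and the iterated Poincare gap\<close>

definition markov_kernel :: "('a::topological_space \<Rightarrow> 'a measure) \<Rightarrow> bool" where
  "markov_kernel K \<longleftrightarrow> K \<in> measurable borel (prob_algebra borel)"

definition history :: "'w measure \<Rightarrow> (nat \<Rightarrow> 'w \<Rightarrow> 'a::topological_space) \<Rightarrow> nat \<Rightarrow> 'w measure" where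
  "history S Z k = sigma (space S) {Z j -` A \<inter> space S | j A. j \<in> {1..k} \<and> A \<in> sets borel}"

text \<open>Time runs through the positive integers; the value \<open>Z 0\<close> is unconstrained and never used.\<close>

definition markov_chain ::
    "'w measure \<Rightarrow> (nat \<Rightarrow> 'w \<Rightarrow> 'a::topological_space) \<Rightarrow> ('a \<Rightarrow> 'a measure) \<Rightarrow> bool" where
  "markov_chain S Z K \<longleftrightarrow>
     prob_space S \<and> markov_kernel K \<and> (\<forall>k\<ge>1. Z k \<in> measurable S borel) \<and>
     (\<forall>k\<ge>1. \<forall>A\<in>sets borel. AE \<omega> in S.
        real_cond_exp S (history S Z k) (\<lambda>\<omega>. indicator A (Z (Suc k) \<omega>)) \<omega> = measure (K (Z k \<omega>)) A)"

definition transition_op :: "('a \<Rightarrow> 'a measure) \<Rightarrow> ('a \<Rightarrow> real) \<Rightarrow> 'a \<Rightarrow> real" where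
  "transition_op K h z = (\<integral>y. h y \<partial>K z)"

definition invariant_distribution :: "('a::topological_space \<Rightarrow> 'a measure) \<Rightarrow> 'a measure \<Rightarrow> bool" where
  "invariant_distribution K \<mu> \<longleftrightarrow>
     prob_space \<mu> \<and> sets \<mu> = sets borel \<and>
     (\<forall>h\<in>L2 \<mu>. (\<integral>z. transition_op K h z \<partial>\<mu>) = (\<integral>z. h z \<partial>\<mu>))"

definition generator :: "('a \<Rightarrow> 'a measure) \<Rightarrow> ('a \<Rightarrow> real) \<Rightarrow> 'a \<Rightarrow> real" where
  "generator K h z = transition_op K h z - h z"

definition iterated_poincare_gap :: "('a \<Rightarrow> 'a measure) \<Rightarrow> 'a measure \<Rightarrow> real" where
  "iterated_poincare_gap K \<mu> =
     (INF h\<in>{h \<in> L2_0 \<mu>. L2_norm \<mu> h \<noteq> 0}. L2_norm \<mu> (generator K h) / L2_norm \<mu> h)"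

end

theory Submission
  imports Defs
begin

text \<open>The density of the initial distribution is removed by the Hoelder inequality, so let the chain
  be stationary. Replace \<open>exp (\<theta> f)\<close> by the slightly larger multiplier \<open>1 / D\<close> and put
  \<open>u 0 = 1\<close>, \<open>u (k + 1) = P (u k) / D\<close>, so that the exponential moment of the sum is at most
  \<open>m n = E (u n)\<close>. The gap controls \<open>u\<close> only after averaging over time: a sum \<open>\<Sum>k. c k * u k\<close> with
  slowly varying weights \<open>c\<close> is nearly invariant under \<open>P\<close>, hence nearly constant in \<open>L\<^sup>2\<close>. Apply this
  to the window \<open>r\<close> with weights \<open>\<rho> ^ \<bar>k - n\<bar>\<close>, and compare it with the sum \<open>U\<close> that has the weights
  \<open>\<beta> ^ (- k)\<close> before the window: integrating the equation for \<open>P U\<close> against the invariant measure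
  bounds \<open>E r\<close> by a multiple of \<open>\<beta> ^ n\<close>. Since \<open>m\<close> varies at most geometrically, \<open>E r\<close> in turn
  bounds \<open>m n\<close>.

  This costs a constant factor, which the claimed exponent \<open>x\<close> absorbs once \<open>x\<close> exceeds a threshold between
  3 and 6. Below the threshold the Chebyshev inequality suffices, the variance being bounded by means of
  the same gap.\<close>

section \<open>Markov operators on bounded functions\<close>

text \<open>A positive gap gives no contraction of \<open>P\<close>: a cyclic shift of a finite set
  is an isometry of L2 with positive gap. So \<open>u k\<close> need not approach a constant,
  whereas \<open>P r - r\<close> is at most a small multiple of \<open>r\<close> whatever
  \<open>u\<close> does.

  The obstacle in comparing \<open>r\<close> with \<open>U\<close> is that the mean of
  \<open>U\<close> has no a priori bound. In the integrated equation the fluctuation of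
  \<open>D\<close> meets the fluctuation of \<open>U\<close>, which the gap bounds by
  \<open>\<beta> * v / \<Delta>\<close> times the mean of \<open>U\<close>, plus a term in
  \<open>r\<close>. This costs \<open>(\<beta> * v)\<^sup>2 / \<Delta>\<close> times the mean of
  \<open>U\<close>, while the growth rate returns \<open>\<beta> - 1\<close> times the same mean.
  The condition \<open>(\<beta> * v)\<^sup>2 \<le> (\<beta> - 1) * \<Delta>\<close> eliminates the
  unknown mean, and it is the origin of a growth rate of the order of the variance of the tilt
  divided by the gap.

  The resulting exponent exceeds the claimed \<open>x\<close> by a margin \<open>x * G\<close>. This
  margin absorbs the constant factor only if \<open>x\<close> is large enough, hence the separate
  treatment of small \<open>x\<close>.\<close>

definition bdd_borel :: "('a::topological_space \<Rightarrow> real) set" where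
  "bdd_borel = {h \<in> borel_measurable borel. \<exists>B. \<forall>x. \<bar>h x\<bar> \<le> B}"

lemma bdd_borelI: "h \<in> borel_measurable borel \<Longrightarrow> (\<And>x. \<bar>h x\<bar> \<le> B) \<Longrightarrow> h \<in> bdd_borel"
  unfolding bdd_borel_def by blast

lemma bdd_borelD [measurable_dest]: "h \<in> bdd_borel \<Longrightarrow> h \<in> borel_measurable borel"
  unfolding bdd_borel_def by blast

lemma bdd_borelE:
  assumes "h \<in> bdd_borel"
  obtains B where "B \<ge> 0" "\<And>x. \<bar>h x\<bar> \<le> B"
proof -
  obtain B where B: "\<And>x. \<bar>h x\<bar> \<le> B" using assms unfolding bdd_borel_def by blast
  moreover have "B \<ge> 0" using B[of undefined] abs_ge_zero order_trans by blast
  ultimately show thesis using that by blast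
qed

lemma bdd_borel_const [simp, intro]: "(\<lambda>_. c) \<in> bdd_borel"
  by (rule bdd_borelI[where B="\<bar>c\<bar>"]) auto

lemma bdd_borel_add [simp, intro]:
  assumes "g \<in> bdd_borel" "h \<in> bdd_borel" shows "(\<lambda>x. g x + h x) \<in> bdd_borel"
proof -
  obtain A B where *: "\<And>x. \<bar>g x\<bar> \<le> A" "\<And>x. \<bar>h x\<bar> \<le> B" by (metis assms bdd_borelE)
  show ?thesis using assms
    by (intro bdd_borelI[where B="A+B"] order_trans[OF abs_triangle_ineq] add_mono *) (auto dest: bdd_borelD)
qed

lemma bdd_borel_mult [simp, intro]:
  assumes "g \<in> bdd_borel" "h \<in> bdd_borel" shows "(\<lambda>x. g x * h x) \<in> bdd_borel"
proof -
  obtain A B where *: "A \<ge> 0" "\<And>x. \<bar>g x\<bar> \<le> A" "\<And>x. \<bar>h x\<bar> \<le> B" by (metis assms bdd_borelE)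
  show ?thesis using assms *
    by (intro bdd_borelI[where B="A*B"]) (auto dest: bdd_borelD simp: abs_mult intro!: mult_mono)
qed

lemma bdd_borel_diff [simp, intro]:
  assumes "g \<in> bdd_borel" "h \<in> bdd_borel" shows "(\<lambda>x. g x - h x) \<in> bdd_borel"
  using bdd_borel_add[OF assms(1) bdd_borel_mult[OF bdd_borel_const[of "-1"] assms(2)]] by simp

lemma bdd_borel_power2 [simp, intro]: "h \<in> bdd_borel \<Longrightarrow> (\<lambda>x. (h x)\<^sup>2) \<in> bdd_borel"
  unfolding power2_eq_square by auto

lemma bdd_borel_sum [simp, intro]: "(\<And>i. i \<in> I \<Longrightarrow> h i \<in> bdd_borel) \<Longrightarrow> (\<lambda>x. \<Sum>i\<in>I. h i x) \<in> bdd_borel"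
  by (induction I rule: infinite_finite_induct) auto

lemma bdd_borel_integrable:
  assumes "h \<in> bdd_borel" "prob_space N" "sets N = sets borel"
  shows "integrable N h"
proof -
  interpret prob_space N by fact
  obtain B where "\<And>x. \<bar>h x\<bar> \<le> B" using assms(1) by (metis bdd_borelE)
  then show ?thesis using assms
    by (intro integrable_const_bound[where B=B])
       (auto dest!: bdd_borelD simp: measurable_cong_sets[OF assms(3) refl])
qed

locale markov_operator =
  fixes K :: "'a::topological_space \<Rightarrow> 'a measure" and \<mu> :: "'a measure"
  assumes kernel: "markov_kernel K" and inv: "invariant_distribution K \<mu>"
begin

abbreviation P where "P \<equiv> transition_op K"

abbreviation E :: "('a \<Rightarrow> real) \<Rightarrow> real" where "E h \<equiv> (\<integral>x. h x \<partial>\<mu>)"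

lemma prob_mu: "prob_space \<mu>" and sets_mu [measurable_cong]: "sets \<mu> = sets borel"
  using inv unfolding invariant_distribution_def by auto

lemma prob_K: "prob_space (K z)" and sets_K [measurable_cong]: "sets (K z) = sets borel"
  using measurable_space[OF kernel[unfolded markov_kernel_def], of z]
  by (auto simp: space_prob_algebra)

lemma measure_mu [simp]: "measure \<mu> (space \<mu>) = 1" and measure_K [simp]: "measure (K z) (space (K z)) = 1"
  by (simp_all add: prob_space.prob_space prob_mu prob_K)

lemma integrable_mu [simp]: "h \<in> bdd_borel \<Longrightarrow> integrable \<mu> h"
  by (rule bdd_borel_integrable[OF _ prob_mu sets_mu])

lemma integrable_K [simp]: "h \<in> bdd_borel \<Longrightarrow> integrable (K z) h"
  by (rule bdd_borel_integrable[OF _ prob_K sets_K])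

lemma P_const [simp]: "P (\<lambda>_. c) z = c"
  by (simp add: transition_op_def)

lemma P_mono: "g \<in> bdd_borel \<Longrightarrow> h \<in> bdd_borel \<Longrightarrow> (\<And>x. g x \<le> h x) \<Longrightarrow> P g z \<le> P h z"
  unfolding transition_op_def by (intro integral_mono integrable_K)

lemma P_add: "g \<in> bdd_borel \<Longrightarrow> h \<in> bdd_borel \<Longrightarrow> P (\<lambda>x. g x + h x) z = P g z + P h z"
  unfolding transition_op_def by (simp add: integrable_K)

lemma P_diff: "g \<in> bdd_borel \<Longrightarrow> h \<in> bdd_borel \<Longrightarrow> P (\<lambda>x. g x - h x) z = P g z - P h z"
  unfolding transition_op_def by (simp add: integrable_K)

lemma P_cmult: "P (\<lambda>x. c * h x) z = c * P h z"
  unfolding transition_op_def by simp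

lemma P_sum: "(\<And>i. i \<in> I \<Longrightarrow> h i \<in> bdd_borel) \<Longrightarrow> P (\<lambda>x. \<Sum>i\<in>I. h i x) z = (\<Sum>i\<in>I. P (h i) z)"
  unfolding transition_op_def by (simp add: integrable_K)

lemma P_abs_le:
  assumes "h \<in> bdd_borel" "\<And>x. \<bar>h x\<bar> \<le> B"
  shows "\<bar>P h z\<bar> \<le> B"
proof -
  have "P h z \<le> P (\<lambda>_. B) z" "P (\<lambda>_. - B) z \<le> P h z"
    using assms by (intro P_mono; auto simp: abs_le_iff minus_le_iff)+
  then show ?thesis by (simp add: abs_le_iff)
qed

lemma P_bdd [simp, intro]:
  assumes "h \<in> bdd_borel" shows "P h \<in> bdd_borel"
proof -
  obtain B where B: "\<And>x. \<bar>h x\<bar> \<le> B" using assms by (metis bdd_borelE)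
  have "K \<in> borel \<rightarrow>\<^sub>M subprob_algebra borel"
    using kernel unfolding markov_kernel_def by (rule measurable_prob_algebraD)
  from measurable_compose[OF this integral_measurable_subprob_algebra[of h borel]]
  have "P h \<in> borel_measurable borel"
    unfolding transition_op_def[abs_def] using bdd_borelD[OF assms] B by simp
  then show ?thesis using P_abs_le[OF assms B] by (rule bdd_borelI)
qed

lemma bdd_borel_L2: "h \<in> bdd_borel \<Longrightarrow> h \<in> L2 \<mu>"
  unfolding L2_def using integrable_mu[OF bdd_borel_power2] by (auto dest: bdd_borelD)

lemma E_P: "h \<in> bdd_borel \<Longrightarrow> E (P h) = E h"
  using inv bdd_borel_L2 unfolding invariant_distribution_def by blast

text \<open>The variance of \<open>h\<close> under \<open>K z\<close> is nonnegative.\<close>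

lemma P_square_le:
  assumes "h \<in> bdd_borel" shows "(P h z)\<^sup>2 \<le> P (\<lambda>x. (h x)\<^sup>2) z"
proof -
  have "P (\<lambda>x. (h x - P h z)\<^sup>2) z = P (\<lambda>x. (h x)\<^sup>2 - 2 * P h z * h x + (P h z)\<^sup>2) z"
    by (rule arg_cong[where f="\<lambda>g. P g z"]) (auto simp: power2_eq_square algebra_simps)
  also have "\<dots> = P (\<lambda>x. (h x)\<^sup>2) z - 2 * P h z * P h z + (P h z)\<^sup>2"
    using assms by (simp add: P_add P_diff P_cmult)
  also have "\<dots> = P (\<lambda>x. (h x)\<^sup>2) z - (P h z)\<^sup>2" by (simp add: power2_eq_square)
  finally have "P (\<lambda>x. (h x - P h z)\<^sup>2) z = P (\<lambda>x. (h x)\<^sup>2) z - (P h z)\<^sup>2" .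
  moreover have "P (\<lambda>x. 0) z \<le> P (\<lambda>x. (h x - P h z)\<^sup>2) z" using assms by (intro P_mono) auto
  ultimately show ?thesis by simp
qed

lemma E_mono: "g \<in> bdd_borel \<Longrightarrow> h \<in> bdd_borel \<Longrightarrow> (\<And>x. g x \<le> h x) \<Longrightarrow> E g \<le> E h"
  by (intro integral_mono integrable_mu)

lemma E_cmult: "E (\<lambda>x. c * h x) = c * E h"
  by simp

definition nrm :: "('a \<Rightarrow> real) \<Rightarrow> real" where "nrm h = sqrt (E (\<lambda>x. (h x)\<^sup>2))"

lemma nrm_nonneg [simp]: "nrm h \<ge> 0" by (simp add: nrm_def)

lemma nrm_square: "(nrm h)\<^sup>2 = E (\<lambda>x. (h x)\<^sup>2)" by (simp add: nrm_def)

lemma nrm_const: "nrm (\<lambda>_. c) = \<bar>c\<bar>" by (simp add: nrm_def)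

lemma nrm_cmult: "nrm (\<lambda>x. c * h x) = \<bar>c\<bar> * nrm h"
  by (simp add: nrm_def power_mult_distrib real_sqrt_mult)

lemma Cauchy_Schwarz:
  assumes g: "g \<in> bdd_borel" and h: "h \<in> bdd_borel"
  shows "\<bar>E (\<lambda>x. g x * h x)\<bar> \<le> nrm g * nrm h"
proof -
  have "(E (\<lambda>x. g x * h x))\<^sup>2 \<le> E (\<lambda>x. (g x)\<^sup>2) * E (\<lambda>x. (h x)\<^sup>2)"
  proof -
    have q: "0 \<le> E (\<lambda>x. (g x)\<^sup>2) - 2 * s * E (\<lambda>x. g x * h x) + s\<^sup>2 * E (\<lambda>x. (h x)\<^sup>2)" for s
    proof -
      have "E (\<lambda>x. (g x - s * h x)\<^sup>2) = E (\<lambda>x. (g x)\<^sup>2 - 2 * s * (g x * h x) + s\<^sup>2 * (h x)\<^sup>2)"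
        by (rule Bochner_Integration.integral_cong) (auto simp: power2_eq_square algebra_simps)
      also have "\<dots> = E (\<lambda>x. (g x)\<^sup>2) - 2 * s * E (\<lambda>x. g x * h x) + s\<^sup>2 * E (\<lambda>x. (h x)\<^sup>2)"
        using g h by simp
      finally have "E (\<lambda>x. (g x - s * h x)\<^sup>2) = \<dots>" .
      moreover have "0 \<le> E (\<lambda>x. (g x - s * h x)\<^sup>2)" by (rule Bochner_Integration.integral_nonneg) simp
      ultimately show ?thesis by linarith
    qed
    let ?a = "E (\<lambda>x. (g x)\<^sup>2)" and ?b = "E (\<lambda>x. g x * h x)" and ?c = "E (\<lambda>x. (h x)\<^sup>2)"
    have c0: "?c \<ge> 0" "?a \<ge> 0" by auto
    show ?thesis
    proof (cases "?c = 0")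
      case True
      show ?thesis
      proof (cases "?b = 0")
        case False
        \<comment> \<open>With \<open>?c = 0\<close> the quadratic in \<open>s\<close> is affine,
          and at this \<open>s\<close> its value is -1.\<close>
        then show ?thesis using q[of "(?a + 1) / (2 * ?b)"] True by (simp add: field_simps)
      qed (use c0 in auto)
    next
      case False
      then have "?c > 0" using c0(1) by (metis order_le_less)
      moreover have "0 \<le> ?a - 2 * (?b / ?c) * ?b + (?b / ?c)\<^sup>2 * ?c" by (rule q)
      ultimately show ?thesis by (simp add: field_simps power2_eq_square)
    qed
  qed
  then have "\<bar>E (\<lambda>x. g x * h x)\<bar> \<le> sqrt (E (\<lambda>x. (g x)\<^sup>2) * E (\<lambda>x. (h x)\<^sup>2))"
    using real_le_rsqrt by fastforce
  then show ?thesis by (simp add: nrm_def real_sqrt_mult)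
qed

lemma nrm_triangle:
  assumes g: "g \<in> bdd_borel" and h: "h \<in> bdd_borel"
  shows "nrm (\<lambda>x. g x + h x) \<le> nrm g + nrm h"
proof (rule power2_le_imp_le)
  have "(nrm (\<lambda>x. g x + h x))\<^sup>2 = E (\<lambda>x. (g x)\<^sup>2 + 2 * (g x * h x) + (h x)\<^sup>2)"
    unfolding nrm_square by (rule Bochner_Integration.integral_cong) (auto simp: power2_eq_square algebra_simps)
  also have "\<dots> = (nrm g)\<^sup>2 + 2 * E (\<lambda>x. g x * h x) + (nrm h)\<^sup>2"
    unfolding nrm_square using g h by simp
  also have "\<dots> \<le> (nrm g)\<^sup>2 + 2 * (nrm g * nrm h) + (nrm h)\<^sup>2"
    using Cauchy_Schwarz[OF g h] by auto
  finally show "(nrm (\<lambda>x. g x + h x))\<^sup>2 \<le> (nrm g + nrm h)\<^sup>2"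
    by (simp add: power2_eq_square algebra_simps)
qed simp

lemma nrm_triangle_diff:
  assumes g: "g \<in> bdd_borel" and h: "h \<in> bdd_borel"
  shows "nrm (\<lambda>x. g x - h x) \<le> nrm g + nrm h"
  using nrm_triangle[OF g bdd_borel_mult[OF bdd_borel_const[of "-1"] h]] nrm_cmult[of "-1" h] by simp

lemma nrm_mono:
  assumes "g \<in> bdd_borel" "h \<in> bdd_borel" "\<And>x. \<bar>g x\<bar> \<le> \<bar>h x\<bar>"
  shows "nrm g \<le> nrm h"
  unfolding nrm_def using assms by (intro real_sqrt_le_mono E_mono) (auto simp: abs_le_square_iff)

lemma nrm_mult_le:
  assumes "g \<in> bdd_borel" "h \<in> bdd_borel" "\<And>x. \<bar>g x\<bar> \<le> B"
  shows "nrm (\<lambda>x. g x * h x) \<le> B * nrm h"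
proof -
  have B: "B \<ge> 0" using assms(3) abs_ge_zero order_trans by blast
  have "nrm (\<lambda>x. g x * h x) \<le> nrm (\<lambda>x. B * h x)"
    using assms B by (intro nrm_mono) (auto simp: abs_mult intro!: mult_right_mono)
  then show ?thesis using B by (simp add: nrm_cmult)
qed

text \<open>Jensen's inequality under each \<open>K z\<close>, followed by invariance of \<mu>,
  makes \<open>P\<close> non-expansive in L2.\<close>

lemma nrm_P: "h \<in> bdd_borel \<Longrightarrow> nrm (P h) \<le> nrm h"
proof -
  assume h: "h \<in> bdd_borel"
  have "E (\<lambda>x. (P h x)\<^sup>2) \<le> E (P (\<lambda>x. (h x)\<^sup>2))"
    by (rule E_mono[OF _ _ P_square_le[OF h]]) (use h in auto)
  then show ?thesis unfolding nrm_def E_P[OF bdd_borel_power2[OF h]] by (rule real_sqrt_le_mono)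
qed

lemma nrm_centred:
  assumes "h \<in> bdd_borel"
  shows "(nrm (\<lambda>x. h x - c))\<^sup>2 = (nrm (\<lambda>x. h x - E h))\<^sup>2 + (E h - c)\<^sup>2"
proof -
  have "E (\<lambda>x. (h x - a)\<^sup>2) = E (\<lambda>x. (h x)\<^sup>2) - 2 * a * E h + a\<^sup>2" for a
  proof -
    have "E (\<lambda>x. (h x - a)\<^sup>2) = E (\<lambda>x. (h x)\<^sup>2 - 2 * a * h x + a\<^sup>2)"
      by (rule Bochner_Integration.integral_cong) (auto simp: power2_eq_square algebra_simps)
    also have "\<dots> = E (\<lambda>x. (h x)\<^sup>2) - 2 * a * E h + a\<^sup>2"
      using assms by simp
    finally show ?thesis .
  qed
  then show ?thesis unfolding nrm_square by (simp only:) (simp add: power2_eq_square algebra_simps)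
qed

text \<open>The mean is the best constant approximation in L2. Hence an unknown constant can be
  subtracted from a centred function before its norm is estimated, as is done in
  \<open>E_r_le\<close>.\<close>

lemma nrm_centred_le: "h \<in> bdd_borel \<Longrightarrow> nrm (\<lambda>x. h x - E h) \<le> nrm (\<lambda>x. h x - c)"
  using nrm_centred[of h c] by (intro power2_le_imp_le[OF _ nrm_nonneg]) simp

end

text \<open>The gap is recorded for bounded functions only. Everything it is applied to (window
  sums, partial sums, a centred indicator) is bounded, so integrability is never an issue.\<close>

locale poincare_kernel = markov_operator K \<mu> for K :: "'a::topological_space \<Rightarrow> 'a measure" and \<mu> +
  fixes \<eta> :: real
  assumes \<eta>_pos: "\<eta> > 0"
    and gap: "\<And>h. h \<in> bdd_borel \<Longrightarrow> E h = 0 \<Longrightarrow> \<eta> * nrm h \<le> nrm (\<lambda>x. P h x - h x)"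
begin

lemma gap_centred:
  assumes "h \<in> bdd_borel"
  shows "\<eta> * nrm (\<lambda>x. h x - E h) \<le> nrm (\<lambda>x. P h x - h x)"
  using gap[of "\<lambda>x. h x - E h"] assms by (simp add: P_diff)

end

section \<open>Windows in time\<close>

lemma sum_power_mult_power:
  fixes a b :: real
  assumes "a \<noteq> b"
  shows "(\<Sum>j<Suc n. b ^ (n - j) * a ^ j) = (a ^ Suc n - b ^ Suc n) / (a - b)"
proof (induction n)
  case (Suc n)
  have "(\<Sum>j<Suc n. b ^ (Suc n - j) * a ^ j) = (\<Sum>j<Suc n. b * (b ^ (n - j) * a ^ j))"
    by (intro sum.cong refl) (auto simp: Suc_diff_le)
  then have "(\<Sum>j<Suc (Suc n). b ^ (Suc n - j) * a ^ j) = (\<Sum>j<Suc n. b * (b ^ (n - j) * a ^ j)) + a ^ Suc n"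
    by simp
  also have "\<dots> = b * ((a ^ Suc n - b ^ Suc n) / (a - b)) + a ^ Suc n"
    by (simp only: sum_distrib_left[symmetric] Suc.IH)
  also have "\<dots> = (a ^ Suc (Suc n) - b ^ Suc (Suc n)) / (a - b)"
    using assms by (simp add: field_simps)
  finally show ?case .
qed (use assms in simp)

text \<open>Subtraction of naturals truncates at 0, so the exponent is the distance between
  \<open>j\<close> and \<open>n\<close>.\<close>

definition peak :: "real \<Rightarrow> nat \<Rightarrow> nat \<Rightarrow> real" where
  "peak \<rho> n j = \<rho> ^ ((j - n) + (n - j))"

lemma peak_nonneg: "\<rho> \<ge> 0 \<Longrightarrow> peak \<rho> n j \<ge> 0"
  by (simp add: peak_def)

text \<open>Moving one step in time changes the distance to \<open>n\<close> by one in either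
  direction. This bound and the next one are the source of the near-invariance of the window under
  \<open>P\<close>.\<close>

lemma peak_le_Suc:
  assumes "0 < \<rho>" "\<rho> \<le> 1" shows "\<rho> * peak \<rho> n j \<le> peak \<rho> n (Suc j)"
proof (cases "j < n")
  case True
  then have "n - j = Suc (n - Suc j)" by simp
  then have "\<rho> * peak \<rho> n j = \<rho>\<^sup>2 * peak \<rho> n (Suc j)"
    using True by (simp add: peak_def power2_eq_square)
  also have "\<dots> \<le> 1 * peak \<rho> n (Suc j)"
    using assms by (intro mult_right_mono) (auto simp: power_le_one peak_def)
  finally show ?thesis by simp
qed (simp add: peak_def Suc_diff_le)

lemma peak_Suc_le:
  assumes "0 < \<rho>" "\<rho> \<le> 1" shows "\<rho> * peak \<rho> n (Suc j) \<le> peak \<rho> n j"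
proof (cases "j < n")
  case True
  then have "n - j = Suc (n - Suc j)" by simp
  then show ?thesis using True by (simp add: peak_def)
next
  case False
  then have "\<rho> * peak \<rho> n (Suc j) = \<rho>\<^sup>2 * peak \<rho> n j"
    by (simp add: peak_def Suc_diff_le power2_eq_square)
  also have "\<dots> \<le> 1 * peak \<rho> n j"
    using assms by (intro mult_right_mono) (auto simp: power_le_one peak_def)
  finally show ?thesis by simp
qed

text \<open>Over all integers \<open>j\<close> the series splits at \<open>n\<close> into two
  geometric series and gives the term with \<open>a ^ n\<close>. The subtracted term is the part
  with negative \<open>j\<close>.\<close>

lemma peak_power_sums:
  fixes a :: real
  assumes "0 < \<rho>" "\<rho> < a" "\<rho> * a < 1"
  shows "(\<lambda>j. peak \<rho> n j * a ^ j) sums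
    (a ^ n * (a / (a - \<rho>) + \<rho> * a / (1 - \<rho> * a)) - \<rho> ^ Suc n / (a - \<rho>))"
proof -
  have "(\<lambda>i. (a ^ n * (\<rho> * a)) * (\<rho> * a) ^ i) sums (a ^ n * (\<rho> * a) * (1 / (1 - \<rho> * a)))"
    using assms by (intro sums_mult geometric_sums) simp
  moreover have "peak \<rho> n (i + Suc n) * a ^ (i + Suc n) = (a ^ n * (\<rho> * a)) * (\<rho> * a) ^ i" for i
    by (simp add: peak_def power_add power_mult_distrib algebra_simps)
  ultimately have "(\<lambda>i. peak \<rho> n (i + Suc n) * a ^ (i + Suc n)) sums (a ^ n * (\<rho> * a) * (1 / (1 - \<rho> * a)))"
    by (simp only:)
  then have "(\<lambda>j. peak \<rho> n j * a ^ j) sums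
      (a ^ n * (\<rho> * a) * (1 / (1 - \<rho> * a)) + (\<Sum>j<Suc n. peak \<rho> n j * a ^ j))"
    by (rule sums_iff_shift[THEN iffD1])
  moreover have "(\<Sum>j<Suc n. peak \<rho> n j * a ^ j) = (a ^ Suc n - \<rho> ^ Suc n) / (a - \<rho>)"
    using assms by (subst sum_power_mult_power[symmetric]) (auto simp: peak_def intro!: sum.cong)
  moreover have "a ^ n * (\<rho> * a) * (1 / (1 - \<rho> * a)) + (a ^ Suc n - \<rho> ^ Suc n) / (a - \<rho>) =
      a ^ n * (a / (a - \<rho>) + \<rho> * a / (1 - \<rho> * a)) - \<rho> ^ Suc n / (a - \<rho>)"
    by (simp add: diff_divide_distrib algebra_simps)
  ultimately show ?thesis by simp
qed

text \<open>Compared with \<open>exp (- y)\<close>, the linear branch satisfies \<open>\<bar>damp y - 1\<bar> \<le> \<bar>y\<bar>\<close> without an exponential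
  correction, which the constants of the theorem would not allow for large gaps.\<close>

definition damp :: "real \<Rightarrow> real" where
  "damp y = (if y \<ge> 0 then exp (- y) else 1 - y)"

lemma damp_pos: "damp y > 0"
  by (simp add: damp_def)

lemma damp_ge: "1 - y \<le> damp y"
  using exp_ge_add_one_self[of "- y"] by (simp add: damp_def)

lemma abs_damp_le: "\<bar>damp y - 1\<bar> \<le> \<bar>y\<bar>"
  using exp_ge_add_one_self[of "- y"] by (simp add: damp_def)

lemma damp_le: "\<bar>y\<bar> \<le> \<tau> \<Longrightarrow> damp y \<le> 1 + \<tau>"
  by (auto simp: damp_def intro: order_trans[of _ 1])

lemma damp_ge_exp: "\<bar>y\<bar> \<le> \<tau> \<Longrightarrow> exp (- \<tau>) \<le> damp y"
  by (auto simp: damp_def intro: order_trans[of _ 1])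

text \<open>Both branches of \<open>damp\<close> lie below \<open>exp (- y)\<close> or equal it.
  Therefore \<open>1 / damp y\<close> dominates \<open>exp y\<close> and may replace it in an upper
  bound for exponential moments.\<close>

lemma exp_mult_damp_le: "exp y * damp y \<le> 1"
proof -
  have "exp y * (1 - y) \<le> exp y * exp (- y)"
    using exp_ge_add_one_self[of "- y"] by (intro mult_left_mono) auto
  then show ?thesis by (simp add: damp_def exp_minus_inverse flip: exp_add)
qed

lemma damp_measurable [measurable]: "damp \<in> borel_measurable borel"
  unfolding damp_def[abs_def] by measurable

section \<open>Exchange of series with the Markov operator and the mean\<close>

context markov_operator
begin

lemma
  assumes h: "\<And>j. h j \<in> bdd_borel" and le: "\<And>j x. \<bar>h j x\<bar> \<le> c j" and c: "summable c"
  shows suminf_bdd: "(\<lambda>x. \<Sum>j. h j x) \<in> bdd_borel"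
    and P_suminf: "P (\<lambda>x. \<Sum>j. h j x) z = (\<Sum>j. P (h j) z)"
    and E_suminf: "E (\<lambda>x. \<Sum>j. h j x) = (\<Sum>j. E (h j))"
    and summable_P: "summable (\<lambda>j. P (h j) z)"
    and summable_E: "summable (\<lambda>j. E (h j))"
proof -
  have c0: "c j \<ge> 0" for j using le[of j undefined] abs_ge_zero order_trans by blast
  have sm: "summable (\<lambda>j. \<bar>h j x\<bar>)" for x
    by (rule summable_comparison_test'[OF c]) (use le in auto)
  show "(\<lambda>x. \<Sum>j. h j x) \<in> bdd_borel"
  proof (rule bdd_borelI)
    show "(\<lambda>x. \<Sum>j. h j x) \<in> borel_measurable borel"
      using h by (intro borel_measurable_suminf bdd_borelD)
    show "\<bar>\<Sum>j. h j x\<bar> \<le> suminf c" for x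
      using summable_rabs[OF sm] suminf_le[OF le sm c] by (rule order_trans)
  qed
  \<comment> \<open>Stated for an arbitrary probability measure, the exchange serves both
    \<open>K z\<close> and \<mu>.\<close>
  have *: "(\<integral>x. (\<Sum>j. h j x) \<partial>N) = (\<Sum>j. \<integral>x. h j x \<partial>N) \<and> summable (\<lambda>j. \<integral>x. h j x \<partial>N)"
    if N: "prob_space N" "sets N = sets borel" for N
  proof -
    interpret prob_space N by fact
    have i: "integrable N (h j)" for j by (rule bdd_borel_integrable[OF h N])
    have "(\<integral>x. \<bar>h j x\<bar> \<partial>N) \<le> (\<integral>x. c j \<partial>N)" for j
      using i le by (intro integral_mono integrable_abs) auto
    then have le': "(\<integral>x. \<bar>h j x\<bar> \<partial>N) \<le> c j" for j by (simp add: prob_space)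
    have s: "summable (\<lambda>j. \<integral>x. \<bar>h j x\<bar> \<partial>N)"
      by (rule summable_comparison_test'[OF c]) (use le' in auto)
    have "summable (\<lambda>j. \<integral>x. h j x \<partial>N)"
      by (rule summable_comparison_test'[OF s]) (auto intro: integral_abs_bound)
    then show ?thesis
      using i sm s by (subst integral_suminf) auto
  qed
  show "P (\<lambda>x. \<Sum>j. h j x) z = (\<Sum>j. P (h j) z)" "summable (\<lambda>j. P (h j) z)"
    using *[OF prob_K sets_K] unfolding transition_op_def by auto
  show "E (\<lambda>x. \<Sum>j. h j x) = (\<Sum>j. E (h j))" "summable (\<lambda>j. E (h j))"
    using *[OF prob_mu sets_mu] by auto
qed

lemma E_nonneg: "(\<And>x. 0 \<le> h x) \<Longrightarrow> 0 \<le> E h"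
  by (rule Bochner_Integration.integral_nonneg)

end

section \<open>The tilted recursion and its means\<close>

locale tilted_kernel = poincare_kernel K \<mu> \<eta>
  for K :: "'a::topological_space \<Rightarrow> 'a measure" and \<mu> and \<eta> +
  fixes \<phi> :: "'a \<Rightarrow> real" and \<tau> v :: real
  assumes \<phi>_bdd: "\<phi> \<in> bdd_borel" and \<phi>_le: "\<And>x. \<bar>\<phi> x\<bar> \<le> \<tau>" and \<phi>_mean: "E \<phi> = 0"
    and \<phi>_nrm: "nrm \<phi> \<le> v"
begin

definition D :: "'a \<Rightarrow> real" where "D x = damp (\<phi> x)"

text \<open>Along the chain started in \<open>x\<close>, this is the expected product of
  \<open>1 / D\<close> over the first \<open>k\<close> states, with \<open>x\<close> itself as the
  first of them.\<close>

primrec u :: "nat \<Rightarrow> 'a \<Rightarrow> real" where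
  "u 0 = (\<lambda>_. 1)"
| "u (Suc k) = (\<lambda>x. P (u k) x / D x)"

definition m :: "nat \<Rightarrow> real" where "m k = E (u k)"

lemma \<tau>_nonneg: "\<tau> \<ge> 0" using \<phi>_le abs_ge_zero order_trans by blast

lemma v_nonneg: "v \<ge> 0" using \<phi>_nrm nrm_nonneg order_trans by blast

lemma D_pos: "D x > 0" by (simp add: D_def damp_pos)

lemma D_le: "D x \<le> 1 + \<tau>" unfolding D_def by (rule damp_le[OF \<phi>_le])

lemma D_ge: "exp (- \<tau>) \<le> D x" unfolding D_def by (rule damp_ge_exp[OF \<phi>_le])

lemma D_measurable [measurable]: "D \<in> borel_measurable borel"
  unfolding D_def[abs_def] using bdd_borelD[OF \<phi>_bdd] by measurable

lemma D_bdd [simp]: "D \<in> bdd_borel"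
  by (rule bdd_borelI[OF D_measurable, where B="1+\<tau>"]) (use D_pos D_le in \<open>auto simp: abs_of_pos\<close>)

lemma inverse_D_le: "1 / D x \<le> exp \<tau>"
  using D_ge[of x] D_pos[of x] by (simp add: field_simps exp_minus)

lemma inverse_D_bdd: "(\<lambda>x. 1 / D x) \<in> bdd_borel"
  by (rule bdd_borelI[where B="exp \<tau>"]) (use inverse_D_le D_pos in \<open>auto simp: abs_of_pos\<close>)

lemma u_bdd [simp]: "u k \<in> bdd_borel"
proof (induction k)
  case (Suc k)
  have "u (Suc k) = (\<lambda>x. P (u k) x * (1 / D x))" by auto
  then show ?case using bdd_borel_mult[OF P_bdd[OF Suc] inverse_D_bdd] by (simp only:)
qed simp

lemma P_u: "P (u k) x = D x * u (Suc k) x"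
  using D_pos[of x] by simp

lemma u_nonneg: "u k x \<ge> 0"
proof (induction k arbitrary: x)
  case (Suc k)
  have "P (\<lambda>_. 0) x \<le> P (u k) x" using Suc by (intro P_mono) auto
  then show ?case using D_pos[of x] by simp
qed simp

lemma u_le: "u k x \<le> exp \<tau> ^ k"
proof (induction k arbitrary: x)
  case (Suc k)
  have "P (u k) x \<le> P (\<lambda>_. exp \<tau> ^ k) x" using Suc by (intro P_mono) auto
  then have "P (u k) x * (1 / D x) \<le> exp \<tau> ^ k * exp \<tau>"
    using D_pos[of x] by (intro mult_mono inverse_D_le) auto
  then show ?case by (simp add: mult.commute)
qed simp

lemma m_nonneg: "m k \<ge> 0" unfolding m_def by (intro E_nonneg u_nonneg)

lemma m_0 [simp]: "m 0 = 1" by (simp add: m_def)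

text \<open>Invariance turns the recursion for \<open>u\<close> into a relation between consecutive
  means. Inserting the bounds of \<open>D\<close> shows that \<open>m\<close> neither grows nor
  decays faster than geometrically.\<close>

lemma m_eq: "m k = E (\<lambda>x. D x * u (Suc k) x)"
proof -
  have "m k = E (P (u k))" unfolding m_def by (rule E_P[OF u_bdd, symmetric])
  then show ?thesis by (simp only: P_u)
qed

lemma m_Suc_le: "m (Suc k) \<le> exp \<tau> * m k"
proof -
  have "u (Suc k) x \<le> exp \<tau> * (D x * u (Suc k) x)" for x
    using mult_right_mono[OF D_ge[of x] u_nonneg[of "Suc k" x]]
    by (simp add: exp_minus field_simps del: u.simps)
  then have "m (Suc k) \<le> E (\<lambda>x. exp \<tau> * (D x * u (Suc k) x))"
    unfolding m_def by (intro E_mono) (auto simp del: u.simps)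
  then show ?thesis by (simp only: E_cmult m_eq)
qed

lemma m_le_Suc: "m k \<le> (1 + \<tau>) * m (Suc k)"
proof -
  have "E (\<lambda>x. D x * u (Suc k) x) \<le> E (\<lambda>x. (1 + \<tau>) * u (Suc k) x)"
    using D_le u_nonneg by (intro E_mono mult_right_mono) (auto simp del: u.simps)
  then show ?thesis by (simp only: E_cmult m_eq[of k]) (simp add: m_def)
qed

lemma m_add_le: "m (k + i) \<le> exp \<tau> ^ i * m k"
proof (induction i)
  case (Suc i)
  have "m (k + Suc i) \<le> exp \<tau> * m (k + i)" using m_Suc_le by simp
  also have "\<dots> \<le> exp \<tau> * (exp \<tau> ^ i * m k)" using Suc by simp
  finally show ?case by (simp add: mult.assoc)
qed simp

lemma m_le_add: "m k \<le> (1 + \<tau>) ^ i * m (k + i)"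
proof (induction i)
  case (Suc i)
  note Suc
  also have "(1 + \<tau>) ^ i * m (k + i) \<le> (1 + \<tau>) ^ i * ((1 + \<tau>) * m (k + Suc i))"
    using m_le_Suc[of "k+i"] \<tau>_nonneg by (intro mult_left_mono) auto
  finally show ?case by (simp add: mult_ac)
qed simp

lemma nrm_D: "nrm (\<lambda>x. D x - 1) \<le> v"
proof -
  have "nrm (\<lambda>x. D x - 1) \<le> nrm \<phi>"
    using \<phi>_bdd by (intro nrm_mono) (simp_all, simp add: D_def abs_damp_le)
  then show ?thesis using \<phi>_nrm by simp
qed

text \<open>\<open>damp\<close> lies above its tangent \<open>1 - y\<close> at 0, and \<phi> is
  centred. The direction matters: in \<open>E_r_le\<close> it allows \<open>E D\<close> to be
  replaced by 1 in two terms with nonnegative coefficients.\<close>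

lemma E_D_ge: "1 \<le> E D"
proof -
  have "E (\<lambda>x. 1 - \<phi> x) \<le> E D"
    using \<phi>_bdd by (intro E_mono) (simp_all, simp add: D_def damp_ge)
  then show ?thesis using \<phi>_bdd \<phi>_mean by simp
qed

end

section \<open>Window sums and the comparison of their means\<close>

locale tilted_window = tilted_kernel K \<mu> \<eta> \<phi> \<tau> v
  for K :: "'a::topological_space \<Rightarrow> 'a measure" and \<mu> and \<eta> and \<phi> and \<tau> v +
  fixes \<rho> \<beta> :: real and n :: nat
  assumes \<rho>: "0 < \<rho>" "\<rho> * exp \<tau> < 1" and \<beta>: "1 \<le> \<beta>" "\<beta> < exp \<tau>"
begin

lemma \<rho>_less_1: "\<rho> < 1"
proof -
  have "\<rho> * 1 \<le> \<rho> * exp \<tau>" using \<rho>(1) \<tau>_nonneg by (intro mult_left_mono) auto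
  then show ?thesis using \<rho>(2) by simp
qed

lemma \<rho>\<beta>_less_1: "\<rho> * \<beta> < 1"
proof -
  have "\<rho> * \<beta> \<le> \<rho> * exp \<tau>" using \<rho>(1) \<beta>(2) by (intro mult_left_mono) auto
  then show ?thesis using \<rho>(2) by simp
qed

abbreviation d :: "nat \<Rightarrow> real" where "d \<equiv> peak \<rho> n"

text \<open>Extend \<open>u\<close> to negative \<open>j\<close> by the constants
  \<open>\<beta> ^ j\<close>. Then \<open>b0\<close> is the part of the window sum with negative
  index, and \<open>K0\<close> is the sum of \<open>d j * \<beta> ^ j\<close> over all integers
  \<open>j\<close>.\<close>

definition b0 :: real where "b0 = \<rho> ^ Suc n / (\<beta> - \<rho>)"

definition K0 :: real where "K0 = \<beta> ^ n * (\<beta> / (\<beta> - \<rho>) + \<rho> * \<beta> / (1 - \<rho> * \<beta>))"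

lemma d_nonneg: "d j \<ge> 0" using \<rho>(1) by (simp add: peak_nonneg)

lemma b0_pos: "b0 > 0" using \<rho>(1) \<rho>_less_1 \<beta>(1) by (simp add: b0_def)

lemma d_\<beta>_sums: "(\<lambda>j. d j * \<beta> ^ j) sums (K0 - b0)"
  using peak_power_sums[of \<rho> \<beta> n] \<rho>(1) \<rho>_less_1 \<rho>\<beta>_less_1 \<beta>(1) by (simp add: K0_def b0_def)

lemma summable_d_exp: "summable (\<lambda>j. d j * (c * exp \<tau> ^ j))"
proof -
  have "\<rho> < exp \<tau>" using \<rho>_less_1 \<tau>_nonneg one_le_exp_iff[of \<tau>] by linarith
  then have "summable (\<lambda>j. d j * exp \<tau> ^ j)"
    using peak_power_sums[of \<rho> "exp \<tau>" n] \<rho> by (auto simp: sums_iff)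
  then have "summable (\<lambda>j. c * (d j * exp \<tau> ^ j))" by (rule summable_mult)
  then show ?thesis by (simp add: mult_ac)
qed

text \<open>The constant \<open>b0\<close> stands for the terms with index below 0, where the tilt is switched off.\<close>

definition r :: "'a \<Rightarrow> real" where "r x = (\<Sum>j. d j * u j x) + b0"

text \<open>Unfolded, \<open>w k\<close> is the sum of \<open>\<beta> ^ (k - 1 - i) * u i\<close>
  over \<open>i < k\<close>.\<close>

primrec w :: "nat \<Rightarrow> 'a \<Rightarrow> real" where
  "w 0 = (\<lambda>_. 0)"
| "w (Suc k) = (\<lambda>x. \<beta> * w k x + u k x)"

text \<open>After exchanging the two sums, \<open>u i\<close> carries the weight
  \<open>\<beta> ^ (- i - 1)\<close> times the sum of \<open>d j * \<beta> ^ j\<close> over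
  \<open>j > i\<close>. Long before the window this is nearly a constant times
  \<open>\<beta> ^ (- i)\<close>; after the window it decays like \<open>d\<close>. Grouping by
  \<open>w j\<close> keeps the action of \<open>P\<close> explicit in each term.\<close>

definition U :: "'a \<Rightarrow> real" where "U x = (\<Sum>j. d j * w j x)"

lemma w_bdd [simp]: "w k \<in> bdd_borel" by (induction k) auto

lemma w_nonneg: "w k x \<ge> 0"
  using \<beta>(1) by (induction k) (auto intro!: add_nonneg_nonneg u_nonneg)

lemma w_le: "w k x \<le> 1 / (exp \<tau> - \<beta>) * exp \<tau> ^ k"
proof (induction k)
  case (Suc k)
  have "w (Suc k) x \<le> \<beta> * (1 / (exp \<tau> - \<beta>) * exp \<tau> ^ k) + exp \<tau> ^ k"
    using Suc \<beta> u_le[of k x] by (simp add: add_mono mult_left_mono del: times_divide_eq_left)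
  also have "\<dots> = 1 / (exp \<tau> - \<beta>) * exp \<tau> ^ Suc k"
    using \<beta> by (simp add: field_simps)
  finally show ?case .
qed (use \<beta> in simp)

text \<open>\<open>P\<close> turns \<open>u i\<close> into \<open>D * u (Suc i)\<close>. So the
  terms of \<open>w (Suc k)\<close> reappear, except the one with \<open>u 0 = 1\<close>, whose
  coefficient is \<open>\<beta> ^ k\<close>.\<close>

lemma P_w: "P (w k) x = D x * (\<beta> * w k x + u k x - \<beta> ^ k)"
proof (induction k)
  case (Suc k)
  have "P (w (Suc k)) x = \<beta> * P (w k) x + P (u k) x"
    by (simp add: P_add P_cmult)
  also have "\<dots> = \<beta> * (D x * (\<beta> * w k x + u k x - \<beta> ^ k)) + D x * u (Suc k) x"
    by (simp only: Suc P_u)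
  also have "\<dots> = D x * (\<beta> * w (Suc k) x + u (Suc k) x - \<beta> ^ Suc k)"
    by (simp add: algebra_simps)
  finally show ?case .
qed simp

lemma abs_du_le: "\<bar>d j * u j x\<bar> \<le> d j * (1 * exp \<tau> ^ j)"
  using d_nonneg[of j] u_nonneg[of j x] u_le[of j x] by (simp add: abs_mult mult_left_mono)

lemma abs_dw_le: "\<bar>d j * w j x\<bar> \<le> d j * (1 / (exp \<tau> - \<beta>) * exp \<tau> ^ j)"
  using d_nonneg[of j] w_nonneg[of j x] w_le[of j x]
  by (simp add: abs_mult mult_left_mono del: times_divide_eq_left)

lemma du_bdd [simp]: "(\<lambda>x. d j * u j x) \<in> bdd_borel"
  and dw_bdd [simp]: "(\<lambda>x. d j * w j x) \<in> bdd_borel"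
  by auto

lemmas du_series = du_bdd abs_du_le summable_d_exp
lemmas dw_series = dw_bdd abs_dw_le summable_d_exp

lemma summable_du: "summable (\<lambda>j. d j * u j x)"
  by (rule summable_comparison_test'[OF summable_d_exp[of 1]]) (use abs_du_le in simp)

lemma summable_dw: "summable (\<lambda>j. d j * w j x)"
  by (rule summable_comparison_test'[OF summable_d_exp[of "1 / (exp \<tau> - \<beta>)"]]) (use abs_dw_le in simp)

lemma r_bdd [simp]: "r \<in> bdd_borel"
  unfolding r_def[abs_def] by (intro bdd_borel_add suminf_bdd[OF du_series]) auto

lemma U_bdd [simp]: "U \<in> bdd_borel"
  unfolding U_def[abs_def] by (rule suminf_bdd[OF dw_series])

lemma r_nonneg: "r x \<ge> 0"
  unfolding r_def using b0_pos d_nonneg u_nonneg summable_du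
  by (intro add_nonneg_nonneg suminf_nonneg) auto

lemma U_nonneg: "U x \<ge> 0"
  unfolding U_def using d_nonneg w_nonneg summable_dw by (intro suminf_nonneg) auto

text \<open>The missing terms \<open>\<beta> ^ j\<close> of \<open>P_w\<close> add up to
  \<open>K0 - b0\<close>, and the constant \<open>b0\<close> contained in \<open>r\<close> cancels
  the rest. Thus \<open>r - K0\<close> is the only inhomogeneity in the equation for
  \<open>U\<close>.\<close>

lemma P_U: "P U x = D x * (\<beta> * U x + r x - K0)"
proof -
  have "P U x = (\<Sum>j. P (\<lambda>x. d j * w j x) x)"
    unfolding U_def[abs_def] by (rule P_suminf[OF dw_series])
  also have "\<dots> = (\<Sum>j. D x * (\<beta> * (d j * w j x) + d j * u j x - d j * \<beta> ^ j))"
    by (simp add: P_cmult P_w algebra_simps)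
  also have "\<dots> = D x * (\<beta> * U x + (r x - b0) - (K0 - b0))"
    using summable_dw[of x] summable_du[of x] d_\<beta>_sums unfolding U_def r_def
    by (intro sums_unique[symmetric] sums_mult sums_diff sums_add) (auto simp: sums_iff)
  finally show ?thesis by simp
qed

lemma P_r: "P r x = D x * (\<Sum>j. d j * u (Suc j) x) + b0" and summable_du_Suc: "summable (\<lambda>j. d j * u (Suc j) x)"
proof -
  have eq: "P (\<lambda>x. d j * u j x) x = D x * (d j * u (Suc j) x)" for j
    by (simp add: P_cmult P_u del: u.simps)
  have "summable (\<lambda>j. D x * (d j * u (Suc j) x))"
    using summable_P[OF du_series, of x] by (simp only: eq)
  then show s: "summable (\<lambda>j. d j * u (Suc j) x)"
    using D_pos[of x] by (auto dest: summable_mult_D)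
  have "P r x = P (\<lambda>x. \<Sum>j. d j * u j x) x + b0"
    unfolding r_def[abs_def] using suminf_bdd[OF du_series] by (simp add: P_add)
  also have "P (\<lambda>x. \<Sum>j. d j * u j x) x = (\<Sum>j. D x * (d j * u (Suc j) x))"
    by (simp only: P_suminf[OF du_series] eq)
  also have "\<dots> = D x * (\<Sum>j. d j * u (Suc j) x)"
    using s by (rule suminf_mult)
  finally show "P r x = D x * (\<Sum>j. d j * u (Suc j) x) + b0" .
qed

lemma suminf_Suc_du: "(\<Sum>j. d (Suc j) * u (Suc j) x) = r x - b0 - \<rho> ^ n"
  and summable_Suc_du: "summable (\<lambda>j. d (Suc j) * u (Suc j) x)"
proof -
  show "summable (\<lambda>j. d (Suc j) * u (Suc j) x)"
    using summable_du[of x] by (subst summable_Suc_iff)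
  show "(\<Sum>j. d (Suc j) * u (Suc j) x) = r x - b0 - \<rho> ^ n"
    using suminf_split_head[OF summable_du[of x]] by (simp add: r_def peak_def del: u.simps(2))
qed

lemma P_r_le: "P r x \<le> (1 + \<tau>) / \<rho> * r x"
proof -
  have "d j * u (Suc j) x \<le> 1 / \<rho> * (d (Suc j) * u (Suc j) x)" for j
    using mult_right_mono[OF peak_le_Suc[of \<rho> n j] u_nonneg[of "Suc j" x]] \<rho>(1) \<rho>_less_1
    by (simp add: field_simps del: u.simps)
  then have "(\<Sum>j. d j * u (Suc j) x) \<le> (\<Sum>j. 1 / \<rho> * (d (Suc j) * u (Suc j) x))"
    by (intro suminf_le summable_du_Suc summable_mult summable_Suc_du)
  also have "\<dots> = 1 / \<rho> * (r x - b0 - \<rho> ^ n)"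
    by (simp only: suminf_mult[OF summable_Suc_du] suminf_Suc_du)
  also have "\<dots> \<le> 1 / \<rho> * (r x - b0)" using \<rho>(1) by (intro mult_left_mono) auto
  finally have le: "(\<Sum>j. d j * u (Suc j) x) \<le> 1 / \<rho> * (r x - b0)" .
  have "0 \<le> (\<Sum>j. d j * u (Suc j) x)"
    by (intro suminf_nonneg summable_du_Suc mult_nonneg_nonneg d_nonneg u_nonneg)
  then have "D x * (\<Sum>j. d j * u (Suc j) x) \<le> (1 + \<tau>) * (1 / \<rho> * (r x - b0))"
    using le D_le[of x] \<tau>_nonneg by (intro mult_mono) auto
  moreover have "b0 * 1 \<le> b0 * ((1 + \<tau>) / \<rho>)"
    using b0_pos \<rho>(1) \<rho>_less_1 \<tau>_nonneg by (intro mult_left_mono) (auto simp: field_simps)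
  moreover have "(1 + \<tau>) * (1 / \<rho> * (r x - b0)) = (1 + \<tau>) / \<rho> * r x - b0 * ((1 + \<tau>) / \<rho>)"
    using \<rho>(1) by (simp add: field_simps)
  ultimately show ?thesis unfolding P_r by linarith
qed

text \<open>Shifting the index loses the head term \<open>\<rho> ^ n\<close> of the window. The
  identity \<open>\<rho> * (b0 + \<rho> ^ n) = \<beta> * b0\<close> shows that \<open>b0\<close>
  compensates for it, because \<open>exp (- \<tau>) * \<beta>\<close> is at most 1.\<close>

lemma P_r_ge: "exp (- \<tau>) * \<rho> * r x \<le> P r x"
proof -
  let ?b = "exp (- \<tau>)"
  have b: "?b * \<beta> \<le> 1" "?b > 0" using \<beta>(2) by (auto simp: exp_minus field_simps)
  have "\<rho> * (d (Suc j) * u (Suc j) x) \<le> d j * u (Suc j) x" for j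
    using mult_right_mono[OF peak_Suc_le[of \<rho> n j] u_nonneg[of "Suc j" x]] \<rho>(1) \<rho>_less_1
    by (simp add: mult_ac del: u.simps)
  then have "(\<Sum>j. \<rho> * (d (Suc j) * u (Suc j) x)) \<le> (\<Sum>j. d j * u (Suc j) x)"
    by (intro suminf_le summable_du_Suc summable_mult summable_Suc_du)
  also have "(\<Sum>j. \<rho> * (d (Suc j) * u (Suc j) x)) = \<rho> * (r x - b0 - \<rho> ^ n)"
    by (simp only: suminf_mult[OF summable_Suc_du] suminf_Suc_du)
  finally have le: "\<rho> * (r x - b0 - \<rho> ^ n) \<le> (\<Sum>j. d j * u (Suc j) x)" .
  have nn: "0 \<le> (\<Sum>j. d j * u (Suc j) x)"
    by (intro suminf_nonneg summable_du_Suc mult_nonneg_nonneg d_nonneg u_nonneg)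
  have "?b * (\<rho> * (r x - b0 - \<rho> ^ n)) \<le> ?b * (\<Sum>j. d j * u (Suc j) x)"
    using le b by (intro mult_left_mono) auto
  also have "\<dots> \<le> D x * (\<Sum>j. d j * u (Suc j) x)"
    using nn by (intro mult_right_mono D_ge)
  finally have "?b * \<rho> * r x - ?b * \<rho> * (b0 + \<rho> ^ n) + b0 \<le> P r x"
    unfolding P_r by (simp add: algebra_simps)
  moreover have "?b * \<rho> * (b0 + \<rho> ^ n) \<le> b0"
  proof -
    have "b0 + \<rho> ^ n = \<beta> * \<rho> ^ n / (\<beta> - \<rho>)"
      using \<rho>_less_1 \<beta>(1) by (simp add: b0_def field_simps)
    then have "?b * \<rho> * (b0 + \<rho> ^ n) = (?b * \<beta>) * b0" by (simp add: b0_def)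
    also have "\<dots> \<le> 1 * b0" using b b0_pos by (intro mult_right_mono) auto
    finally show ?thesis by simp
  qed
  ultimately show ?thesis by linarith
qed

text \<open>The upper deviation is the larger one. After
  \<open>exp (- \<tau>) \<ge> 1 - \<tau>\<close> this comes down to
  \<open>(1 - \<rho>)\<^sup>2 + \<tau> * (1 - \<rho>\<^sup>2) \<ge> 0\<close>.\<close>

lemma abs_P_r_le: "\<bar>P r x - r x\<bar> \<le> ((1 + \<tau>) / \<rho> - 1) * r x"
proof -
  have "1 - \<tau> \<le> exp (- \<tau>)" using exp_ge_add_one_self[of "- \<tau>"] by simp
  then have "\<rho> * (1 - \<tau>) \<le> \<rho> * exp (- \<tau>)" using \<rho>(1) by (intro mult_left_mono) auto
  moreover have "2 + \<tau> * \<rho> \<le> \<rho> + (1 + \<tau>) / \<rho>"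
  proof -
    have "0 \<le> (1 - \<rho>)\<^sup>2 + \<tau> * (1 - \<rho>\<^sup>2)"
      using \<rho>(1) \<rho>_less_1 \<tau>_nonneg by (intro add_nonneg_nonneg mult_nonneg_nonneg) (auto simp: power_le_one)
    then show ?thesis using \<rho>(1) by (simp add: field_simps power2_eq_square)
  qed
  ultimately have "1 - ((1 + \<tau>) / \<rho> - 1) \<le> exp (- \<tau>) * \<rho>" by (simp add: algebra_simps)
  then have "(1 - ((1 + \<tau>) / \<rho> - 1)) * r x \<le> exp (- \<tau>) * \<rho> * r x"
    by (rule mult_right_mono[OF _ r_nonneg])
  then show ?thesis using P_r_ge[of x] P_r_le[of x] by (simp add: abs_le_iff algebra_simps)
qed

text \<open>The gap bounds the fluctuation of \<open>r\<close> by \<omega>/\<eta> times its full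
  norm. Pythagoras splits the squared norm into variance and squared mean, and \<omega> < \<eta>
  allows the inequality to be solved for the variance. \<open>T\<close> is any upper bound of
  \<omega> divided by the root of \<open>\<eta>\<^sup>2 - \<omega>\<^sup>2\<close>.\<close>

lemma nrm_r_centred:
  assumes \<omega>: "(1 + \<tau>) / \<rho> - 1 < \<eta>" and T: "T \<ge> 0" "((1 + \<tau>) / \<rho> - 1)\<^sup>2 \<le> T\<^sup>2 * (\<eta>\<^sup>2 - ((1 + \<tau>) / \<rho> - 1)\<^sup>2)"
  shows "nrm (\<lambda>x. r x - E r) \<le> T * E r"
proof -
  define \<omega> where "\<omega> = (1 + \<tau>) / \<rho> - 1"
  have \<omega>0: "\<omega> > 0" using \<rho>(1) \<rho>_less_1 \<tau>_nonneg by (simp add: \<omega>_def field_simps)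
  let ?V = "(nrm (\<lambda>x. r x - E r))\<^sup>2"
  have "nrm (\<lambda>x. P r x - r x) \<le> nrm (\<lambda>x. \<omega> * r x)"
    using abs_P_r_le \<omega>0 r_nonneg by (intro nrm_mono) (auto simp: \<omega>_def)
  then have "\<eta> * nrm (\<lambda>x. r x - E r) \<le> \<omega> * nrm r"
    using gap_centred[OF r_bdd] \<omega>0 by (simp add: nrm_cmult)
  then have "(\<eta> * nrm (\<lambda>x. r x - E r))\<^sup>2 \<le> (\<omega> * nrm r)\<^sup>2"
    using \<eta>_pos by (intro power_mono) auto
  moreover have "(nrm r)\<^sup>2 = ?V + (E r)\<^sup>2" using nrm_centred[OF r_bdd, of 0] by simp
  ultimately have "\<eta>\<^sup>2 * ?V \<le> \<omega>\<^sup>2 * (?V + (E r)\<^sup>2)" by (simp add: power_mult_distrib)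
  then have "(\<eta>\<^sup>2 - \<omega>\<^sup>2) * ?V \<le> \<omega>\<^sup>2 * (E r)\<^sup>2" by (simp add: algebra_simps)
  also have "\<dots> \<le> T\<^sup>2 * (\<eta>\<^sup>2 - \<omega>\<^sup>2) * (E r)\<^sup>2"
    using T(2) unfolding \<omega>_def by (rule mult_right_mono) simp
  finally have "(\<eta>\<^sup>2 - \<omega>\<^sup>2) * ?V \<le> (\<eta>\<^sup>2 - \<omega>\<^sup>2) * (T * E r)\<^sup>2" by (simp add: power_mult_distrib mult_ac)
  moreover have "\<eta>\<^sup>2 - \<omega>\<^sup>2 > 0"
    using \<omega> \<omega>0 unfolding \<omega>_def[symmetric] by (simp add: power_strict_mono)
  ultimately have "?V \<le> (T * E r)\<^sup>2" by simp
  then show ?thesis by (rule power2_le_imp_le[OF _ mult_nonneg_nonneg[OF T(1) E_nonneg[OF r_nonneg]]])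
qed

text \<open>The growth bounds for \<open>m\<close> compare the window with two geometric series,
  with ratio \<open>\<rho> * exp (- \<tau>)\<close> into the past and
  \<open>\<rho> / (1 + \<tau>)\<close> into the future. The past series is summed to infinity
  although time starts at 0; its terms of negative index are paid for by \<open>b0\<close>, since
  \<open>m n \<le> exp \<tau> ^ n\<close>.\<close>

lemma E_r_ge:
  "m n * (1 / (1 - \<rho> * exp (- \<tau>)) + 1 / ((1 + \<tau>) / \<rho> - 1)) \<le> E r"
proof -
  define b where "b = exp (- \<tau>)"
  define a where "a = 1 / (1 + \<tau>)"
  have b: "0 < b" "b \<le> 1" "b * \<beta> \<le> 1" using \<tau>_nonneg \<beta>(2) by (auto simp: b_def exp_minus field_simps)
  have a: "0 < a" "a \<le> 1" using \<tau>_nonneg by (auto simp: a_def)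
  have \<rho>b: "\<rho> * b < 1" using \<rho>(1) \<rho>_less_1 b by (meson le_less_trans less_imp_le mult_left_le)
  have \<rho>a: "\<rho> * a < 1" using \<rho>(1) \<rho>_less_1 a by (meson le_less_trans less_imp_le mult_left_le)
  have sm: "summable (\<lambda>j. d j * m j)"
    using summable_E[OF du_series] by (simp add: m_def)
  have "E r = (\<Sum>j. d j * m j) + b0"
  proof -
    have "E r = E (\<lambda>x. \<Sum>j. d j * u j x) + b0"
      unfolding r_def[abs_def] using suminf_bdd[OF du_series] by simp
    then show ?thesis by (simp add: E_suminf[OF du_series] m_def)
  qed
  moreover have "(\<Sum>j. d j * m j) = (\<Sum>i. d (i + Suc n) * m (i + Suc n)) + (\<Sum>j<Suc n. d j * m j)"
    by (rule suminf_split_initial_segment[OF sm])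
  moreover have "m n * ((1 - (\<rho> * b) ^ Suc n) / (1 - \<rho> * b)) \<le> (\<Sum>j<Suc n. d j * m j)"
  proof -
    have "m n * ((1 - (\<rho> * b) ^ Suc n) / (1 - \<rho> * b)) = (\<Sum>j<Suc n. m n * (\<rho> * b) ^ (n - j))"
      using sum_power_mult_power[of 1 "\<rho> * b" n] \<rho>b by (simp add: sum_distrib_left[symmetric])
    also have "\<dots> \<le> (\<Sum>j<Suc n. d j * m j)"
    proof (rule sum_mono)
      fix j assume "j \<in> {..<Suc n}"
      then have j: "j \<le> n" by simp
      have "m n \<le> exp \<tau> ^ (n - j) * m j" using m_add_le[of j "n - j"] j by simp
      then have "b ^ (n - j) * m n \<le> b ^ (n - j) * (exp \<tau> ^ (n - j) * m j)"
        using b by (intro mult_left_mono) auto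
      also have "\<dots> = m j" by (simp add: b_def exp_minus flip: power_mult_distrib)
      finally have "\<rho> ^ (n - j) * (b ^ (n - j) * m n) \<le> \<rho> ^ (n - j) * m j"
        using \<rho>(1) by (intro mult_left_mono) auto
      then show "m n * (\<rho> * b) ^ (n - j) \<le> d j * m j"
        using j by (simp add: peak_def power_mult_distrib mult_ac)
    qed
    finally show ?thesis .
  qed
  moreover have "m n * (1 / ((1 + \<tau>) / \<rho> - 1)) \<le> (\<Sum>i. d (i + Suc n) * m (i + Suc n))"
  proof -
    have s: "(\<lambda>i. m n * (\<rho> * a) * (\<rho> * a) ^ i) sums (m n * (\<rho> * a) * (1 / (1 - \<rho> * a)))"
      using \<rho>(1) a \<rho>a by (intro sums_mult geometric_sums) auto
    have "m n * (\<rho> * a) * (1 / (1 - \<rho> * a)) = (\<Sum>i. m n * (\<rho> * a) * (\<rho> * a) ^ i)"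
      using s by (simp add: sums_iff)
    also have "\<dots> \<le> (\<Sum>i. d (i + Suc n) * m (i + Suc n))"
    proof (rule suminf_le)
      fix i
      have "m n \<le> (1 + \<tau>) ^ Suc i * m (i + Suc n)"
        using m_le_add[of n "Suc i"] by (simp add: add.commute)
      then have "a ^ Suc i * m n \<le> a ^ Suc i * ((1 + \<tau>) ^ Suc i * m (i + Suc n))"
        using a by (intro mult_left_mono) auto
      also have "\<dots> = (a * (1 + \<tau>)) ^ Suc i * m (i + Suc n)"
        by (simp only: power_mult_distrib mult.assoc)
      also have "a * (1 + \<tau>) = 1" using \<tau>_nonneg by (simp add: a_def)
      finally have "\<rho> ^ Suc i * (a ^ Suc i * m n) \<le> \<rho> ^ Suc i * m (i + Suc n)"
        using \<rho>(1) by (intro mult_left_mono) auto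
      then show "m n * (\<rho> * a) * (\<rho> * a) ^ i \<le> d (i + Suc n) * m (i + Suc n)"
        by (simp add: peak_def power_mult_distrib mult_ac)
    qed (use s summable_ignore_initial_segment[OF sm, of "Suc n"] in \<open>auto simp: sums_iff\<close>)
    also have "m n * (\<rho> * a) * (1 / (1 - \<rho> * a)) = m n * (1 / ((1 + \<tau>) / \<rho> - 1))"
    proof -
      define X where "X = (1 + \<tau>) / \<rho>"
      have X: "X > 1" and eq: "\<rho> * a = 1 / X"
        using \<rho>(1) \<rho>_less_1 \<tau>_nonneg by (auto simp: X_def a_def field_simps)
      show ?thesis unfolding X_def[symmetric] eq using X by (simp add: field_simps)
    qed
    finally show ?thesis .
  qed
  moreover have "m n * ((\<rho> * b) ^ Suc n / (1 - \<rho> * b)) \<le> b0"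
  proof -
    have "b ^ n * m n \<le> b ^ n * (exp \<tau> ^ n * 1)"
      using m_add_le[of 0 n] b by (intro mult_left_mono) auto
    also have "\<dots> = 1" by (simp add: b_def exp_minus flip: power_mult_distrib)
    finally have 1: "b ^ n * m n \<le> 1" .
    have 2: "b / (1 - \<rho> * b) \<le> 1 / (\<beta> - \<rho>)"
      using b \<rho>b \<rho>_less_1 \<beta>(1) by (simp add: field_simps)
    have "(b ^ n * m n) * (b / (1 - \<rho> * b)) \<le> 1 * (1 / (\<beta> - \<rho>))"
      using 1 2 b \<rho>b by (intro mult_mono) auto
    then have "\<rho> ^ Suc n * ((b ^ n * m n) * (b / (1 - \<rho> * b))) \<le> \<rho> ^ Suc n * (1 * (1 / (\<beta> - \<rho>)))"
      using \<rho>(1) by (intro mult_left_mono) auto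
    then show ?thesis by (simp add: b0_def power_mult_distrib mult_ac)
  qed
  ultimately have "m n * ((1 - (\<rho> * b) ^ Suc n) / (1 - \<rho> * b)) + m n * (1 / ((1 + \<tau>) / \<rho> - 1))
      + m n * ((\<rho> * b) ^ Suc n / (1 - \<rho> * b)) \<le> E r" by linarith
  moreover have "m n * ((1 - (\<rho> * b) ^ Suc n) / (1 - \<rho> * b)) + m n * ((\<rho> * b) ^ Suc n / (1 - \<rho> * b))
      = m n * (1 / (1 - \<rho> * b))" by (simp add: diff_divide_distrib right_diff_distrib)
  ultimately show ?thesis by (simp add: b_def distrib_left)
qed

text \<open>The equation for \<open>P U - U\<close> is read twice. In norm, the gap bounds
  \<open>nrm U0\<close> by \<open>E U\<close> and \<open>N\<close>. Integrated, it bounds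
  \<open>c - K0\<close> by \<open>nrm U0\<close>, \<open>nrm r0\<close> and a negative multiple of
  \<open>E U\<close>. On inserting the first bound into the second, assumption
  \<open>\<beta>2\<close> cancels \<open>E U\<close>; what is left involves only the window.\<close>

lemma E_r_le:
  assumes Dl: "\<beta> * (1 + \<tau>) - 1 < \<eta>"
    and \<beta>2: "(\<beta> * v)\<^sup>2 \<le> (\<beta> - 1) * (\<eta> - (\<beta> * (1 + \<tau>) - 1))"
    and g: "g = \<beta> * v * (1 + \<tau>) / (\<eta> - (\<beta> * (1 + \<tau>) - 1))" "g < 1"
    and T: "T \<ge> 0" "nrm (\<lambda>x. r x - E r) \<le> T * E r"
  shows "E r * (1 - g - (v + g) * T) \<le> K0 * (1 - g)"
proof -
  define \<Delta> where "\<Delta> = \<eta> - (\<beta> * (1 + \<tau>) - 1)"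
  define p where "p = \<beta> * v"
  define c where "c = E r"
  define U0 where "U0 = (\<lambda>x. U x - E U)"
  define r0 where "r0 = (\<lambda>x. r x - c)"
  define N where "N = nrm (\<lambda>x. r x - K0)"
  have \<Delta>: "\<Delta> > 0" using Dl by (simp add: \<Delta>_def)
  have p0: "p \<ge> 0" using \<beta>(1) v_nonneg by (simp add: p_def)
  have g0: "g \<ge> 0" and g': "g = p * (1 + \<tau>) / \<Delta>"
    using p0 \<Delta> \<tau>_nonneg unfolding g(1) p_def[symmetric] \<Delta>_def[symmetric] by auto
  have c0: "c \<ge> 0" unfolding c_def by (intro E_nonneg r_nonneg)
  have EU: "E U \<ge> 0" by (intro E_nonneg U_nonneg)
  have bdd [simp]: "U0 \<in> bdd_borel" "r0 \<in> bdd_borel" by (simp_all add: U0_def r0_def)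
  show ?thesis
  \<comment> \<open>In the remaining case \<open>c - K0\<close> is positive, which is the sign
    needed to apply \<open>E D \<ge> 1\<close> to its coefficient.\<close>
  proof (cases "c \<le> K0")
    case True
    have "c * (1 - g - (v + g) * T) \<le> c * (1 - g)"
      using c0 v_nonneg g0 T(1) by (intro mult_left_mono) auto
    also have "\<dots> \<le> K0 * (1 - g)" using True g(2) by (intro mult_right_mono) auto
    finally show ?thesis by (simp add: c_def)
  next
    case False
    have LU: "P U x - U x = (\<beta> * D x - 1) * U0 x + E U * (\<beta> * (D x - 1)) + D x * (r x - K0) + E U * (\<beta> - 1)" for x
      unfolding P_U U0_def by (simp add: algebra_simps)
    have psi: "\<bar>\<beta> * D x - 1\<bar> \<le> \<beta> * (1 + \<tau>) - 1" for x
    proof -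
      have "\<beta> * D x \<le> \<beta> * (1 + \<tau>)" using D_le[of x] \<beta>(1) by (intro mult_left_mono) auto
      moreover have "1 - \<tau> \<le> D x" using D_ge[of x] exp_ge_add_one_self[of "- \<tau>"] by simp
      moreover have "1 * D x \<le> \<beta> * D x" using \<beta>(1) D_pos[of x] by (intro mult_right_mono) auto
      moreover have "1 + \<tau> \<le> \<beta> * (1 + \<tau>)" using \<beta>(1) \<tau>_nonneg mult_right_mono[of 1 \<beta> "1+\<tau>"] by simp
      ultimately show ?thesis unfolding abs_le_iff by linarith
    qed
    have mean0: "E (\<lambda>x. P U x - U x) = 0" by (simp add: E_P)
    \<comment> \<open>\<open>P U - U\<close> is centred, so removing the constant drift
      \<open>E U * (\<beta> - 1)\<close> can only increase the norm. The contribution of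
      \<open>E U\<close> left after this is proportional to the fluctuation of
      \<open>D\<close>.\<close>
    have "nrm (\<lambda>x. P U x - U x) \<le> nrm (\<lambda>x. (P U x - U x) - E U * (\<beta> - 1))"
      using nrm_centred_le[of "\<lambda>x. P U x - U x" "E U * (\<beta> - 1)"] by (simp only: mean0) simp
    also have "\<dots> = nrm (\<lambda>x. ((\<beta> * D x - 1) * U0 x + E U * (\<beta> * (D x - 1))) + D x * (r x - K0))"
      by (simp only: LU) simp
    also have "\<dots> \<le> nrm (\<lambda>x. (\<beta> * D x - 1) * U0 x + E U * (\<beta> * (D x - 1))) + nrm (\<lambda>x. D x * (r x - K0))"
      by (intro nrm_triangle) simp_all
    also have "nrm (\<lambda>x. (\<beta> * D x - 1) * U0 x + E U * (\<beta> * (D x - 1)))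
        \<le> nrm (\<lambda>x. (\<beta> * D x - 1) * U0 x) + nrm (\<lambda>x. E U * (\<beta> * (D x - 1)))"
      by (intro nrm_triangle) simp_all
    also have "nrm (\<lambda>x. (\<beta> * D x - 1) * U0 x) \<le> (\<beta> * (1 + \<tau>) - 1) * nrm U0"
      using psi by (intro nrm_mult_le) simp_all
    also have "nrm (\<lambda>x. E U * (\<beta> * (D x - 1))) \<le> E U * p"
      using EU \<beta>(1) nrm_D by (simp add: nrm_cmult p_def mult_left_mono)
    also have "nrm (\<lambda>x. D x * (r x - K0)) \<le> (1 + \<tau>) * N"
      unfolding N_def using D_le D_pos by (intro nrm_mult_le) (auto simp: abs_of_pos)
    finally have "\<eta> * nrm U0 \<le> (\<beta> * (1 + \<tau>) - 1) * nrm U0 + E U * p + (1 + \<tau>) * N"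
      using gap_centred[OF U_bdd] unfolding U0_def by simp
    then have n0: "\<Delta> * nrm U0 \<le> E U * p + (1 + \<tau>) * N" by (simp add: \<Delta>_def algebra_simps)

    have EU0: "E U0 = 0" and Er0: "E r0 = 0" by (simp_all add: U0_def r0_def c_def)
    \<comment> \<open>Here \<open>\<beta> * D - 1\<close> is split into
      \<open>\<beta> * (D - 1)\<close> and \<open>\<beta> - 1\<close>. The second part multiplies
      the centred \<open>U0\<close> and integrates to 0, so only the fluctuation of \<open>D\<close>
      acts on that of \<open>U\<close>.\<close>
    have LU': "P U x - U x = \<beta> * ((D x - 1) * U0 x) + (\<beta> - 1) * U0 x + E U * (\<beta> * D x) - E U
        + (D x - 1) * r0 x + r0 x + (c - K0) * D x" for x
      unfolding P_U U0_def r0_def by (simp add: algebra_simps)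
    have "0 = \<beta> * E (\<lambda>x. (D x - 1) * U0 x) + E U * (\<beta> * E D) - E U
        + E (\<lambda>x. (D x - 1) * r0 x) + (c - K0) * E D"
      using mean0 unfolding LU' by (simp add: EU0 Er0)
    moreover have "- (v * nrm U0) \<le> E (\<lambda>x. (D x - 1) * U0 x)"
      using Cauchy_Schwarz[of "\<lambda>x. D x - 1" U0] mult_right_mono[OF nrm_D nrm_nonneg[of U0]] by (simp add: abs_le_iff)
    then have "\<beta> * - (v * nrm U0) \<le> \<beta> * E (\<lambda>x. (D x - 1) * U0 x)"
      using \<beta>(1) by (intro mult_left_mono) auto
    moreover have "- (v * nrm r0) \<le> E (\<lambda>x. (D x - 1) * r0 x)"
      using Cauchy_Schwarz[of "\<lambda>x. D x - 1" r0] mult_right_mono[OF nrm_D nrm_nonneg[of r0]] by (simp add: abs_le_iff)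
    moreover have "E U * (\<beta> * 1) \<le> E U * (\<beta> * E D)"
      using EU \<beta>(1) E_D_ge by (intro mult_left_mono) auto
    moreover have "(c - K0) * 1 \<le> (c - K0) * E D"
      using False E_D_ge by (intro mult_left_mono) auto
    ultimately have main: "c - K0 \<le> p * nrm U0 - E U * (\<beta> - 1) + v * nrm r0"
      by (simp add: p_def algebra_simps)
    have "\<Delta> * (p * nrm U0) \<le> p * (E U * p + (1 + \<tau>) * N)"
      using mult_left_mono[OF n0 p0] by (simp add: mult_ac)
    also have "\<dots> = E U * p\<^sup>2 + \<Delta> * (g * N)"
      using \<Delta> by (simp add: g' power2_eq_square field_simps)
    also have "E U * p\<^sup>2 \<le> E U * ((\<beta> - 1) * \<Delta>)"
      using \<beta>2 EU unfolding p_def \<Delta>_def by (intro mult_left_mono)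
    finally have "\<Delta> * (p * nrm U0) \<le> \<Delta> * (E U * (\<beta> - 1) + g * N)" by (simp add: algebra_simps)
    then have "p * nrm U0 \<le> E U * (\<beta> - 1) + g * N" using \<Delta> by simp
    with main have "c - K0 \<le> g * N + v * nrm r0" by linarith
    also have "N \<le> nrm r0 + nrm (\<lambda>_. c - K0)"
      using nrm_triangle[of r0 "\<lambda>_. c - K0"] by (simp add: N_def r0_def)
    then have "g * N \<le> g * (nrm r0 + (c - K0))"
      using g0 False by (intro mult_left_mono) (auto simp: nrm_const)
    finally have "(c - K0) * (1 - g) \<le> (v + g) * nrm r0" by (simp add: algebra_simps)
    also have "\<dots> \<le> (v + g) * (T * c)"
      using T(2) v_nonneg g0 unfolding r0_def c_def by (intro mult_left_mono) auto
    finally show ?thesis by (simp add: c_def algebra_simps)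
  qed
qed

theorem tilted_mean_le:
  assumes \<omega>: "(1 + \<tau>) / \<rho> - 1 < \<eta>"
    and T: "T \<ge> 0" "((1 + \<tau>) / \<rho> - 1)\<^sup>2 \<le> T\<^sup>2 * (\<eta>\<^sup>2 - ((1 + \<tau>) / \<rho> - 1)\<^sup>2)"
    and Dl: "\<beta> * (1 + \<tau>) - 1 < \<eta>"
    and \<beta>2: "(\<beta> * v)\<^sup>2 \<le> (\<beta> - 1) * (\<eta> - (\<beta> * (1 + \<tau>) - 1))"
    and g: "g = \<beta> * v * (1 + \<tau>) / (\<eta> - (\<beta> * (1 + \<tau>) - 1))" "g < 1" "(v + g) * T \<le> 1 - g"
  shows "m n * (1 / (1 - \<rho> * exp (- \<tau>)) + 1 / ((1 + \<tau>) / \<rho> - 1)) * (1 - g - (v + g) * T)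
    \<le> \<beta> ^ n * (\<beta> / (\<beta> - \<rho>) + \<rho> * \<beta> / (1 - \<rho> * \<beta>)) * (1 - g)"
proof -
  have "m n * (1 / (1 - \<rho> * exp (- \<tau>)) + 1 / ((1 + \<tau>) / \<rho> - 1)) * (1 - g - (v + g) * T)
      \<le> E r * (1 - g - (v + g) * T)"
    using E_r_ge g(3) by (intro mult_right_mono) auto
  also have "\<dots> \<le> K0 * (1 - g)"
    by (rule E_r_le[OF Dl \<beta>2 g(1,2) T(1) nrm_r_centred[OF \<omega> T]])
  finally show ?thesis by (simp add: K0_def)
qed

end

section \<open>The stationary tail\<close>

context markov_operator
begin

text \<open>For the chain in state \<open>z\<close>, \<open>mean_sum f k z\<close> and
  \<open>square_sum f k z\<close> are the first and second moments of the sum of \<open>f\<close>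
  over the next \<open>k\<close> states, \<open>z\<close> excluded.\<close>

primrec mean_sum :: "('a \<Rightarrow> real) \<Rightarrow> nat \<Rightarrow> 'a \<Rightarrow> real" where
  "mean_sum f 0 = (\<lambda>_. 0)"
| "mean_sum f (Suc k) = P (\<lambda>y. f y + mean_sum f k y)"

primrec square_sum :: "('a \<Rightarrow> real) \<Rightarrow> nat \<Rightarrow> 'a \<Rightarrow> real" where
  "square_sum f 0 = (\<lambda>_. 0)"
| "square_sum f (Suc k) = P (\<lambda>y. (f y)\<^sup>2 + 2 * (f y * mean_sum f k y) + square_sum f k y)"

lemma mean_sum_bdd [simp]: "f \<in> bdd_borel \<Longrightarrow> mean_sum f k \<in> bdd_borel"
  by (induction k) auto

lemma square_sum_bdd [simp]: "f \<in> bdd_borel \<Longrightarrow> square_sum f k \<in> bdd_borel"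
  by (induction k) auto

lemma E_square_sum:
  assumes f: "f \<in> bdd_borel"
  shows "E (square_sum f n) = real n * (nrm f)\<^sup>2 + 2 * E (\<lambda>x. f x * (\<Sum>k<n. mean_sum f k x))"
proof (induction n)
  case (Suc n)
  have "E (square_sum f (Suc n)) = (nrm f)\<^sup>2 + 2 * E (\<lambda>x. f x * mean_sum f n x) + E (square_sum f n)"
    using f by (simp add: E_P nrm_square)
  moreover have "E (\<lambda>x. f x * (\<Sum>k<Suc n. mean_sum f k x))
      = E (\<lambda>x. f x * (\<Sum>k<n. mean_sum f k x)) + E (\<lambda>x. f x * mean_sum f n x)"
    using f by (simp add: distrib_left)
  ultimately show ?case by (simp add: Suc algebra_simps)
qed simp

end

context poincare_kernel
begin

text \<open>The increment \<open>?g (Suc k) - ?g k\<close> is the iterate of \<open>P\<close> of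
  order \<open>k + 1\<close> applied to \<open>f\<close>, hence no larger than \<open>f\<close> in
  norm. So \<open>P (?g n) - ?g n\<close> is bounded by \<open>2 * nrm f\<close>, and the gap bounds
  \<open>?g n\<close> uniformly in \<open>n\<close>. A second use of the gap, on the sum
  \<open>H\<close>, for which \<open>P H - H\<close> telescopes, gives linear growth.\<close>

lemma E_square_sum_le:
  assumes f: "f \<in> bdd_borel" and f0: "E f = 0"
  shows "E (square_sum f n) \<le> (nrm f)\<^sup>2 * (real n + 2 * real n / \<eta> + 4 / \<eta>\<^sup>2)"
proof -
  let ?g = "mean_sum f"
  define H where "H = (\<lambda>x. \<Sum>k<n. ?g k x)"
  have H [simp]: "H \<in> bdd_borel" unfolding H_def using f by auto
  have Pg: "P (?g k) x = ?g (Suc k) x - P f x" for k x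
    using f by (simp add: P_add)
  have Eg: "E (?g k) = 0" for k
    using f f0 by (induction k) (simp_all add: E_P)
  have incr: "nrm (\<lambda>x. ?g (Suc k) x - ?g k x) \<le> nrm f" for k
  proof (induction k)
    case 0
    show ?case using nrm_P[OF f] by simp
  next
    case (Suc k)
    have "(\<lambda>x. ?g (Suc (Suc k)) x - ?g (Suc k) x) = P (\<lambda>x. ?g (Suc k) x - ?g k x)"
      using f by (auto simp: P_add P_diff)
    then show ?case using nrm_P[of "\<lambda>x. ?g (Suc k) x - ?g k x"] Suc f by simp
  qed
  have "\<eta> * nrm (?g n) \<le> nrm (\<lambda>x. P (?g n) x - ?g n x)"
    using f Eg by (intro gap) auto
  also have "\<dots> = nrm (\<lambda>x. (?g (Suc n) x - ?g n x) - P f x)"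
    by (simp only: Pg) (simp add: algebra_simps)
  also have "\<dots> \<le> nrm (\<lambda>x. ?g (Suc n) x - ?g n x) + nrm (P f)"
    using f by (intro nrm_triangle_diff) (auto simp del: mean_sum.simps)
  also have "\<dots> \<le> 2 * nrm f" using incr[of n] nrm_P[OF f] by linarith
  finally have gn: "nrm (?g n) \<le> 2 * nrm f / \<eta>" using \<eta>_pos by (simp add: field_simps)
  have PH: "P H x - H x = ?g n x - real n * P f x" for x
  proof -
    have "P H x - H x = (\<Sum>k<n. ?g (Suc k) x - ?g k x - P f x)"
      unfolding H_def using f by (simp add: P_sum Pg sum_subtractf del: mean_sum.simps(2))
    also have "\<dots> = (\<Sum>k<n. ?g (Suc k) x - ?g k x) - real n * P f x"
      by (simp add: sum_subtractf del: mean_sum.simps(2))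
    finally show ?thesis using sum_lessThan_telescope[of "\<lambda>k. ?g k x" n] by (simp del: mean_sum.simps(2))
  qed
  have "\<eta> * nrm H \<le> nrm (\<lambda>x. P H x - H x)"
    by (intro gap) (simp_all add: H_def f Eg)
  also have "\<dots> = nrm (\<lambda>x. ?g n x - real n * P f x)" by (simp only: PH)
  also have "\<dots> \<le> nrm (?g n) + nrm (\<lambda>x. real n * P f x)"
    using f by (intro nrm_triangle_diff) auto
  also have "\<dots> \<le> 2 * nrm f / \<eta> + real n * nrm f"
    using gn nrm_P[OF f] by (simp add: nrm_cmult add_mono mult_left_mono)
  finally have nH: "nrm H \<le> nrm f * (2 / \<eta>\<^sup>2 + real n / \<eta>)"
    using \<eta>_pos by (simp add: field_simps power2_eq_square)
  have "E (\<lambda>x. f x * H x) \<le> nrm f * nrm H"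
    using Cauchy_Schwarz[OF f H] by linarith
  also have "\<dots> \<le> nrm f * (nrm f * (2 / \<eta>\<^sup>2 + real n / \<eta>))"
    using nH by (intro mult_left_mono) auto
  finally have "E (square_sum f n) \<le> real n * (nrm f)\<^sup>2 + 2 * (nrm f * (nrm f * (2 / \<eta>\<^sup>2 + real n / \<eta>)))"
    unfolding E_square_sum[OF f, of n] H_def by simp
  also have "\<dots> = (nrm f)\<^sup>2 * (real n + 2 * real n / \<eta> + 4 / \<eta>\<^sup>2)"
    by (simp add: power2_eq_square algebra_simps)
  finally show ?thesis .
qed

end

text \<open>This is the expectation of \<open>F\<close> at \<open>s\<close> plus the sum of
  \<open>f\<close> over the next \<open>k\<close> states after \<open>z\<close>. Carrying the
  running sum \<open>s\<close> as an argument makes an additive functional a function of a Markov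
  pair.\<close>

primrec path_value :: "('a \<Rightarrow> 'a measure) \<Rightarrow> ('a \<Rightarrow> real) \<Rightarrow> (real \<Rightarrow> real) \<Rightarrow> nat \<Rightarrow> 'a \<times> real \<Rightarrow> real" where
  "path_value K f F 0 = (\<lambda>(z, s). F s)"
| "path_value K f F (Suc k) = (\<lambda>(z, s). \<integral>y. path_value K f F k (y, s + f y) \<partial>K z)"

context markov_operator
begin

lemma path_value_measurable [measurable]:
  assumes [measurable]: "f \<in> borel_measurable borel" "F \<in> borel_measurable borel"
  shows "path_value K f F k \<in> borel_measurable (borel \<Otimes>\<^sub>M borel)"
proof (induction k)
  case (Suc k)
  note [measurable] = Suc
  have "K \<in> borel \<rightarrow>\<^sub>M subprob_algebra borel"
    using kernel unfolding markov_kernel_def by (rule measurable_prob_algebraD)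
  then have [measurable]: "(\<lambda>x. K (fst x)) \<in> borel \<Otimes>\<^sub>M borel \<rightarrow>\<^sub>M subprob_algebra borel"
    by (rule measurable_compose[OF measurable_fst])
  \<comment> \<open>Pushing \<open>K z\<close> forward to pairs fixes the integrand; the parameters
    \<open>z\<close> and \<open>s\<close> then enter through a kernel only.\<close>
  have dm: "(\<lambda>x. distr (K (fst x)) (borel \<Otimes>\<^sub>M borel) (\<lambda>y. (y, snd x + f y)))
      \<in> borel \<Otimes>\<^sub>M borel \<rightarrow>\<^sub>M subprob_algebra (borel \<Otimes>\<^sub>M (borel :: real measure))"
    by (rule measurable_distr2[where M=borel]) measurable
  have "path_value K f F (Suc k) = (\<lambda>x. \<integral>y. path_value K f F k y
      \<partial>distr (K (fst x)) (borel \<Otimes>\<^sub>M borel) (\<lambda>y. (y, snd x + f y)))"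
    by (intro ext) (subst integral_distr, auto simp: case_prod_beta)
  also have "\<dots> \<in> borel_measurable (borel \<Otimes>\<^sub>M borel)"
    by (rule measurable_compose[OF dm]) (rule integral_measurable_subprob_algebra[OF Suc])
  finally show ?case .
qed simp

lemma path_value_bounds:
  assumes f: "f \<in> borel_measurable borel" and F: "F \<in> borel_measurable borel" "\<And>s. 0 \<le> F s" "\<And>s. F s \<le> 1"
  shows path_value_nonneg: "0 \<le> path_value K f F k x"
    and path_value_le_1: "path_value K f F k x \<le> 1"
    and path_value_step_bdd: "(\<lambda>y. path_value K f F k (y, s + f y)) \<in> bdd_borel"
proof -
  have m: "(\<lambda>y. path_value K f F k (y, s + f y)) \<in> borel_measurable borel" for k s
    using f F(1) by measurable
  have *: "0 \<le> path_value K f F k x \<and> path_value K f F k x \<le> 1" for k x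
  proof (induction k arbitrary: x)
    case (Suc k)
    obtain z s where x: "x = (z, s)" by (cases x)
    have "P (\<lambda>_. 0) z \<le> P (\<lambda>y. path_value K f F k (y, s + f y)) z"
      "P (\<lambda>y. path_value K f F k (y, s + f y)) z \<le> P (\<lambda>_. 1) z"
      using Suc m[of k s] by (intro P_mono; auto intro: bdd_borelI[where B=1])+
    then show ?case by (simp add: x transition_op_def)
  qed (use F in \<open>auto split: prod.splits\<close>)
  show "0 \<le> path_value K f F k x" "path_value K f F k x \<le> 1" using * by auto
  show "(\<lambda>y. path_value K f F k (y, s + f y)) \<in> bdd_borel"
    using m * by (intro bdd_borelI[where B=1]) auto
qed

text \<open>Backward induction with a supersolution \<open>b\<close> of the recursion. The quadratic
  and the exponential tail bounds are two choices of \<open>b\<close>.\<close>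

lemma path_value_le:
  assumes f: "f \<in> borel_measurable borel" and F: "F \<in> borel_measurable borel" "\<And>s. 0 \<le> F s" "\<And>s. F s \<le> 1"
    and b0: "\<And>z s. F s \<le> b 0 z s"
    and b: "\<And>k s. (\<lambda>y. b k y (s + f y)) \<in> bdd_borel" "\<And>k z s. P (\<lambda>y. b k y (s + f y)) z \<le> b (Suc k) z s"
  shows "path_value K f F k (z, s) \<le> b k z s"
proof (induction k arbitrary: z s)
  case (Suc k)
  have "path_value K f F (Suc k) (z, s) = P (\<lambda>y. path_value K f F k (y, s + f y)) z"
    by (simp add: transition_op_def)
  also have "\<dots> \<le> P (\<lambda>y. b k y (s + f y)) z"
    using Suc by (intro P_mono path_value_step_bdd f F b) auto
  also have "\<dots> \<le> b (Suc k) z s" by (rule b)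
  finally show ?case .
qed (simp add: b0)

text \<open>The argument \<open>z\<close> is the state at time 1, whose value \<open>f z\<close> is
  already counted, so \<open>n - 1\<close> steps remain. Stationarity enters only on averaging over
  \<mu>.\<close>

definition stationary_tail :: "('a \<Rightarrow> real) \<Rightarrow> real \<Rightarrow> nat \<Rightarrow> 'a \<Rightarrow> real" where
  "stationary_tail f a n z = path_value K f (indicat_real {s. a \<le> \<bar>s\<bar>}) (n - 1) (z, f z)"

lemma stationary_tail_bdd:
  assumes "f \<in> borel_measurable borel"
  shows "stationary_tail f a n \<in> bdd_borel" "0 \<le> stationary_tail f a n z" "stationary_tail f a n z \<le> 1"
proof -
  have [measurable]: "indicat_real {s. a \<le> \<bar>s\<bar>} \<in> borel_measurable borel" by measurable
  show "stationary_tail f a n \<in> bdd_borel"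
    unfolding stationary_tail_def[abs_def]
    using path_value_step_bdd[OF assms, of "indicat_real {s. a \<le> \<bar>s\<bar>}" "n - 1" 0] by simp
  show "0 \<le> stationary_tail f a n z" "stationary_tail f a n z \<le> 1"
    unfolding stationary_tail_def by (intro path_value_nonneg path_value_le_1 assms; simp)+
qed

lemma stationary_tail_square_le:
  assumes f: "f \<in> bdd_borel" and a: "a > 0" and n: "n \<ge> 1"
  shows "E (stationary_tail f a n) \<le> E (square_sum f n) / a\<^sup>2"
proof -
  \<comment> \<open>This is the second moment of \<open>s\<close> plus the next \<open>k\<close>
    values, divided by \<open>a\<^sup>2\<close>, as in Chebyshev's inequality.\<close>
  define b where "b k z s = (s\<^sup>2 + 2 * s * mean_sum f k z + square_sum f k z) / a\<^sup>2" for k z s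
  have bb: "(\<lambda>y. b k y (s + f y)) \<in> bdd_borel" for k s
    unfolding b_def divide_inverse using f by simp
  have "path_value K f (indicat_real {s. a \<le> \<bar>s\<bar>}) k (z, s) \<le> b k z s" for k z s
  proof (rule path_value_le)
    show "indicat_real {s. a \<le> \<bar>s\<bar>} s \<le> b 0 z s" for z s
    proof -
      have "a\<^sup>2 \<le> s\<^sup>2" if "a \<le> \<bar>s\<bar>" using that a by (simp flip: abs_le_square_iff)
      then show ?thesis using a by (auto simp: b_def indicator_def)
    qed
    show "P (\<lambda>y. b k y (s + f y)) z \<le> b (Suc k) z s" for k z s
    proof -
      have "(\<lambda>y. b k y (s + f y)) = (\<lambda>y. (1 / a\<^sup>2) * (s\<^sup>2 + 2 * s * (f y + mean_sum f k y)
          + ((f y)\<^sup>2 + 2 * (f y * mean_sum f k y) + square_sum f k y)))"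
        unfolding b_def by (auto simp: power2_eq_square field_simps)
      then have "P (\<lambda>y. b k y (s + f y)) z = (1 / a\<^sup>2) * (s\<^sup>2 + 2 * s * P (\<lambda>y. f y + mean_sum f k y) z
          + P (\<lambda>y. (f y)\<^sup>2 + 2 * (f y * mean_sum f k y) + square_sum f k y) z)"
        using f by (simp only: P_cmult) (subst P_add; simp add: P_add P_cmult)
      then show ?thesis by (simp add: b_def)
    qed
  qed (use f bb in \<open>auto dest: bdd_borelD\<close>)
  then have "stationary_tail f a n z \<le> b (n - 1) z (f z)" for z
    unfolding stationary_tail_def .
  then have "E (stationary_tail f a n) \<le> E (\<lambda>z. b (n - 1) z (0 + f z))"
    using f bb[of "n - 1" 0] stationary_tail_bdd[OF bdd_borelD[OF f]] by (intro E_mono) auto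
  \<comment> \<open>By invariance one more \<open>P\<close> may be inserted; it turns the average
    over the state at time 1 into the last step of \<open>square_sum\<close>.\<close>
  also have "\<dots> = E (P (\<lambda>z. b (n - 1) z (0 + f z)))" by (rule E_P[OF bb, symmetric])
  also have "P (\<lambda>z. b (n - 1) z (0 + f z)) = (\<lambda>x. square_sum f n x / a\<^sup>2)"
  proof
    fix x
    have "(\<lambda>z. b (n - 1) z (0 + f z)) = (\<lambda>y. (1 / a\<^sup>2) * ((f y)\<^sup>2 + 2 * (f y * mean_sum f (n - 1) y) + square_sum f (n - 1) y))"
      unfolding b_def by (auto simp: mult.assoc)
    then have "P (\<lambda>z. b (n - 1) z (0 + f z)) x = (1 / a\<^sup>2) * square_sum f (Suc (n - 1)) x"
      by (simp only: P_cmult square_sum.simps)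
    then show "P (\<lambda>z. b (n - 1) z (0 + f z)) x = square_sum f n x / a\<^sup>2" using n by simp
  qed
  finally show ?thesis by simp
qed

end

context poincare_kernel
begin

lemma stationary_tail_exp_le:
  assumes f: "f \<in> bdd_borel" and n: "n \<ge> 1" and \<theta>: "\<theta> > 0"
    and t1: "tilted_kernel K \<mu> \<eta> (\<lambda>x. \<theta> * f x) \<tau> v" and t2: "tilted_kernel K \<mu> \<eta> (\<lambda>x. - (\<theta> * f x)) \<tau> v"
    and C1: "tilted_kernel.m K \<mu> (\<lambda>x. \<theta> * f x) n \<le> C" and C2: "tilted_kernel.m K \<mu> (\<lambda>x. - (\<theta> * f x)) n \<le> C"
  shows "E (stationary_tail f a n) \<le> 2 * C * exp (- (\<theta> * a))"
proof -
  interpret A: tilted_kernel K \<mu> \<eta> "\<lambda>x. \<theta> * f x" \<tau> v by fact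
  interpret B: tilted_kernel K \<mu> \<eta> "\<lambda>x. - (\<theta> * f x)" \<tau> v by fact
  \<comment> \<open>\<open>u k\<close> includes the factor of its starting state, whereas
    \<open>b\<close> concerns the states after \<open>z\<close>; hence the outer \<open>P\<close>.
    Opposite tilts cover the two tails: if \<open>a \<le> \<bar>s\<bar>\<close>, one of the two
    exponentials is at least 1 after the factor \<open>exp (- (\<theta> * a))\<close>.\<close>
  define b where "b k z s = exp (- (\<theta> * a)) * (exp (\<theta> * s) * P (A.u k) z + exp (- (\<theta> * s)) * P (B.u k) z)" for k z s
  have ebdd: "(\<lambda>x. exp (c * f x)) \<in> bdd_borel" for c
  proof -
    obtain M where M: "M \<ge> 0" "\<And>x. \<bar>f x\<bar> \<le> M" using f by (metis bdd_borelE)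
    have "c * f x \<le> \<bar>c\<bar> * M" for x
      using abs_ge_self[of "c * f x"] M mult_left_mono[OF M(2)[of x], of "\<bar>c\<bar>"] by (simp add: abs_mult)
    then show ?thesis using bdd_borelD[OF f] by (intro bdd_borelI[where B="exp (\<bar>c\<bar> * M)"]) auto
  qed
  have split: "exp (\<theta> * (s + f y)) = exp (\<theta> * s) * exp (\<theta> * f y)"
    "exp (- (\<theta> * (s + f y))) = exp (- (\<theta> * s)) * exp (- (\<theta> * f y))" for s y
    by (simp_all add: distrib_left exp_add right_diff_distrib exp_diff exp_minus divide_inverse)
  have bb: "(\<lambda>y. b k y (s + f y)) \<in> bdd_borel" for k s
    unfolding b_def split using ebdd[of \<theta>] ebdd[of "- \<theta>", unfolded mult_minus_left]
    by (intro bdd_borel_mult bdd_borel_add bdd_borel_const P_bdd A.u_bdd B.u_bdd)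
  have step: "exp (\<theta> * f y) * P (A.u k) y \<le> A.u (Suc k) y" "exp (- (\<theta> * f y)) * P (B.u k) y \<le> B.u (Suc k) y" for k y
    using mult_right_mono[OF exp_mult_damp_le[of "\<theta> * f y"] A.u_nonneg[of "Suc k" y]]
      mult_right_mono[OF exp_mult_damp_le[of "- (\<theta> * f y)"] B.u_nonneg[of "Suc k" y]]
    unfolding A.P_u B.P_u A.D_def B.D_def by (simp_all only: mult.assoc mult_1_left)
  have ble: "b k y (s + f y) \<le> exp (- (\<theta> * a)) * (exp (\<theta> * s) * A.u (Suc k) y + exp (- (\<theta> * s)) * B.u (Suc k) y)" for k y s
    unfolding b_def split mult.assoc
    by (intro mult_left_mono add_mono step) auto
  have "path_value K f (indicat_real {s. a \<le> \<bar>s\<bar>}) k (z, s) \<le> b k z s" for k z s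
  proof (rule path_value_le)
    show "indicat_real {s. a \<le> \<bar>s\<bar>} s \<le> b 0 z s" for z s
    proof (cases "a \<le> \<bar>s\<bar>")
      case True
      have "1 \<le> exp (- (\<theta> * a)) * exp (\<theta> * s) \<or> 1 \<le> exp (- (\<theta> * a)) * exp (- (\<theta> * s))"
      proof (cases "s \<ge> 0")
        case True
        then have "\<theta> * a \<le> \<theta> * s" using \<open>a \<le> \<bar>s\<bar>\<close> \<theta> by (intro mult_left_mono) auto
        then show ?thesis unfolding exp_add[symmetric] one_le_exp_iff by simp
      next
        case False
        then have "\<theta> * a \<le> \<theta> * (- s)" using \<open>a \<le> \<bar>s\<bar>\<close> \<theta> by (intro mult_left_mono) auto
        then show ?thesis unfolding exp_add[symmetric] one_le_exp_iff by simp
      qed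
      moreover have "0 \<le> exp (- (\<theta> * a)) * exp (\<theta> * s)" "0 \<le> exp (- (\<theta> * a)) * exp (- (\<theta> * s))" by auto
      ultimately have "1 \<le> exp (- (\<theta> * a)) * exp (\<theta> * s) + exp (- (\<theta> * a)) * exp (- (\<theta> * s))" by linarith
      then show ?thesis using True by (simp add: b_def distrib_left)
    qed (simp add: b_def)
    show "P (\<lambda>y. b k y (s + f y)) z \<le> b (Suc k) z s" for k z s
    proof -
      have "P (\<lambda>y. b k y (s + f y)) z \<le> P (\<lambda>y. exp (- (\<theta> * a)) * (exp (\<theta> * s) * A.u (Suc k) y + exp (- (\<theta> * s)) * B.u (Suc k) y)) z"
        by (rule P_mono[OF bb _ ble]) (intro bdd_borel_mult bdd_borel_add bdd_borel_const A.u_bdd B.u_bdd)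
      also have "\<dots> = b (Suc k) z s"
        unfolding b_def by (simp add: P_cmult P_add del: A.u.simps B.u.simps)
      finally show ?thesis .
    qed
  qed (use f bb in \<open>auto dest: bdd_borelD\<close>)
  then have "stationary_tail f a n z \<le> b (n - 1) z (0 + f z)" for z
    unfolding stationary_tail_def by simp
  also have "b (n - 1) z (0 + f z) \<le> exp (- (\<theta> * a)) * (A.u n z + B.u n z)" for z
    using ble[of "n - 1" z 0] n by (simp del: A.u.simps B.u.simps)
  finally have "E (stationary_tail f a n) \<le> E (\<lambda>z. exp (- (\<theta> * a)) * (A.u n z + B.u n z))"
    using f by (intro E_mono stationary_tail_bdd) (auto dest: bdd_borelD)
  also have "\<dots> = exp (- (\<theta> * a)) * (A.m n + B.m n)"
    by (simp add: A.m_def B.m_def)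
  also have "\<dots> \<le> exp (- (\<theta> * a)) * (C + C)" using C1 C2 by (intro mult_left_mono add_mono) auto
  finally show ?thesis by (simp add: mult_ac)
qed

end

section \<open>Rational estimates of the exponential function\<close>

lemma exp_mult_one_minus_half_le:
  fixes x :: real
  assumes "0 \<le> x"
  shows "exp x * (1 - x / 2) \<le> 1 + x / 2"
proof -
  \<comment> \<open>The difference vanishes at 0, and its derivative is nonnegative because
    \<open>1 - y \<le> exp (- y)\<close>. For \<open>x < 2\<close> this bounds \<open>exp x\<close>
    by its Pade quotient, whose error is of third order.\<close>
  have "(1 + 0 / 2) - exp 0 * (1 - 0 / 2) \<le> (1 + x / 2) - exp x * (1 - x / 2 :: real)"
  proof (rule DERIV_nonneg_imp_nondecreasing[OF assms])
    fix y :: real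
    have "((\<lambda>y. (1 + y / 2) - exp y * (1 - y / 2)) has_real_derivative (1 - exp y * (1 - y)) / 2) (at y)"
      by (auto intro!: derivative_eq_intros simp: field_simps)
    moreover have "exp y * (1 - y) \<le> exp y * exp (- y)"
      using exp_ge_add_one_self[of "- y"] by (intro mult_left_mono) auto
    then have "0 \<le> (1 - exp y * (1 - y)) / 2" by (simp flip: exp_add)
    ultimately show "\<exists>d. ((\<lambda>y. (1 + y / 2) - exp y * (1 - y / 2)) has_real_derivative d) (at y) \<and> 0 \<le> d"
      by blast
  qed
  then show ?thesis by simp
qed

text \<open>A rational lower bound of \<open>exp\<close>, by which
  \<open>C \<le> exp (X * G)\<close> can be checked in exact arithmetic.\<close>

lemma power_16_le_exp:
  fixes x :: real
  assumes "0 \<le> x"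
  shows "(1 + x / 16) ^ 16 \<le> exp x"
proof -
  have "(1 + x / 16) ^ 16 \<le> exp (x / 16) ^ 16"
    using assms exp_ge_add_one_self[of "x / 16"] by (intro power_mono) auto
  then show ?thesis by (simp flip: exp_of_nat_mult)
qed

lemma exp_nat_le: "exp (real k) \<le> (68 / 25) ^ k"
proof -
  have "exp 1 ^ k \<le> (68 / 25 :: real) ^ k" using e_less_272 by (intro power_mono) auto
  then show ?thesis by (simp flip: exp_of_nat_mult)
qed

lemma exp_quarter_le:
  assumes "(68 / 25) ^ k \<le> B ^ 4" "0 \<le> B"
  shows "exp (real k / 4) \<le> B"
proof (rule power_le_imp_le_base)
  have "exp (real k / 4) ^ 4 = exp (real k)" by (simp flip: exp_of_nat_mult)
  then show "exp (real k / 4) ^ Suc 3 \<le> B ^ Suc 3" using exp_nat_le[of k] assms(1) by simp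
qed (use assms in auto)

text \<open>This is the Chebyshev bound
  \<open>(4 * x + 1) / (16 * x\<^sup>2) \<le> 2 * exp (- x)\<close> cleared of denominators. It
  fails at 16/5, hence the threshold 3. On each cell from \<open>c\<close> to \<open>k / 4\<close> a
  constant \<open>B\<close> replaces \<open>exp x\<close>; the resulting inequality holds at
  \<open>c\<close>, and \<open>B \<le> 8 * c\<close> carries it to the right.\<close>

lemma exp_mult_affine_le:
  fixes x :: real
  assumes "69 / 100 \<le> x" "x \<le> 3"
  shows "exp x * (4 * x + 1) \<le> 32 * x\<^sup>2"
proof -
  have *: "exp x * (4 * x + 1) \<le> 32 * x\<^sup>2"
    if "c \<le> x" "x \<le> real k / 4" "(68 / 25) ^ k \<le> B ^ 4" "0 \<le> B" "0 \<le> c" "B * (4 * c + 1) \<le> 32 * c\<^sup>2" "B \<le> 8 * c" for c B k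
  proof -
    have "exp x \<le> exp (real k / 4)" using that by simp
    also have "\<dots> \<le> B" using that by (intro exp_quarter_le)
    finally have "exp x * (4 * x + 1) \<le> B * (4 * x + 1)" using assms by (intro mult_right_mono) auto
    also have "\<dots> = B * (4 * c + 1) + 4 * B * (x - c)" by (simp add: algebra_simps)
    also have "\<dots> \<le> 32 * c\<^sup>2 + 32 * (x + c) * (x - c)"
      using that assms by (intro add_mono mult_right_mono) auto
    also have "\<dots> = 32 * x\<^sup>2" by (simp add: power2_eq_square algebra_simps)
    finally show ?thesis .
  qed
  consider "x \<le> 1" | "1 \<le> x" "x \<le> 3/2" | "3/2 \<le> x" "x \<le> 2" | "2 \<le> x" "x \<le> 5/2" | "5/2 \<le> x" "x \<le> 11/4" | "11/4 \<le> x"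
    by linarith
  then show ?thesis
  proof cases
    case 1 show ?thesis by (rule *[of "69/100" 4 "68/25"]) (use assms 1 in \<open>simp_all add: power2_eq_square power_divide\<close>)
  next
    case 2 then show ?thesis by (intro *[of 1 6 "9/2"]) (simp_all add: power2_eq_square power_divide)
  next
    case 3 then show ?thesis by (intro *[of "3/2" 8 "37/5"]) (simp_all add: power2_eq_square power_divide)
  next
    case 4 then show ?thesis by (intro *[of 2 10 "123/10"]) (simp_all add: power2_eq_square power_divide)
  next
    case 5 then show ?thesis by (intro *[of "5/2" 11 "16"]) (simp_all add: power2_eq_square power_divide)
  next
    case 6 then show ?thesis using assms by (intro *[of "11/4" 12 "20124/1000"]) (simp_all add: power2_eq_square power_divide)
  qed
qed

section \<open>Growth of the tilted mean with explicit constants\<close>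

context tilted_kernel
begin

text \<open>All parameters are measured in units of the gap, with
  \<open>\<rho> = 1 / (1 + s * \<eta>)\<close> and \<open>\<beta> = 1 + l * \<eta>\<close>. Primed
  quantities in the proof are the actual ones; \<Omega>, \<Delta> and \<gamma> are their worst
  values, taken at the upper bounds \<open>e\<close>, \<open>zm\<close> and \<open>lm\<close>. The
  estimates of the two geometric factors \<open>S\<close> and \<open>Kc\<close> both contain
  \<open>1 / \<eta>\<close>, which cancels, so \<open>C\<close> stays bounded for small gaps. A
  larger \<open>s\<close> improves the ratio \<open>s * (s + t) / (s\<^sup>2 - lm\<^sup>2)\<close>
  but enlarges \<Omega>, hence \<open>T\<close> and \<kappa>.\<close>

lemma m_le_geometric:
  fixes e t s z zm l lm h T \<kappa> C :: real
  assumes \<eta>e: "\<eta> \<le> e" and \<tau>t: "\<tau> = t * \<eta>" and vz: "v = z * \<eta>" and z: "0 \<le> z" "z \<le> zm"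
    and l: "l = h * z\<^sup>2" and lm: "lm = h * zm\<^sup>2" and h: "0 \<le> h"
    and ts: "0 < t" "0 < s" "t < s * (1 - t * e / 2)"
    and \<Omega>: "\<Omega> = t + s + t * s * e" "\<Omega> < 1" and T: "0 \<le> T" "\<Omega>\<^sup>2 \<le> T\<^sup>2 * (1 - \<Omega>\<^sup>2)"
    and \<Delta>: "\<Delta> = 1 - t - lm * (1 + t * e)" "0 < \<Delta>" "(1 + lm * e)\<^sup>2 \<le> h * \<Delta>"
    and lm_less: "lm < t" "lm < s"
    and g: "\<gamma> = (1 + lm * e) * zm * (1 + t * e) / \<Delta>" "\<gamma> < 1" "(zm * e + \<gamma>) * T \<le> \<kappa> * (1 - \<gamma>)" "\<kappa> < 1"
    and C: "s * (s + t + s * t * e / 2) * (1 + e * lm / 2) / ((s\<^sup>2 - lm\<^sup>2) * (1 - \<kappa>)) \<le> C"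
  shows "m n \<le> C * (1 + l * \<eta>) ^ n"
proof -
  note \<eta> = \<eta>_pos
  have e: "e > 0" using \<eta> \<eta>e by simp
  have zz: "z\<^sup>2 \<le> zm\<^sup>2" using z by (simp add: power_mono)
  have l0: "0 \<le> l" "l \<le> lm" using h zz unfolding l lm by (auto intro: mult_left_mono)
  have lm0: "0 \<le> lm" using l0 by simp
  have l_less: "l < t" "l < s" using l0 lm_less by auto
  define \<rho> where "\<rho> = 1 / (1 + s * \<eta>)"
  define \<beta> where "\<beta> = 1 + l * \<eta>"
  have \<rho>: "0 < \<rho>" using ts \<eta> by (simp add: \<rho>_def add_pos_pos)
  have te: "t * \<eta> \<le> t * e" using ts \<eta>e by (intro mult_left_mono) auto
  have half: "0 < 1 - t * \<eta> / 2"
  proof -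
    have "0 < s * (1 - t * e / 2)" using ts by linarith
    then have "0 < 1 - t * e / 2" using ts(2) zero_less_mult_pos by blast
    then show ?thesis using te by simp
  qed
  have exp_\<tau>: "exp \<tau> * (1 - t * \<eta> / 2) \<le> 1 + t * \<eta> / 2"
    using exp_mult_one_minus_half_le[of \<tau>] \<tau>_nonneg by (simp add: \<tau>t)
  have "s * (1 - t * e / 2) \<le> s * (1 - t * \<eta> / 2)" using te ts by (intro mult_left_mono) auto
  then have "t < s * (1 - t * \<eta> / 2)" using ts by linarith
  then have "t * \<eta> < s * (1 - t * \<eta> / 2) * \<eta>" using \<eta> by (intro mult_strict_right_mono) auto
  then have "exp \<tau> * (1 - t * \<eta> / 2) < (1 + s * \<eta>) * (1 - t * \<eta> / 2)"
  proof -
    have "(1 + s * \<eta>) * (1 - t * \<eta> / 2) = (1 - t * \<eta> / 2) + s * (1 - t * \<eta> / 2) * \<eta>"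
      by (simp add: algebra_simps)
    then show ?thesis using exp_\<tau> \<open>t * \<eta> < s * (1 - t * \<eta> / 2) * \<eta>\<close> by linarith
  qed
  then have "exp \<tau> < 1 + s * \<eta>" using half by simp
  then have \<rho>2: "\<rho> * exp \<tau> < 1" using ts \<eta> by (simp add: \<rho>_def add_pos_pos)
  have \<beta>1: "1 \<le> \<beta>" using l0 \<eta> by (simp add: \<beta>_def)
  have "\<beta> < 1 + t * \<eta>" using l_less \<eta> by (simp add: \<beta>_def)
  then have \<beta>2: "\<beta> < exp \<tau>" using exp_ge_add_one_self[of "t * \<eta>"] unfolding \<tau>t by linarith
  interpret tilted_window K \<mu> \<eta> \<phi> \<tau> v \<rho> \<beta> n
    by unfold_locales (fact \<rho> \<rho>2 \<beta>1 \<beta>2)+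

  define \<Omega>' where "\<Omega>' = t + s + t * s * \<eta>"
  have ts0: "0 \<le> t * s" using ts by simp
  have \<Omega>': "0 < \<Omega>'" "\<Omega>' \<le> \<Omega>"
    using ts \<eta> mult_left_mono[OF \<eta>e ts0] by (auto simp: \<Omega>'_def \<Omega>(1) intro!: add_pos_pos)
  have \<omega>: "(1 + \<tau>) / \<rho> - 1 = \<eta> * \<Omega>'" by (simp add: \<rho>_def \<tau>t \<Omega>'_def algebra_simps)
  have \<omega>_less: "(1 + \<tau>) / \<rho> - 1 < \<eta>" unfolding \<omega> using \<Omega>' \<Omega>(2) \<eta> by simp
  have "\<Omega>'\<^sup>2 \<le> \<Omega>\<^sup>2" using \<Omega>' by (intro power_mono) auto
  then have "\<Omega>'\<^sup>2 * (1 + T\<^sup>2) \<le> \<Omega>\<^sup>2 * (1 + T\<^sup>2)" by (intro mult_right_mono) auto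
  then have "\<Omega>'\<^sup>2 \<le> T\<^sup>2 * (1 - \<Omega>'\<^sup>2)" using T(2) by (simp add: algebra_simps)
  then have "\<eta>\<^sup>2 * \<Omega>'\<^sup>2 \<le> \<eta>\<^sup>2 * (T\<^sup>2 * (1 - \<Omega>'\<^sup>2))" by (intro mult_left_mono) auto
  then have T': "((1 + \<tau>) / \<rho> - 1)\<^sup>2 \<le> T\<^sup>2 * (\<eta>\<^sup>2 - ((1 + \<tau>) / \<rho> - 1)\<^sup>2)"
    unfolding \<omega> by (simp add: power_mult_distrib algebra_simps)

  define \<Delta>' where "\<Delta>' = 1 - t - l * (1 + t * \<eta>)"
  have te1: "1 + t * \<eta> \<le> 1 + t * e" "0 \<le> 1 + t * \<eta>" using te ts \<eta> by auto
  have "l * (1 + t * \<eta>) \<le> lm * (1 + t * e)" using l0 lm0 te1 by (intro mult_mono) auto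
  then have \<Delta>': "\<Delta> \<le> \<Delta>'" "0 < \<Delta>'" using \<Delta> by (auto simp: \<Delta>'_def)
  have D_eq: "\<eta> - (\<beta> * (1 + \<tau>) - 1) = \<eta> * \<Delta>'" by (simp add: \<beta>_def \<tau>t \<Delta>'_def algebra_simps)
  have D_pos': "\<beta> * (1 + \<tau>) - 1 < \<eta>" using D_eq \<Delta>'(2) \<eta> mult_pos_pos[of \<eta> \<Delta>'] by linarith
  have le: "l * \<eta> \<le> lm * e" using l0 lm0 \<eta>e \<eta> by (intro mult_mono) auto
  have "\<beta>\<^sup>2 \<le> (1 + lm * e)\<^sup>2" using le l0 \<eta> by (intro power_mono) (auto simp: \<beta>_def)
  also have "\<dots> \<le> h * \<Delta>'" using \<Delta>(3) mult_left_mono[OF \<Delta>'(1) h] by linarith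
  finally have "\<beta>\<^sup>2 * (z\<^sup>2 * \<eta>\<^sup>2) \<le> h * \<Delta>' * (z\<^sup>2 * \<eta>\<^sup>2)" by (intro mult_right_mono) auto
  then have \<beta>v: "(\<beta> * v)\<^sup>2 \<le> (\<beta> - 1) * (\<eta> - (\<beta> * (1 + \<tau>) - 1))"
    unfolding D_eq by (simp add: \<beta>_def vz l power_mult_distrib power2_eq_square mult_ac)

  define g' where "g' = \<beta> * v * (1 + \<tau>) / (\<eta> - (\<beta> * (1 + \<tau>) - 1))"
  have g'_eq: "g' = (1 + l * \<eta>) * z * (1 + t * \<eta>) / \<Delta>'"
    unfolding g'_def D_eq using \<eta> by (simp add: \<beta>_def vz \<tau>t)
  have g'0: "0 \<le> g'" unfolding g'_eq using l0 \<eta> z te1 \<Delta>' by auto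
  have "(1 + l * \<eta>) * z * (1 + t * \<eta>) \<le> (1 + lm * e) * zm * (1 + t * e)"
    using le z te1 l0 lm0 \<eta> e by (intro mult_mono mult_nonneg_nonneg) auto
  then have g'_le: "g' \<le> \<gamma>" unfolding g'_eq g(1)
    using \<Delta>' \<Delta>(2) l0 lm0 \<eta> z te1 e ts by (intro frac_le) auto
  have "v + g' \<le> zm * e + \<gamma>" using g'_le z \<eta>e \<eta> unfolding vz by (intro add_mono mult_mono) auto
  then have "(v + g') * T \<le> (zm * e + \<gamma>) * T" using T(1) by (intro mult_right_mono) auto
  also note g(3)
  finally have vgT: "(v + g') * T \<le> \<kappa> * (1 - \<gamma>)" .
  have g'1: "g' < 1" using g'_le g(2) by simp
  have "0 \<le> (v + g') * T" using v_nonneg g'0 T(1) by simp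
  then have "0 \<le> \<kappa> * (1 - \<gamma>)" using vgT by linarith
  then have \<kappa>0: "0 \<le> \<kappa>" using g(2) by (simp add: zero_le_mult_iff)
  have "\<kappa> * (1 - \<gamma>) \<le> \<kappa> * (1 - g')" using \<kappa>0 g'_le by (intro mult_left_mono) auto
  then have q: "(1 - \<kappa>) * (1 - g') \<le> 1 - g' - (v + g') * T" using vgT by (simp add: algebra_simps)
  have "\<kappa> * (1 - g') \<le> 1 * (1 - g')" using g(4) g'1 by (intro mult_right_mono) auto
  then have vgT1: "(v + g') * T \<le> 1 - g'" using q by (simp add: algebra_simps)

  define S where "S = 1 / (1 - \<rho> * exp (- \<tau>)) + 1 / ((1 + \<tau>) / \<rho> - 1)"
  define Kc where "Kc = \<beta> / (\<beta> - \<rho>) + \<rho> * \<beta> / (1 - \<rho> * \<beta>)"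
  have main: "m n * S * (1 - g' - (v + g') * T) \<le> \<beta> ^ n * Kc * (1 - g')"
    unfolding S_def Kc_def by (rule tilted_mean_le[OF \<omega>_less T(1) T' D_pos' \<beta>v g'_def g'1 vgT1])
  define A where "A = s + t + s * t * \<eta> / 2"
  have A0: "A > 0" using ts \<eta> by (auto simp: A_def intro!: add_pos_pos)
  \<comment> \<open>\<open>S\<close> equals 1 plus the reciprocals of \<open>\<omega>b\<close> and
    of the smaller \<omega>. Replacing \<omega> by \<open>\<omega>b\<close> and bounding
    \<open>exp \<tau>\<close> by its Pade quotient leaves a rational expression.\<close>
  have S_ge: "(2 + \<eta> * s) / (\<eta> * A) \<le> S"
  proof -
    define \<omega>b where "\<omega>b = exp \<tau> * (1 + s * \<eta>) - 1"
    have s\<eta>: "1 + s * \<eta> > 0" using ts \<eta> by (simp add: add_pos_pos)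
    have "1 + \<tau> \<le> exp \<tau>" by (rule exp_ge_add_one_self)
    then have "(1 + \<tau>) * (1 + s * \<eta>) \<le> exp \<tau> * (1 + s * \<eta>)" using s\<eta> by (intro mult_right_mono) auto
    then have \<omega>b: "\<eta> * \<Omega>' \<le> \<omega>b" by (simp add: \<omega>b_def \<tau>t \<Omega>'_def algebra_simps)
    have \<omega>b0: "\<omega>b > 0" using \<omega>b \<Omega>' \<eta> mult_pos_pos[of \<eta> \<Omega>'] by linarith
    have "\<rho> * exp (- \<tau>) = 1 / (\<omega>b + 1)" by (simp add: \<rho>_def \<omega>b_def exp_minus field_simps)
    then have "1 / (1 - \<rho> * exp (- \<tau>)) = 1 + 1 / \<omega>b" using \<omega>b0 by (simp only:) (simp add: field_simps)
    moreover have "1 / \<omega>b \<le> 1 / ((1 + \<tau>) / \<rho> - 1)"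
      unfolding \<omega> using \<omega>b \<Omega>' \<eta> \<omega>b0 by (intro divide_left_mono mult_pos_pos) auto
    ultimately have "1 + 2 / \<omega>b \<le> S" unfolding S_def by simp
    moreover have "\<omega>b * (1 - t * \<eta> / 2) \<le> \<eta> * A"
    proof -
      have "\<omega>b * (1 - t * \<eta> / 2) = exp \<tau> * (1 - t * \<eta> / 2) * (1 + s * \<eta>) - (1 - t * \<eta> / 2)"
        by (simp add: \<omega>b_def algebra_simps)
      also have "\<dots> \<le> (1 + t * \<eta> / 2) * (1 + s * \<eta>) - (1 - t * \<eta> / 2)"
        using exp_\<tau> s\<eta> by (intro diff_mono mult_right_mono) auto
      also have "\<dots> = \<eta> * A" by (simp add: A_def field_simps)
      finally show ?thesis .
    qed
    then have "2 * (1 - t * \<eta> / 2) / (\<eta> * A) \<le> 2 / \<omega>b"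
      using \<omega>b0 A0 \<eta> by (simp add: field_simps)
    moreover have "1 + 2 * (1 - t * \<eta> / 2) / (\<eta> * A) = (2 + \<eta> * s + \<eta> * (s * t * \<eta> / 2)) / (\<eta> * A)"
    proof -
      have "\<eta> * A \<noteq> 0" using A0 \<eta> by simp
      then have "1 + 2 * (1 - t * \<eta> / 2) / (\<eta> * A) = (\<eta> * A + 2 * (1 - t * \<eta> / 2)) / (\<eta> * A)"
        by (simp add: add_divide_distrib)
      also have "\<eta> * A + 2 * (1 - t * \<eta> / 2) = 2 + \<eta> * s + \<eta> * (s * t * \<eta> / 2)"
        by (simp add: A_def algebra_simps)
      finally show ?thesis .
    qed
    moreover have "(2 + \<eta> * s) / (\<eta> * A) \<le> (2 + \<eta> * s + \<eta> * (s * t * \<eta> / 2)) / (\<eta> * A)"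
      using A0 \<eta> ts by (intro divide_right_mono) auto
    ultimately show ?thesis by linarith
  qed
  have S0: "S > 0"
  proof -
    have "0 < (2 + \<eta> * s) / (\<eta> * A)" using A0 \<eta> ts by (intro divide_pos_pos mult_pos_pos add_pos_pos) auto
    then show ?thesis using S_ge by linarith
  qed
  have Kc_le: "Kc \<le> s / (s - l) * ((2 + \<eta> * (s + l)) / (\<eta> * (s + l)))"
  proof -
    have s\<eta>: "1 + s * \<eta> > 0" using ts \<eta> by (simp add: add_pos_pos)
    have sl: "s - l > 0" "s + l > 0" using l_less l0 ts by auto
    have b1: "\<beta> * (1 + s * \<eta>) - 1 = \<eta> * (s + l) + l * s * \<eta>\<^sup>2"
      by (simp add: \<beta>_def power2_eq_square algebra_simps)
    have b1': "\<eta> * (s + l) \<le> \<beta> * (1 + s * \<eta>) - 1" unfolding b1 using l0 ts by auto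
    have b1p: "0 < \<eta> * (s + l)" using sl \<eta> by simp
    have "\<beta> - \<rho> = (\<beta> * (1 + s * \<eta>) - 1) / (1 + s * \<eta>)" using s\<eta> by (simp add: \<rho>_def field_simps)
    then have "\<beta> / (\<beta> - \<rho>) = \<beta> * (1 + s * \<eta>) / (\<beta> * (1 + s * \<eta>) - 1)" by simp
    also have "\<dots> = 1 + 1 / (\<beta> * (1 + s * \<eta>) - 1)"
      using b1' b1p by (simp add: divide_simps)
    also have "\<dots> \<le> 1 + 1 / (\<eta> * (s + l))"
      using b1' b1p by (intro add_left_mono divide_left_mono) auto
    finally have 1: "\<beta> / (\<beta> - \<rho>) \<le> 1 + 1 / (\<eta> * (s + l))" .
    have "1 - \<rho> * \<beta> = \<eta> * (s - l) / (1 + s * \<eta>)" using s\<eta> by (simp add: \<rho>_def \<beta>_def field_simps)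
    then have 2: "\<rho> * \<beta> / (1 - \<rho> * \<beta>) = (1 + l * \<eta>) / (\<eta> * (s - l))"
      using s\<eta> by (simp add: \<rho>_def \<beta>_def)
    have "1 + 1 / (\<eta> * (s + l)) + (1 + l * \<eta>) / (\<eta> * (s - l)) = s / (s - l) * ((2 + \<eta> * (s + l)) / (\<eta> * (s + l)))"
      using sl \<eta> by (simp add: divide_simps) (simp add: algebra_simps)
    then show ?thesis using 1 2 unfolding Kc_def by linarith
  qed
  have Kc_S: "Kc \<le> s / (s\<^sup>2 - l\<^sup>2) * (A * (1 + \<eta> * l / 2)) * S"
  proof -
    have sl: "s - l > 0" "s + l > 0" using l_less l0 ts by auto
    have sq: "s\<^sup>2 - l\<^sup>2 = (s - l) * (s + l)" by (simp add: power2_eq_square algebra_simps)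
    \<comment> \<open>The two sides differ by \<open>\<eta>\<^sup>2 * s * l / 2\<close> only, and
      the factor \<open>2 + \<eta> * s\<close> on the right is the one that occurs in
      \<open>S_ge\<close>.\<close>
    have "2 + \<eta> * (s + l) \<le> (2 + \<eta> * s) * (1 + \<eta> * l / 2)"
      using \<eta> ts l0 by (simp add: algebra_simps)
    then have "s / (s - l) * ((2 + \<eta> * (s + l)) / (\<eta> * (s + l)))
        \<le> s / (s - l) * ((2 + \<eta> * s) * (1 + \<eta> * l / 2) / (\<eta> * (s + l)))"
      using sl \<eta> ts by (intro mult_left_mono divide_right_mono) auto
    also have "\<dots> = s / (s\<^sup>2 - l\<^sup>2) * (A * (1 + \<eta> * l / 2)) * ((2 + \<eta> * s) / (\<eta> * A))"
      unfolding sq using sl A0 \<eta> by (simp add: divide_simps)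
    also have "\<dots> \<le> s / (s\<^sup>2 - l\<^sup>2) * (A * (1 + \<eta> * l / 2)) * S"
      using S_ge sl A0 \<eta> ts l0 unfolding sq by (intro mult_left_mono) auto
    finally show ?thesis using Kc_le by linarith
  qed
  have sl2: "0 < s\<^sup>2 - lm\<^sup>2" "s\<^sup>2 - lm\<^sup>2 \<le> s\<^sup>2 - l\<^sup>2"
    using lm_less lm0 l0 ts by (auto intro!: power_strict_mono power_mono)
  have A_le: "A \<le> s + t + s * t * e / 2"
    using \<eta>e ts by (simp add: A_def mult_left_mono)
  have el: "1 + \<eta> * l / 2 \<le> 1 + e * lm / 2" using le by (simp add: mult.commute)
  have "s / (s\<^sup>2 - l\<^sup>2) * (A * (1 + \<eta> * l / 2)) \<le> s / (s\<^sup>2 - lm\<^sup>2) * ((s + t + s * t * e / 2) * (1 + e * lm / 2))"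
  proof (rule mult_mono)
    show "s / (s\<^sup>2 - l\<^sup>2) \<le> s / (s\<^sup>2 - lm\<^sup>2)"
      using sl2 ts by (intro divide_left_mono mult_pos_pos) linarith+
    show "A * (1 + \<eta> * l / 2) \<le> (s + t + s * t * e / 2) * (1 + e * lm / 2)"
      using A_le el A0 \<eta> l0 by (intro mult_mono) auto
    show "0 \<le> s / (s\<^sup>2 - lm\<^sup>2)" using sl2 ts by (intro divide_nonneg_pos) linarith+
    show "0 \<le> A * (1 + \<eta> * l / 2)" using A0 \<eta> l0 by auto
  qed
  also have "\<dots> = s * (s + t + s * t * e / 2) * (1 + e * lm / 2) / ((s\<^sup>2 - lm\<^sup>2) * (1 - \<kappa>)) * (1 - \<kappa>)"
    using g(4) sl2 by (simp add: divide_simps)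
  also have "\<dots> \<le> C * (1 - \<kappa>)" using C g(4) by (intro mult_right_mono) auto
  finally have "s / (s\<^sup>2 - l\<^sup>2) * (A * (1 + \<eta> * l / 2)) * S \<le> C * (1 - \<kappa>) * S"
    using S0 by (intro mult_right_mono) auto
  then have KC: "Kc \<le> C * (1 - \<kappa>) * S" using Kc_S by linarith
  have "m n * S * ((1 - \<kappa>) * (1 - g')) \<le> m n * S * (1 - g' - (v + g') * T)"
    using q m_nonneg S0 by (intro mult_left_mono) auto
  also note main
  also have "\<beta> ^ n * Kc * (1 - g') \<le> \<beta> ^ n * (C * (1 - \<kappa>) * S) * (1 - g')"
    using KC \<beta>1 g'1 by (intro mult_right_mono mult_left_mono) auto
  finally have "m n * (S * ((1 - \<kappa>) * (1 - g'))) \<le> (C * \<beta> ^ n) * (S * ((1 - \<kappa>) * (1 - g')))"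
    by (simp add: mult_ac)
  moreover have "0 < S * ((1 - \<kappa>) * (1 - g'))" using S0 g(4) g'1 by simp
  ultimately have "m n \<le> C * \<beta> ^ n" by (rule mult_right_le_imp_le)
  then show ?thesis by (simp add: \<beta>_def)
qed

end

section \<open>The claimed exponent and its reduction to numerical cells\<close>

locale bernstein_setting = poincare_kernel K \<mu> \<eta>
  for K :: "'a::topological_space \<Rightarrow> 'a measure" and \<mu> and \<eta> +
  fixes f :: "'a \<Rightarrow> real" and M \<sigma> \<delta> :: real and n :: nat
  assumes f_meas: "f \<in> borel_measurable borel" and f_le: "\<And>x. \<bar>f x\<bar> \<le> M" and f_mean: "E f = 0"
    and f_nrm: "nrm f \<le> \<sigma>" and \<sigma>: "0 < \<sigma>" "\<sigma> \<le> M" and \<delta>: "0 < \<delta>" "\<delta> \<le> M" and n: "1 \<le> n"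
begin

definition R :: real where "R = sqrt ((2 + 6 * \<eta>)\<^sup>2 * \<sigma>\<^sup>2 + \<delta>\<^sup>2)"

definition x :: real where "x = real n * \<eta> * \<delta>\<^sup>2 / (4 * M * R)"

abbreviation tail :: real where "tail \<equiv> E (stationary_tail f (real n * \<delta>) n)"

lemma M_pos: "M > 0" using \<sigma> by simp

lemma f_bdd [simp]: "f \<in> bdd_borel" by (rule bdd_borelI[OF f_meas f_le])

lemma R_square: "R\<^sup>2 = (2 + 6 * \<eta>)\<^sup>2 * \<sigma>\<^sup>2 + \<delta>\<^sup>2" by (simp add: R_def)

lemma R_pos: "R > 0"
  unfolding R_def using \<delta> by (intro real_sqrt_gt_zero add_nonneg_pos) auto

lemma R_ge: "(2 + 6 * \<eta>) * \<sigma> \<le> R"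
  unfolding R_def by (intro real_le_rsqrt) (simp add: power_mult_distrib)

lemma x_pos: "x > 0"
  unfolding x_def using n \<eta>_pos \<delta> M_pos R_pos by (intro divide_pos_pos mult_pos_pos) auto

lemma tail_le_one: "tail \<le> 1"
proof -
  have "tail \<le> E (\<lambda>_. 1)" by (intro E_mono stationary_tail_bdd f_meas) auto
  then show ?thesis by simp
qed

text \<open>The variance bound of \<open>E_square_sum_le\<close> rewritten in \<open>x\<close> by
  means of \<open>real n * \<eta> * \<delta>\<^sup>2 = 4 * M * R * x\<close>.\<close>

lemma chebyshev: "tail \<le> (\<sigma>\<^sup>2 * (\<eta> + 2) / (M * R) + (\<sigma> * \<delta> / (M * R))\<^sup>2 / x) / (4 * x)"
proof -
  have "tail \<le> E (square_sum f n) / (real n * \<delta>)\<^sup>2"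
    using n \<delta> by (intro stationary_tail_square_le) auto
  also have "\<dots> \<le> \<sigma>\<^sup>2 * (real n + 2 * real n / \<eta> + 4 / \<eta>\<^sup>2) / (real n * \<delta>)\<^sup>2"
  proof (intro divide_right_mono)
    have "E (square_sum f n) \<le> (nrm f)\<^sup>2 * (real n + 2 * real n / \<eta> + 4 / \<eta>\<^sup>2)"
      using f_mean by (intro E_square_sum_le) auto
    also have "\<dots> \<le> \<sigma>\<^sup>2 * (real n + 2 * real n / \<eta> + 4 / \<eta>\<^sup>2)"
      using f_nrm \<eta>_pos by (intro mult_right_mono power_mono) auto
    finally show "E (square_sum f n) \<le> \<sigma>\<^sup>2 * (real n + 2 * real n / \<eta> + 4 / \<eta>\<^sup>2)" .
  qed simp
  also have "\<dots> = (\<sigma>\<^sup>2 * (\<eta> + 2) / (M * R) + (\<sigma> * \<delta> / (M * R))\<^sup>2 / x) / (4 * x)"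
  proof -
    have nz: "real n \<noteq> 0" "\<eta> \<noteq> 0" "\<delta> \<noteq> 0" "M \<noteq> 0" "R \<noteq> 0" using n \<eta>_pos \<delta> M_pos R_pos by auto
    have "real n + 2 * real n / \<eta> + 4 / \<eta>\<^sup>2 = (real n * \<eta> * (\<eta> + 2) + 4) / \<eta>\<^sup>2"
      using nz by (simp add: field_simps power2_eq_square)
    moreover have "\<sigma>\<^sup>2 * (\<eta> + 2) / (M * R) + (\<sigma> * \<delta> / (M * R))\<^sup>2 / x
        = \<sigma>\<^sup>2 * (real n * \<eta> * (\<eta> + 2) + 4) / (M * R * (real n * \<eta>))"
      unfolding x_def using nz by (simp add: divide_simps power_mult_distrib power_divide) (simp add: power2_eq_square algebra_simps)
    ultimately show ?thesis unfolding x_def using nz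
      by (simp add: power2_eq_square)
  qed
  finally show ?thesis .
qed

lemma chebyshev_coeffs:
  shows "\<sigma>\<^sup>2 * (\<eta> + 2) / (M * R) \<le> 1" "(\<sigma> * \<delta> / (M * R))\<^sup>2 \<le> 1 / 4"
proof -
  have "(\<eta> + 2) * \<sigma> \<le> (2 + 6 * \<eta>) * \<sigma>" using \<eta>_pos \<sigma> by (intro mult_right_mono) auto
  then have *: "(\<eta> + 2) * \<sigma> \<le> R" using R_ge by linarith
  have "\<sigma> * ((\<eta> + 2) * \<sigma>) \<le> M * R" using * \<sigma> R_pos \<eta>_pos by (intro mult_mono) auto
  then show "\<sigma>\<^sup>2 * (\<eta> + 2) / (M * R) \<le> 1"
    using M_pos R_pos by (simp add: power2_eq_square mult_ac)
  have "2 * \<sigma> \<le> (\<eta> + 2) * \<sigma>" using \<eta>_pos \<sigma> by (intro mult_right_mono) auto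
  then have "2 * \<sigma> \<le> R" using * by linarith
  then have "2 * \<sigma> * \<delta> \<le> R * M" using \<delta> \<sigma> R_pos by (intro mult_mono) auto
  then have "\<sigma> * \<delta> / (M * R) \<le> 1 / 2" using M_pos R_pos by (simp add: field_simps)
  then have "(\<sigma> * \<delta> / (M * R))\<^sup>2 \<le> (1 / 2)\<^sup>2"
    using M_pos R_pos \<sigma> \<delta> by (intro power_mono) auto
  then show "(\<sigma> * \<delta> / (M * R))\<^sup>2 \<le> 1 / 4" by (simp add: power2_eq_square)
qed

lemma tail_le_small:
  assumes "x \<le> 3"
  shows "tail \<le> 2 * exp (- x)"
\<comment> \<open>69/100 lies below the logarithm of 2, so up to this point the right-hand side is
  at least 1.\<close>
proof (cases "x \<le> 69 / 100")
  case True
  have "exp (69 / 100) \<le> (2 :: real)"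
  proof (rule power_le_imp_le_base)
    have "exp (69 / 100 :: real) ^ 100 = exp (real 69)" by (simp flip: exp_of_nat_mult)
    also have "\<dots> \<le> (68 / 25) ^ 69" by (rule exp_nat_le)
    also have "\<dots> \<le> 2 ^ 100" by (simp add: power_divide)
    finally show "exp (69 / 100 :: real) ^ Suc 99 \<le> 2 ^ Suc 99" by simp
  qed simp
  then have "exp x \<le> 2" using True order_trans[of "exp x" "exp (69/100)" 2] by simp
  then have "1 \<le> 2 * exp (- x)" by (simp add: exp_minus field_simps)
  then show ?thesis using tail_le_one by linarith
next
  case False
  have "tail \<le> (1 + 1 / 4 / x) / (4 * x)"
    using chebyshev_coeffs x_pos
    by (intro order_trans[OF chebyshev] divide_right_mono add_mono) auto
  also have "\<dots> = (4 * x + 1) / (16 * x\<^sup>2)"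
    using x_pos by (simp add: field_simps power2_eq_square)
  also have "\<dots> \<le> 2 * exp (- x)"
    using exp_mult_affine_le[of x] assms False x_pos by (simp add: exp_minus field_simps)
  finally show ?thesis .
qed

text \<open>With \<open>y = \<delta> / R\<close> one has \<open>\<sigma> / R \<le> v2\<close> and \<open>\<sigma> / M \<le> s2\<close>. The proof takes \<open>\<theta> = b * y * \<eta> / M\<close> and
  \<open>\<rho> = 1 / (1 + s * \<eta>)\<close>; the gain \<open>x * G\<close> in the exponent pays for the constant \<open>C\<close>. \<open>X\<close> is the value
  of \<open>x\<close> up to which the Chebyshev inequality is used.\<close>

lemma tail_le_cell:
  fixes y1 y2 e1 e2 b s h T v2 s2 w k1 t \<Omega> z l \<Delta> \<gamma> \<kappa> C G :: real and X :: nat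
  assumes \<eta>: "e1 \<le> \<eta>" "\<eta> \<le> e2" "0 \<le> e1" and y: "y1 * R \<le> \<delta>" "\<delta> \<le> y2 * R" "0 \<le> y1" "0 < y2"
    and pos: "0 < b" "0 < s" "0 \<le> h" "0 \<le> T" "0 \<le> v2" "0 \<le> s2"
    and v2: "1 - y1\<^sup>2 \<le> (v2 * (2 + 6 * e1))\<^sup>2"
    and s2: "1 \<le> s2 \<or> v2 \<le> s2 * y1" and w: "w = y2 \<or> w = v2"
    and X: "X = 3 \<or> ((e2 + 2) * v2 * s2 / 12 + w\<^sup>2 / 36) * (68 / 25) ^ X \<le> 2 \<and> 3 \<le> X"
    and t: "t = b * y2" "t < s * (1 - t * e2 / 2)"
    and \<Omega>: "\<Omega> = t + s + t * s * e2" "\<Omega> < 1" "\<Omega>\<^sup>2 \<le> T\<^sup>2 * (1 - \<Omega>\<^sup>2)"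
    and l: "z = b * w" "l = h * z\<^sup>2" "l < t" "l < s"
    and \<Delta>: "\<Delta> = 1 - t - l * (1 + t * e2)" "0 < \<Delta>" "(1 + l * e2)\<^sup>2 \<le> h * \<Delta>"
    and \<gamma>: "\<gamma> = (1 + l * e2) * z * (1 + t * e2) / \<Delta>" "\<gamma> < 1" "(z * e2 + \<gamma>) * T \<le> \<kappa> * (1 - \<gamma>)" "\<kappa> < 1"
    and C: "s * (s + t + s * t * e2 / 2) * (1 + e2 * l / 2) \<le> C * ((s\<^sup>2 - l\<^sup>2) * (1 - \<kappa>))"
    and G: "G = 4 * b - 1 - 4 * h * b\<^sup>2 * v2 * s2" "0 \<le> G" "C \<le> (1 + X * G / 16) ^ 16"
  shows "tail \<le> 2 * exp (- x)"
proof -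
  define v where "v = \<sigma> / R"
  define y where "y = \<delta> / R"
  have v0: "v > 0" and y0: "y > 0" using \<sigma> \<delta> R_pos by (auto simp: v_def y_def)
  have yb: "y1 \<le> y" "y \<le> y2" using y R_pos by (auto simp: y_def field_simps)
  \<comment> \<open>With \<open>\<delta> \<le> M\<close> the product is at most \<open>v\<close>,
    with \<open>\<sigma> \<le> M\<close> it is at most \<open>y\<close>. These are the two
    admissible choices of \<open>w\<close>; the first also bounds \<sigma>/M from above once
    \<open>y\<close> is bounded from below.\<close>
  have sy: "\<sigma> / M * y = \<delta> / M * v" by (simp add: v_def y_def)
  \<comment> \<open>\<delta> and \<open>(2 + 6 * \<eta>) * \<sigma>\<close> are the legs of a right
    triangle with hypotenuse \<open>R\<close>, so a lower bound for \<open>y\<close> is an upper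
    bound for \<open>v\<close>.\<close>
  have circle: "y\<^sup>2 + ((2 + 6 * \<eta>) * v)\<^sup>2 = 1"
  proof -
    have "y\<^sup>2 + ((2 + 6 * \<eta>) * v)\<^sup>2 = ((2 + 6 * \<eta>)\<^sup>2 * \<sigma>\<^sup>2 + \<delta>\<^sup>2) / R\<^sup>2"
      by (simp add: y_def v_def power_mult_distrib power_divide add_divide_distrib)
    then show ?thesis using R_pos by (simp only: R_square[symmetric]) simp
  qed
  have vv2: "v \<le> v2"
  proof -
    have "y1\<^sup>2 \<le> y\<^sup>2" using yb y by (intro power_mono) auto
    then have "((2 + 6 * \<eta>) * v)\<^sup>2 \<le> (v2 * (2 + 6 * e1))\<^sup>2" using circle v2 by linarith
    then have "(2 + 6 * \<eta>) * v \<le> v2 * (2 + 6 * e1)"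
      by (rule power2_le_imp_le) (use pos(5) \<eta>(3) in simp)
    also have "\<dots> \<le> v2 * (2 + 6 * \<eta>)" using \<eta> pos by (intro mult_left_mono) auto
    finally show ?thesis using \<eta>_pos by (simp add: mult.commute)
  qed
  have \<sigma>M: "0 < \<sigma> / M" "\<sigma> / M \<le> 1" and \<delta>M: "0 < \<delta> / M" "\<delta> / M \<le> 1" using \<sigma> \<delta> by auto
  have ssy: "\<sigma> / M * y \<le> v" unfolding sy using \<delta>M v0 by (intro mult_left_le_one_le) auto
  have ss2: "\<sigma> / M \<le> s2"
  proof (cases "1 \<le> s2")
    case False
    then have le: "v2 \<le> s2 * y1" using s2 by simp
    then have "0 < s2 * y1" using vv2 v0 by linarith
    then have y1: "0 < y1" using y(3) pos by (simp add: zero_less_mult_iff)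
    have "\<sigma> / M * y1 \<le> \<sigma> / M * y" using yb \<sigma>M by (intro mult_left_mono) auto
    also have "\<dots> \<le> s2 * y1" using ssy vv2 le by linarith
    finally show ?thesis using y1 by (rule mult_right_le_imp_le)
  qed (use \<sigma>M in linarith)
  have sw: "\<sigma> / M * y \<le> w"
    using w ssy vv2 yb \<sigma>M y0 mult_left_le_one_le[of y "\<sigma> / M"] by auto
  have w0: "0 \<le> w" using w pos y by auto
  have sv: "\<sigma> / M * v \<le> v2 * s2"
    using mult_mono[OF ss2 vv2] pos v0 by (simp add: mult.commute)
  show ?thesis
  proof (cases "x \<le> X")
    case True
    show ?thesis
    proof (cases "x \<le> 3")
      case x3: False
      have X3: "((e2 + 2) * v2 * s2 / 12 + w\<^sup>2 / 36) * (68 / 25) ^ X \<le> 2" using X x3 True by auto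
      have c1: "\<sigma>\<^sup>2 * (\<eta> + 2) / (M * R) \<le> (e2 + 2) * v2 * s2"
      proof -
        have "\<sigma>\<^sup>2 * (\<eta> + 2) / (M * R) = (\<eta> + 2) * (\<sigma> / M * v)"
          by (simp add: v_def power2_eq_square)
        also have "\<dots> \<le> (e2 + 2) * (v2 * s2)"
          by (rule mult_mono[OF _ sv]) (use \<eta> \<eta>_pos mult_pos_pos[OF \<sigma>M(1) v0] in auto)
        finally show ?thesis by simp
      qed
      have "\<sigma> * \<delta> / (M * R) = \<sigma> / M * y" by (simp add: y_def)
      then have c2: "(\<sigma> * \<delta> / (M * R))\<^sup>2 \<le> w\<^sup>2"
        by (simp only:) (intro power_mono sw, use mult_pos_pos[OF \<sigma>M(1) y0] in simp)
      \<comment> \<open>For \<open>x\<close> between 3 and \<open>X\<close> both sides decrease, so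
        the Chebyshev bound at 3 is compared with the exponential at \<open>X\<close>.\<close>
      have "tail \<le> ((e2 + 2) * v2 * s2 + w\<^sup>2 / 3) / (4 * 3)"
      proof (rule order_trans[OF chebyshev], rule frac_le)
        have "(\<sigma> * \<delta> / (M * R))\<^sup>2 / x \<le> w\<^sup>2 / 3" using c2 x3 by (intro frac_le) auto
        then show "\<sigma>\<^sup>2 * (\<eta> + 2) / (M * R) + (\<sigma> * \<delta> / (M * R))\<^sup>2 / x \<le> (e2 + 2) * v2 * s2 + w\<^sup>2 / 3"
          by (rule add_mono[OF c1])
        show "0 \<le> (e2 + 2) * v2 * s2 + w\<^sup>2 / 3" using \<eta> \<eta>_pos pos by auto
      qed (use x3 in auto)
      also have "\<dots> = (e2 + 2) * v2 * s2 / 12 + w\<^sup>2 / 36" by simp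
      also have "\<dots> \<le> 2 / (68 / 25) ^ X" using X3 by (simp add: field_simps)
      also have "\<dots> \<le> 2 / exp (real X)" using exp_nat_le[of X] by (intro divide_left_mono) auto
      also have "\<dots> \<le> 2 / exp x" using True by (intro divide_left_mono) auto
      finally show ?thesis by (simp add: exp_minus divide_inverse)
    qed (rule tail_le_small)
  next
    case False
    define \<theta> where "\<theta> = b * y * \<eta> / M"
    define zz where "zz = b * y * (\<sigma> / M)"
    have \<theta>: "\<theta> > 0" using pos y0 \<eta>_pos M_pos by (simp add: \<theta>_def)
    have zz: "0 \<le> zz" "zz \<le> z"
    proof -
      show "0 \<le> zz" unfolding zz_def using pos y0 \<sigma>M by (intro mult_nonneg_nonneg) auto
      have "b * (\<sigma> / M * y) \<le> b * w" using sw pos by (intro mult_left_mono) auto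
      then show "zz \<le> z" by (simp add: zz_def l mult_ac)
    qed
    have tilted: "tilted_kernel K \<mu> \<eta> (\<lambda>x. c * f x) (t * \<eta>) (zz * \<eta>)" if c: "\<bar>c\<bar> = \<theta>" for c
    proof unfold_locales
      show "(\<lambda>x. c * f x) \<in> bdd_borel" by simp
      show "\<bar>c * f x\<bar> \<le> t * \<eta>" for x
      proof -
        have "\<bar>c * f x\<bar> \<le> \<theta> * M" using c \<theta> f_le[of x] by (simp add: abs_mult mult_left_mono)
        also have "\<dots> = b * y * \<eta>" using M_pos by (simp add: \<theta>_def)
        also have "\<dots> \<le> b * y2 * \<eta>" using yb pos \<eta>_pos by (intro mult_right_mono mult_left_mono) auto
        finally show ?thesis by (simp add: t)
      qed
      show "E (\<lambda>x. c * f x) = 0" using f_mean by simp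
      have "nrm (\<lambda>x. c * f x) \<le> \<theta> * \<sigma>" using c \<theta> f_nrm by (simp add: nrm_cmult mult_left_mono)
      then show "nrm (\<lambda>x. c * f x) \<le> zz * \<eta>" by (simp add: \<theta>_def zz_def mult_ac)
    qed
    define ll where "ll = h * zz\<^sup>2"
    have "0 \<le> l" using pos by (simp add: l)
    then have t0: "0 < t" and l2: "l\<^sup>2 < s\<^sup>2" using l by (auto intro!: power_strict_mono)
    have C': "s * (s + t + s * t * e2 / 2) * (1 + e2 * l / 2) / ((s\<^sup>2 - l\<^sup>2) * (1 - \<kappa>)) \<le> C"
      using C l2 \<gamma>(4) by (simp add: pos_divide_le_eq)
    have bound: "tilted_kernel.m K \<mu> (\<lambda>x. c * f x) n \<le> C * (1 + ll * \<eta>) ^ n" if c: "\<bar>c\<bar> = \<theta>" for c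
    proof -
      interpret tilted_kernel K \<mu> \<eta> "\<lambda>x. c * f x" "t * \<eta>" "zz * \<eta>" by (rule tilted[OF c])
      show ?thesis
        by (rule m_le_geometric[OF \<eta>(2) refl refl zz ll_def l(2) pos(3) t0 pos(2) t(2) \<Omega>(1,2) pos(4) \<Omega>(3)
              \<Delta> l(3,4) \<gamma> C'])
    qed
    have C0: "0 \<le> C"
    proof -
      have "0 \<le> s * (s + t + s * t * e2 / 2) * (1 + e2 * l / 2) / ((s\<^sup>2 - l\<^sup>2) * (1 - \<kappa>))"
        using pos t0 l2 \<gamma>(4) \<open>0 \<le> l\<close> \<eta>
        by (intro divide_nonneg_nonneg mult_nonneg_nonneg add_nonneg_nonneg) linarith+
      then show ?thesis using C' by linarith
    qed
    have "tail \<le> 2 * (C * (1 + ll * \<eta>) ^ n) * exp (- \<theta> * (real n * \<delta>))"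
      using stationary_tail_exp_le[OF f_bdd n \<theta> tilted[of \<theta>] tilted[of "- \<theta>", unfolded mult_minus_left]
          bound[of \<theta>] bound[of "- \<theta>", unfolded mult_minus_left]] \<theta> by simp
    also have "\<dots> \<le> 2 * (exp (x * G) * exp (real n * (ll * \<eta>))) * exp (- \<theta> * (real n * \<delta>))"
    proof (intro mult_right_mono mult_left_mono mult_mono)
      have "C \<le> exp (X * G)" using G(3) power_16_le_exp[of "X * G"] G(2) by simp
      also have "\<dots> \<le> exp (x * G)" using False G(2) by (simp add: mult_right_mono)
      finally show "C \<le> exp (x * G)" .
      have "(1 + ll * \<eta>) ^ n \<le> exp (ll * \<eta>) ^ n"
        using exp_ge_add_one_self[of "ll * \<eta>"] pos \<eta>_pos by (intro power_mono) (auto simp: ll_def)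
      then show "(1 + ll * \<eta>) ^ n \<le> exp (real n * (ll * \<eta>))" by (simp add: exp_of_nat_mult)
    qed (use C0 pos \<eta>_pos in \<open>auto simp: ll_def\<close>)
    also have "\<dots> = 2 * exp (x * G + real n * (ll * \<eta>) - \<theta> * (real n * \<delta>))"
      by (simp add: exp_add exp_diff exp_minus divide_inverse)
    \<comment> \<open>The tilt contributes \<open>- 4 * b * x\<close> and the growth rate at most
      \<open>4 * h * b\<^sup>2 * v2 * s2 * x\<close>. \<open>G\<close> is what remains beyond the
      claimed exponent, and it is spent on \<open>C\<close>.\<close>
    also have "x * G + real n * (ll * \<eta>) - \<theta> * (real n * \<delta>) \<le> - x"
    proof -
      have "\<theta> * (real n * \<delta>) = 4 * b * x"
        using M_pos R_pos by (simp add: \<theta>_def y_def x_def power2_eq_square mult_ac)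
      moreover have "real n * (ll * \<eta>) = x * (4 * h * b\<^sup>2 * (\<sigma> / M * v))"
        using M_pos R_pos by (simp add: ll_def zz_def y_def v_def x_def power2_eq_square mult_ac)
      moreover have "x * (4 * h * b\<^sup>2 * (\<sigma> / M * v)) \<le> x * (4 * h * b\<^sup>2 * (v2 * s2))"
        using sv x_pos pos by (intro mult_left_mono) auto
      ultimately show ?thesis unfolding G(1) by (simp add: algebra_simps)
    qed
    finally show ?thesis by simp
  qed
qed

end

section \<open>Numerical verification for gaps up to 2\<close>

context bernstein_setting
begin

lemma \<delta>_le_R: "\<delta> \<le> R"
  unfolding R_def by (intro real_le_rsqrt) simp

text \<open>The parameters \<open>b\<close> (tilt), \<open>s\<close> (decay of the window) and \<open>h\<close> (growth rate) come from a numerical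
  search; the remaining ones are rounded upwards from the values that these determine.\<close>

lemma tail_le_for_gap_1:
  assumes "0 \<le> \<eta>" "\<eta> \<le> 1/20"
  shows "tail \<le> 2 * exp (- x)"
proof -
  consider "\<delta> \<le> 17/40 * R"
    | "17/40 * R \<le> \<delta>" "\<delta> \<le> 19/40 * R"
    | "19/40 * R \<le> \<delta>" "\<delta> \<le> 21/40 * R"
    | "21/40 * R \<le> \<delta>" "\<delta> \<le> 5/8 * R"
    | "5/8 * R \<le> \<delta>" "\<delta> \<le> 31/40 * R"
    | "31/40 * R \<le> \<delta>"
    by linarith
  then show ?thesis
  proof cases
    case 1
    show ?thesis
      \<comment> \<open>The facts \<open>refl\<close> compute \<open>t\<close>, \<Omega>,
        \<open>z\<close>, \<open>l\<close>, \<Delta>, \<gamma> and \<open>G\<close> from the chosen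
        constants. What remains are inequalities between rational numbers and the membership of
        \<eta> and \<delta>/R in the cell.\<close>
      by (rule tail_le_cell[where ?e1.0 = "0" and ?e2.0 = "1/20" and ?y1.0 = "0" and ?y2.0 = "17/40" and b = "43/100" and s = "2/5" and h = "13/10" and T = "73/100" and ?v2.0 = "501/1000" and ?s2.0 = "1" and w = "17/40" and \<kappa> = "119/500" and C = "1943/1000" and X = 3,
      OF _ _ _ _ _ _ _ _ _ _ _ _ _ _ _ _ _ refl _ refl _ _ refl refl _ _ refl _ _ refl _ _ _ _ refl])
        (use assms 1 \<delta> \<delta>_le_R in \<open>simp_all add: power2_eq_square power_divide\<close>)
  next
    case 2
    show ?thesis
      by (rule tail_le_cell[where ?e1.0 = "0" and ?e2.0 = "1/20" and ?y1.0 = "17/40" and ?y2.0 = "19/40" and b = "23/50" and s = "9/25" and h = "7/5" and T = "18/25" and ?v2.0 = "453/1000" and ?s2.0 = "1" and w = "453/1000" and \<kappa> = "31/100" and C = "241/100" and X = 3,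
      OF _ _ _ _ _ _ _ _ _ _ _ _ _ _ _ _ _ refl _ refl _ _ refl refl _ _ refl _ _ refl _ _ _ _ refl])
        (use assms 2 \<delta> \<delta>_le_R in \<open>simp_all add: power2_eq_square power_divide\<close>)
  next
    case 3
    show ?thesis
      by (rule tail_le_cell[where ?e1.0 = "0" and ?e2.0 = "1/20" and ?y1.0 = "19/40" and ?y2.0 = "21/40" and b = "43/100" and s = "19/50" and h = "7/5" and T = "77/100" and ?v2.0 = "11/25" and ?s2.0 = "927/1000" and w = "11/25" and \<kappa> = "36/125" and C = "229/100" and X = 3,
      OF _ _ _ _ _ _ _ _ _ _ _ _ _ _ _ _ _ refl _ refl _ _ refl refl _ _ refl _ _ refl _ _ _ _ refl])
        (use assms 3 \<delta> \<delta>_le_R in \<open>simp_all add: power2_eq_square power_divide\<close>)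
  next
    case 4
    show ?thesis
      by (rule tail_le_cell[where ?e1.0 = "0" and ?e2.0 = "1/20" and ?y1.0 = "21/40" and ?y2.0 = "5/8" and b = "11/25" and s = "17/50" and h = "3/2" and T = "79/100" and ?v2.0 = "213/500" and ?s2.0 = "203/250" and w = "213/500" and \<kappa> = "81/250" and C = "689/250" and X = 3,
      OF _ _ _ _ _ _ _ _ _ _ _ _ _ _ _ _ _ refl _ refl _ _ refl refl _ _ refl _ _ refl _ _ _ _ refl])
        (use assms 4 \<delta> \<delta>_le_R in \<open>simp_all add: power2_eq_square power_divide\<close>)
  next
    case 5
    show ?thesis
      by (rule tail_le_cell[where ?e1.0 = "0" and ?e2.0 = "1/20" and ?y1.0 = "5/8" and ?y2.0 = "31/40" and b = "21/50" and s = "9/25" and h = "8/5" and T = "24/25" and ?v2.0 = "391/1000" and ?s2.0 = "313/500" and w = "391/1000" and \<kappa> = "179/500" and C = "1513/500" and X = 3,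
      OF _ _ _ _ _ _ _ _ _ _ _ _ _ _ _ _ _ refl _ refl _ _ refl refl _ _ refl _ _ refl _ _ _ _ refl])
        (use assms 5 \<delta> \<delta>_le_R in \<open>simp_all add: power2_eq_square power_divide\<close>)
  next
    case 6
    show ?thesis
      by (rule tail_le_cell[where ?e1.0 = "0" and ?e2.0 = "1/20" and ?y1.0 = "31/40" and ?y2.0 = "1" and b = "41/100" and s = "21/50" and h = "9/5" and T = "77/50" and ?v2.0 = "79/250" and ?s2.0 = "51/125" and w = "79/250" and \<kappa> = "491/1000" and C = "1963/500" and X = 4,
      OF _ _ _ _ _ _ _ _ _ _ _ _ _ _ _ _ _ refl _ refl _ _ refl refl _ _ refl _ _ refl _ _ _ _ refl])
        (use assms 6 \<delta> \<delta>_le_R in \<open>simp_all add: power2_eq_square power_divide\<close>)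
  qed
qed

lemma tail_le_for_gap_2:
  assumes "1/20 \<le> \<eta>" "\<eta> \<le> 2/5"
  shows "tail \<le> 2 * exp (- x)"
proof -
  consider "\<delta> \<le> 2/5 * R"
    | "2/5 * R \<le> \<delta>" "\<delta> \<le> 19/40 * R"
    | "19/40 * R \<le> \<delta>" "\<delta> \<le> 3/5 * R"
    | "3/5 * R \<le> \<delta>" "\<delta> \<le> 3/4 * R"
    | "3/4 * R \<le> \<delta>"
    by linarith
  then show ?thesis
  proof cases
    case 1
    show ?thesis
      by (rule tail_le_cell[where ?e1.0 = "1/20" and ?e2.0 = "2/5" and ?y1.0 = "0" and ?y2.0 = "2/5" and b = "49/100" and s = "3/10" and h = "7/5" and T = "61/100" and ?v2.0 = "87/200" and ?s2.0 = "1" and w = "2/5" and \<kappa> = "79/250" and C = "517/200" and X = 3,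
      OF _ _ _ _ _ _ _ _ _ _ _ _ _ _ _ _ _ refl _ refl _ _ refl refl _ _ refl _ _ refl _ _ _ _ refl])
        (use assms 1 \<delta> \<delta>_le_R in \<open>simp_all add: power2_eq_square power_divide\<close>)
  next
    case 2
    show ?thesis
      by (rule tail_le_cell[where ?e1.0 = "1/20" and ?e2.0 = "2/5" and ?y1.0 = "2/5" and ?y2.0 = "19/40" and b = "11/25" and s = "8/25" and h = "7/5" and T = "67/100" and ?v2.0 = "399/1000" and ?s2.0 = "499/500" and w = "399/1000" and \<kappa> = "3/10" and C = "311/125" and X = 3,
      OF _ _ _ _ _ _ _ _ _ _ _ _ _ _ _ _ _ refl _ refl _ _ refl refl _ _ refl _ _ refl _ _ _ _ refl])
        (use assms 2 \<delta> \<delta>_le_R in \<open>simp_all add: power2_eq_square power_divide\<close>)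
  next
    case 3
    show ?thesis
      by (rule tail_le_cell[where ?e1.0 = "1/20" and ?e2.0 = "2/5" and ?y1.0 = "19/40" and ?y2.0 = "3/5" and b = "43/100" and s = "3/10" and h = "3/2" and T = "73/100" and ?v2.0 = "383/1000" and ?s2.0 = "807/1000" and w = "383/1000" and \<kappa> = "329/1000" and C = "1463/500" and X = 3,
      OF _ _ _ _ _ _ _ _ _ _ _ _ _ _ _ _ _ refl _ refl _ _ refl refl _ _ refl _ _ refl _ _ _ _ refl])
        (use assms 3 \<delta> \<delta>_le_R in \<open>simp_all add: power2_eq_square power_divide\<close>)
  next
    case 4
    show ?thesis
      by (rule tail_le_cell[where ?e1.0 = "1/20" and ?e2.0 = "2/5" and ?y1.0 = "3/5" and ?y2.0 = "3/4" and b = "21/50" and s = "17/50" and h = "8/5" and T = "49/50" and ?v2.0 = "87/250" and ?s2.0 = "581/1000" and w = "87/250" and \<kappa> = "419/1000" and C = "3483/1000" and X = 3,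
      OF _ _ _ _ _ _ _ _ _ _ _ _ _ _ _ _ _ refl _ refl _ _ refl refl _ _ refl _ _ refl _ _ _ _ refl])
        (use assms 4 \<delta> \<delta>_le_R in \<open>simp_all add: power2_eq_square power_divide\<close>)
  next
    case 5
    show ?thesis
      by (rule tail_le_cell[where ?e1.0 = "1/20" and ?e2.0 = "2/5" and ?y1.0 = "3/4" and ?y2.0 = "1" and b = "37/100" and s = "2/5" and h = "9/5" and T = "149/100" and ?v2.0 = "36/125" and ?s2.0 = "77/200" and w = "36/125" and \<kappa> = "461/1000" and C = "1867/500" and X = 4,
      OF _ _ _ _ _ _ _ _ _ _ _ _ _ _ _ _ _ refl _ refl _ _ refl refl _ _ refl _ _ refl _ _ _ _ refl])
        (use assms 5 \<delta> \<delta>_le_R in \<open>simp_all add: power2_eq_square power_divide\<close>)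
  qed
qed

lemma tail_le_for_gap_3:
  assumes "2/5 \<le> \<eta>" "\<eta> \<le> 6/5"
  shows "tail \<le> 2 * exp (- x)"
proof -
  consider "\<delta> \<le> 13/20 * R"
    | "13/20 * R \<le> \<delta>"
    by linarith
  then show ?thesis
  proof cases
    case 1
    show ?thesis
      by (rule tail_le_cell[where ?e1.0 = "2/5" and ?e2.0 = "6/5" and ?y1.0 = "0" and ?y2.0 = "13/20" and b = "43/100" and s = "17/50" and h = "3/2" and T = "27/25" and ?v2.0 = "57/250" and ?s2.0 = "1" and w = "57/250" and \<kappa> = "411/1000" and C = "1707/500" and X = 3,
      OF _ _ _ _ _ _ _ _ _ _ _ _ _ _ _ _ _ refl _ refl _ _ refl refl _ _ refl _ _ refl _ _ _ _ refl])
        (use assms 1 \<delta> \<delta>_le_R in \<open>simp_all add: power2_eq_square power_divide\<close>)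
  next
    case 2
    show ?thesis
      by (rule tail_le_cell[where ?e1.0 = "2/5" and ?e2.0 = "6/5" and ?y1.0 = "13/20" and ?y2.0 = "1" and b = "8/25" and s = "2/5" and h = "8/5" and T = "9/5" and ?v2.0 = "173/1000" and ?s2.0 = "267/1000" and w = "173/1000" and \<kappa> = "46/125" and C = "1581/500" and X = 5,
      OF _ _ _ _ _ _ _ _ _ _ _ _ _ _ _ _ _ refl _ refl _ _ refl refl _ _ refl _ _ refl _ _ _ _ refl])
        (use assms 2 \<delta> \<delta>_le_R in \<open>simp_all add: power2_eq_square power_divide\<close>)
  qed
qed

text \<open>For large gaps and \<delta>/R near 1 the condition \<Omega> < 1 limits \<open>b\<close>,
  so the margin \<open>G\<close> is small and \<open>X\<close> has to be large. There
  \<open>v2\<close> and \<open>s2\<close> are small too, which makes the Chebyshev inequality strong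
  enough up to \<open>X\<close>.\<close>

lemma tail_le_for_gap_4:
  assumes "6/5 \<le> \<eta>" "\<eta> \<le> 2"
  shows "tail \<le> 2 * exp (- x)"
proof -
  consider "\<delta> \<le> 7/10 * R"
    | "7/10 * R \<le> \<delta>" "\<delta> \<le> 19/20 * R"
    | "19/20 * R \<le> \<delta>"
    by linarith
  then show ?thesis
  proof cases
    case 1
    show ?thesis
      by (rule tail_le_cell[where ?e1.0 = "6/5" and ?e2.0 = "2" and ?y1.0 = "0" and ?y2.0 = "7/10" and b = "39/100" and s = "19/50" and h = "3/2" and T = "169/100" and ?v2.0 = "109/1000" and ?s2.0 = "1" and w = "109/1000" and \<kappa> = "329/1000" and C = "2977/1000" and X = 3,
      OF _ _ _ _ _ _ _ _ _ _ _ _ _ _ _ _ _ refl _ refl _ _ refl refl _ _ refl _ _ refl _ _ _ _ refl])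
        (use assms 1 \<delta> \<delta>_le_R in \<open>simp_all add: power2_eq_square power_divide\<close>)
  next
    case 2
    show ?thesis
      by (rule tail_le_cell[where ?e1.0 = "6/5" and ?e2.0 = "2" and ?y1.0 = "7/10" and ?y2.0 = "19/20" and b = "3/10" and s = "2/5" and h = "3/2" and T = "56/25" and ?v2.0 = "39/500" and ?s2.0 = "14/125" and w = "39/500" and \<kappa> = "233/1000" and C = "2607/1000" and X = 6,
      OF _ _ _ _ _ _ _ _ _ _ _ _ _ _ _ _ _ refl _ refl _ _ refl refl _ _ refl _ _ refl _ _ _ _ refl])
        (use assms 2 \<delta> \<delta>_le_R in \<open>simp_all add: power2_eq_square power_divide\<close>)
  next
    case 3
    show ?thesis
      by (rule tail_le_cell[where ?e1.0 = "6/5" and ?e2.0 = "2" and ?y1.0 = "19/20" and ?y2.0 = "1" and b = "29/100" and s = "21/50" and h = "3/2" and T = "317/100" and ?v2.0 = "17/500" and ?s2.0 = "9/250" and w = "17/500" and \<kappa> = "17/125" and C = "2293/1000" and X = 6,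
      OF _ _ _ _ _ _ _ _ _ _ _ _ _ _ _ _ _ refl _ refl _ _ refl refl _ _ refl _ _ refl _ _ _ _ refl])
        (use assms 3 \<delta> \<delta>_le_R in \<open>simp_all add: power2_eq_square power_divide\<close>)
  qed
qed

end

section \<open>Change of measure and the Markov property\<close>

lemma space_history [simp]: "space (history S Z k) = space S"
  unfolding history_def by (intro space_measure_of) auto

lemma sets_history:
  "sets (history S Z k) = sigma_sets (space S) {Z j -` A \<inter> space S | j A. j \<in> {1..k} \<and> A \<in> sets borel}"
  unfolding history_def by (intro sets_measure_of) auto

lemma measurable_history:
  fixes Z :: "nat \<Rightarrow> 'w \<Rightarrow> 'b::topological_space"
  assumes "j \<in> {1..k}" shows "Z j \<in> history S Z k \<rightarrow>\<^sub>M borel"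
proof (rule measurableI)
  fix A :: "'b set" assume "A \<in> sets borel"
  then show "Z j -` A \<inter> space (history S Z k) \<in> sets (history S Z k)"
    unfolding sets_history space_history using assms by (intro sigma_sets.Basic) blast
qed simp

lemma subalgebra_history:
  assumes "\<And>j. 1 \<le> j \<Longrightarrow> Z j \<in> S \<rightarrow>\<^sub>M borel" shows "subalgebra S (history S Z k)"
  unfolding subalgebra_def sets_history
  using assms by (auto intro!: sets.sigma_sets_subset dest: measurable_sets)

text \<open>The definition of the chain determines the conditional law of the next state on single
  sets. Rectangles of such a set and an event for \<open>T\<close> are stable under intersection and
  generate the product sigma-algebra, so the joint law follows.\<close>

lemma markov_chain_step:
  fixes Z :: "nat \<Rightarrow> 'w \<Rightarrow> 'a::polish_space" and T :: "'w \<Rightarrow> real"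
  assumes chain: "markov_chain S Z K" and k: "1 \<le> k"
    and T: "T \<in> history S Z k \<rightarrow>\<^sub>M borel" and \<Psi>: "\<Psi> \<in> borel_measurable (borel \<Otimes>\<^sub>M borel)"
  shows "(\<integral>\<^sup>+\<omega>. \<Psi> (Z (Suc k) \<omega>, T \<omega>) \<partial>S) = (\<integral>\<^sup>+\<omega>. \<integral>\<^sup>+y. \<Psi> (y, T \<omega>) \<partial>K (Z k \<omega>) \<partial>S)"
proof -
  interpret S: prob_space S using chain by (simp add: markov_chain_def)
  have Z: "\<And>j. 1 \<le> j \<Longrightarrow> Z j \<in> S \<rightarrow>\<^sub>M borel" using chain by (simp add: markov_chain_def)
  have K: "K \<in> borel \<rightarrow>\<^sub>M subprob_algebra borel"
    using chain by (auto simp: markov_chain_def markov_kernel_def intro: measurable_prob_algebraD)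
  have probK: "prob_space (K z)" and setsK: "sets (K z) = sets borel" for z
    using chain measurable_space[of K borel "prob_algebra borel" z]
    by (auto simp: markov_chain_def markov_kernel_def space_prob_algebra)
  have sub: "subalgebra S (history S Z k)" using Z by (rule subalgebra_history)
  interpret F: finite_measure_subalgebra S "history S Z k" by unfold_locales (rule sub)
  have [measurable]: "T \<in> borel_measurable S" using T sub by (rule measurable_from_subalg[rotated])
  have [measurable]: "Z k \<in> S \<rightarrow>\<^sub>M borel" "Z (Suc k) \<in> S \<rightarrow>\<^sub>M borel" using Z k by auto
  have KZ: "(\<lambda>\<omega>. K (Z k \<omega>)) \<in> S \<rightarrow>\<^sub>M subprob_algebra borel" using K by (rule measurable_compose[rotated]) simp
  define N where "N \<omega> = distr (K (Z k \<omega>)) (borel \<Otimes>\<^sub>M borel) (\<lambda>y. (y, T \<omega>))" for \<omega>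
  have N: "N \<in> S \<rightarrow>\<^sub>M subprob_algebra (borel \<Otimes>\<^sub>M borel)"
    unfolding N_def using KZ by (intro measurable_distr2[where M=borel]) measurable
  have ne: "space S \<noteq> {}" by (rule S.not_empty)
  have "distr S (borel \<Otimes>\<^sub>M borel) (\<lambda>\<omega>. (Z (Suc k) \<omega>, T \<omega>)) = S \<bind> N"
  proof (rule measure_eqI_generator_eq[OF Int_stable_pair_measure_generator[of borel borel]])
    show "{a \<times> b |a b. a \<in> sets borel \<and> b \<in> sets (borel :: real measure)} \<subseteq> Pow (UNIV :: ('a \<times> real) set)" by auto
    show "sets (distr S (borel \<Otimes>\<^sub>M borel) (\<lambda>\<omega>. (Z (Suc k) \<omega>, T \<omega>)))
        = sigma_sets UNIV {a \<times> b |a b. a \<in> sets borel \<and> b \<in> sets borel}"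
      by (simp add: sets_pair_measure)
    show "sets (S \<bind> N) = sigma_sets UNIV {a \<times> b |a b. a \<in> sets borel \<and> b \<in> sets borel}"
      using sets_bind[OF sets_kernel[OF N] ne] by (simp add: sets_pair_measure)
    show "range (\<lambda>_. UNIV) \<subseteq> {a \<times> b |a b. a \<in> sets borel \<and> b \<in> sets borel}"
      by (auto intro!: exI[of _ UNIV])
    show "emeasure (distr S (borel \<Otimes>\<^sub>M borel) (\<lambda>\<omega>. (Z (Suc k) \<omega>, T \<omega>))) UNIV \<noteq> \<infinity>" for i :: nat
    proof -
      interpret D: prob_space "distr S (borel \<Otimes>\<^sub>M borel) (\<lambda>\<omega>. (Z (Suc k) \<omega>, T \<omega>))"
        by (rule S.prob_space_distr) measurable
      show ?thesis by (simp add: D.emeasure_eq_measure)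
    qed
    fix X :: "('a \<times> real) set"
    assume "X \<in> {a \<times> b |a b. a \<in> sets borel \<and> b \<in> sets borel}"
    then obtain a b where X: "X = a \<times> b" and [measurable]: "a \<in> sets borel" "b \<in> sets borel" by blast
    define B where "B = T -` b \<inter> space S"
    have B: "B \<in> sets (history S Z k)" using measurable_sets[OF T, of b] by (simp add: B_def)
    have [measurable]: "B \<in> sets S" unfolding B_def by measurable
    have Km: "(\<lambda>\<omega>. measure (K (Z k \<omega>)) a) \<in> borel_measurable S"
      using measurable_compose[OF KZ measurable_measure_subprob_algebra[of a borel]] by simp
    have "(\<integral>\<omega>\<in>B. indicator a (Z (Suc k) \<omega>) \<partial>S)
        = (\<integral>\<omega>\<in>B. real_cond_exp S (history S Z k) (\<lambda>\<omega>. indicator a (Z (Suc k) \<omega>)) \<omega> \<partial>S)"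
      by (rule F.real_cond_exp_intA[OF _ B]) (auto intro!: S.integrable_const_bound[where B=1])
    also have "\<dots> = (\<integral>\<omega>\<in>B. measure (K (Z k \<omega>)) a \<partial>S)"
    proof (rule set_lebesgue_integral_cong_AE)
      show "AE \<omega>\<in>B in S. real_cond_exp S (history S Z k) (\<lambda>\<omega>. indicator a (Z (Suc k) \<omega>)) \<omega> = measure (K (Z k \<omega>)) a"
      proof -
        have "AE \<omega> in S. real_cond_exp S (history S Z k) (\<lambda>\<omega>. indicator a (Z (Suc k) \<omega>)) \<omega> = measure (K (Z k \<omega>)) a"
          using chain k \<open>a \<in> sets borel\<close> unfolding markov_chain_def by blast
        then show ?thesis by eventually_elim simp
      qed
    qed (use Km in auto)
    finally have eq: "(\<integral>\<omega>. indicator B \<omega> * indicator a (Z (Suc k) \<omega>) \<partial>S)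
        = (\<integral>\<omega>. indicator B \<omega> * measure (K (Z k \<omega>)) a \<partial>S)"
      by (simp add: set_lebesgue_integral_def)
    have "emeasure (distr S (borel \<Otimes>\<^sub>M borel) (\<lambda>\<omega>. (Z (Suc k) \<omega>, T \<omega>))) X
        = (\<integral>\<^sup>+\<omega>. ennreal (indicator B \<omega> * indicator a (Z (Suc k) \<omega>)) \<partial>S)"
    proof -
      have "emeasure (distr S (borel \<Otimes>\<^sub>M borel) (\<lambda>\<omega>. (Z (Suc k) \<omega>, T \<omega>))) X
          = emeasure S (B \<inter> (Z (Suc k) -` a \<inter> space S))"
        unfolding X by (subst emeasure_distr) (auto simp: B_def intro!: arg_cong[where f="emeasure S"])
      also have "\<dots> = (\<integral>\<^sup>+\<omega>. indicator (B \<inter> (Z (Suc k) -` a \<inter> space S)) \<omega> \<partial>S)"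
        by (rule nn_integral_indicator[symmetric]) measurable
      also have "\<dots> = (\<integral>\<^sup>+\<omega>. ennreal (indicator B \<omega> * indicator a (Z (Suc k) \<omega>)) \<partial>S)"
        by (intro nn_integral_cong) (auto simp: indicator_def)
      finally show ?thesis .
    qed
    also have "\<dots> = ennreal (\<integral>\<omega>. indicator B \<omega> * indicator a (Z (Suc k) \<omega>) \<partial>S)"
      by (rule nn_integral_eq_integral) (auto intro!: S.integrable_const_bound[where B=1] simp: indicator_def)
    also have "\<dots> = (\<integral>\<^sup>+\<omega>. ennreal (indicator B \<omega> * measure (K (Z k \<omega>)) a) \<partial>S)"
      unfolding eq using Km prob_space.prob_le_1[OF probK]
      by (intro nn_integral_eq_integral[symmetric])
         (auto intro!: S.integrable_const_bound[where B=1] simp: indicator_def)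
    also have "\<dots> = (\<integral>\<^sup>+\<omega>. emeasure (N \<omega>) X \<partial>S)"
    proof (rule nn_integral_cong)
      fix \<omega> assume \<omega>: "\<omega> \<in> space S"
      have "emeasure (N \<omega>) X = emeasure (K (Z k \<omega>)) ((\<lambda>y. (y, T \<omega>)) -` X \<inter> space (K (Z k \<omega>)))"
        unfolding N_def X
        by (rule emeasure_distr) (auto simp: measurable_cong_sets[OF setsK refl])
      also have "(\<lambda>y. (y, T \<omega>)) -` X \<inter> space (K (Z k \<omega>)) = (if T \<omega> \<in> b then a else {})"
        unfolding X using sets_eq_imp_space_eq[OF setsK] by auto
      finally show "ennreal (indicator B \<omega> * measure (K (Z k \<omega>)) a) = emeasure (N \<omega>) X"
        using \<omega> finite_measure.emeasure_eq_measure[OF prob_space.finite_measure[OF probK]]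
        by (auto simp: B_def indicator_def)
    qed
    also have "\<dots> = emeasure (S \<bind> N) X"
      unfolding X using ne N by (intro emeasure_bind[symmetric]) auto
    finally show "emeasure (distr S (borel \<Otimes>\<^sub>M borel) (\<lambda>\<omega>. (Z (Suc k) \<omega>, T \<omega>))) X = emeasure (S \<bind> N) X" .
  qed auto
  then have "(\<integral>\<^sup>+x. \<Psi> x \<partial>distr S (borel \<Otimes>\<^sub>M borel) (\<lambda>\<omega>. (Z (Suc k) \<omega>, T \<omega>))) = (\<integral>\<^sup>+x. \<Psi> x \<partial>(S \<bind> N))"
    by simp
  also have "\<dots> = (\<integral>\<^sup>+\<omega>. \<integral>\<^sup>+x. \<Psi> x \<partial>N \<omega> \<partial>S)" by (rule nn_integral_bind[OF \<Psi> N])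
  also have "\<dots> = (\<integral>\<^sup>+\<omega>. \<integral>\<^sup>+y. \<Psi> (y, T \<omega>) \<partial>K (Z k \<omega>) \<partial>S)"
    unfolding N_def using \<Psi>
    by (intro nn_integral_cong nn_integral_distr) (auto simp: measurable_cong_sets[OF setsK refl])
  finally show ?thesis using \<Psi> by (simp add: nn_integral_distr)
qed

text \<open>The quantity \<open>A k\<close> evaluates the expectation given the first
  \<open>k\<close> states. By \<open>markov_chain_step\<close>, with the running sum as
  \<open>T\<close>, it does not depend on \<open>k\<close>; \<open>k = n\<close> gives the left-hand
  side and \<open>k = 1\<close> the right-hand side.\<close>

lemma markov_chain_path_value:
  fixes Z :: "nat \<Rightarrow> 'w \<Rightarrow> 'a::polish_space"
  assumes chain: "markov_chain S Z K" and op: "markov_operator K \<mu>" and n: "1 \<le> n"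
    and f: "f \<in> borel_measurable borel" and F: "F \<in> borel_measurable borel" "\<And>s. 0 \<le> F s" "\<And>s. F s \<le> 1"
  shows "(\<integral>\<^sup>+\<omega>. ennreal (F (\<Sum>j=1..n. f (Z j \<omega>))) \<partial>S)
    = (\<integral>\<^sup>+\<omega>. ennreal (path_value K f F (n - 1) (Z 1 \<omega>, f (Z 1 \<omega>))) \<partial>S)"
proof -
  interpret markov_operator K \<mu> by fact
  define A where "A k = (\<integral>\<^sup>+\<omega>. ennreal (path_value K f F (n - k) (Z k \<omega>, \<Sum>j=1..k. f (Z j \<omega>))) \<partial>S)" for k
  have step: "A k = A (Suc k)" if k: "1 \<le> k" "k < n" for k
  proof -
    define i where "i = n - Suc k"
    have i: "n - k = Suc i" using k by (simp add: i_def)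
    let ?T = "\<lambda>\<omega>. \<Sum>j=1..k. f (Z j \<omega>)"
    have T: "?T \<in> history S Z k \<rightarrow>\<^sub>M borel"
      using measurable_history[of _ k Z S] f by (intro borel_measurable_sum) (auto intro: measurable_compose)
    have \<Psi>: "(\<lambda>(y, s). ennreal (path_value K f F i (y, s + f y))) \<in> borel_measurable (borel \<Otimes>\<^sub>M borel)"
      using f F(1) by measurable
    have "ennreal (path_value K f F (Suc i) (z, s)) = (\<integral>\<^sup>+y. ennreal (path_value K f F i (y, s + f y)) \<partial>K z)" for z s
      using integrable_K[OF path_value_step_bdd[OF f F]] path_value_nonneg[OF f F]
      by (simp add: nn_integral_eq_integral)
    then have "A k = (\<integral>\<^sup>+\<omega>. \<integral>\<^sup>+y. ennreal (path_value K f F i (y, ?T \<omega> + f y)) \<partial>K (Z k \<omega>) \<partial>S)"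
      unfolding A_def i by simp
    also have "\<dots> = (\<integral>\<^sup>+\<omega>. ennreal (path_value K f F i (Z (Suc k) \<omega>, ?T \<omega> + f (Z (Suc k) \<omega>))) \<partial>S)"
      using markov_chain_step[OF chain k(1) T \<Psi>] by simp
    also have "\<dots> = A (Suc k)" by (simp add: A_def i_def)
    finally show ?thesis .
  qed
  have "A 1 = A k" if "1 \<le> k" "k \<le> n" for k
    using that
  proof (induction k rule: dec_induct)
    case (step i)
    then show ?case using \<open>\<And>k. 1 \<le> k \<Longrightarrow> k < n \<Longrightarrow> A k = A (Suc k)\<close>[of i] by simp
  qed simp
  then have "A 1 = A n" using n by blast
  then show ?thesis by (simp add: A_def)
qed

text \<open>For values in the unit interval \<open>h powr q \<le> h\<close>, so the conjugate norm
  of \<open>h\<close> is controlled by its mean. Young's inequality is applied after scaling by the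
  bounds \<open>A\<close> and \<open>B\<close> of the two norms; the scaling requires
  \<open>J\<close> and \<open>I\<close> to be positive.\<close>

lemma Holder_indicator:
  fixes \<rho> h :: "'a \<Rightarrow> real" and p :: real
  assumes [measurable]: "\<rho> \<in> borel_measurable N" "h \<in> borel_measurable N"
    and \<rho>: "\<And>x. 0 \<le> \<rho> x" and h: "\<And>x. 0 \<le> h x" "\<And>x. h x \<le> 1" and p: "1 < p"
    and J: "(\<integral>\<^sup>+x. ennreal (\<rho> x powr p) \<partial>N) = ennreal J" "0 \<le> J"
    and I: "(\<integral>\<^sup>+x. ennreal (h x) \<partial>N) = ennreal I" "0 \<le> I"
  shows "(\<integral>\<^sup>+x. ennreal (\<rho> x * h x) \<partial>N) \<le> ennreal (J powr (1 / p) * I powr (1 - 1 / p))"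
proof -
  consider "J = 0" | "I = 0" | "J > 0" "I > 0" using J I by linarith
  then show ?thesis
  proof cases
    case 1
    then have "(\<integral>\<^sup>+x. ennreal (\<rho> x powr p) \<partial>N) = 0" using J by simp
    then have "AE x in N. \<rho> x powr p = 0" by (subst (asm) nn_integral_0_iff_AE) (auto simp: ennreal_eq_0_iff)
    then have "AE x in N. ennreal (\<rho> x * h x) = 0" by eventually_elim simp
    then have "(\<integral>\<^sup>+x. ennreal (\<rho> x * h x) \<partial>N) = 0" by (subst nn_integral_0_iff_AE) auto
    then show ?thesis by simp
  next
    case 2
    then have "(\<integral>\<^sup>+x. ennreal (h x) \<partial>N) = 0" using I by simp
    then have "AE x in N. h x \<le> 0" by (subst (asm) nn_integral_0_iff_AE) (auto simp: ennreal_eq_0_iff)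
    then have "AE x in N. ennreal (\<rho> x * h x) = 0"
    proof eventually_elim
      case (elim x)
      then have "h x = 0" using h(1)[of x] by simp
      then show ?case by simp
    qed
    then have "(\<integral>\<^sup>+x. ennreal (\<rho> x * h x) \<partial>N) = 0" by (subst nn_integral_0_iff_AE) auto
    then show ?thesis by simp
  next
    case 3
    define q where "q = p / (p - 1)"
    have q: "1 < q" "1 / p + 1 / q = 1" using p by (auto simp: q_def field_simps)
    have q': "1 / q = 1 - 1 / p" using q by simp
    define A where "A = J powr (1 / p)"
    define B where "B = I powr (1 / q)"
    have AB: "A > 0" "B > 0" using 3 by (auto simp: A_def B_def)
    have Ap: "A powr p = J" "B powr q = I" using 3 p q by (auto simp: A_def B_def powr_powr)
    have "\<rho> x * h x \<le> A * B * (1 / (p * J)) * \<rho> x powr p + A * B * (1 / (q * I)) * h x" for x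
    proof -
      have "(\<rho> x / A) * (h x / B) \<le> (\<rho> x / A) powr p / p + (h x / B) powr q / q"
        using p q \<rho> h AB by (intro Youngs_inequality) auto
      also have "\<dots> = 1 / (p * J) * \<rho> x powr p + 1 / (q * I) * h x powr q"
        using \<rho> h AB Ap by (simp add: powr_divide mult.commute)
      also have "\<dots> \<le> 1 / (p * J) * \<rho> x powr p + 1 / (q * I) * h x"
      proof (intro add_left_mono mult_left_mono)
        show "h x powr q \<le> h x"
        proof (cases "h x = 0")
          case False
          then have "h x powr q \<le> h x powr 1" using h[of x] q by (intro powr_mono') auto
          then show ?thesis using h(1)[of x] by simp
        qed simp
      qed (use q 3 in auto)
      finally have "A * B * ((\<rho> x / A) * (h x / B)) \<le> A * B * (1 / (p * J) * \<rho> x powr p + 1 / (q * I) * h x)"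
        using AB by (intro mult_left_mono) auto
      then show ?thesis using AB by (simp add: algebra_simps)
    qed
    then have "(\<integral>\<^sup>+x. ennreal (\<rho> x * h x) \<partial>N)
        \<le> (\<integral>\<^sup>+x. ennreal (A * B * (1 / (p * J))) * ennreal (\<rho> x powr p) + ennreal (A * B * (1 / (q * I))) * ennreal (h x) \<partial>N)"
      using AB p q 3 h by (intro nn_integral_mono) (simp add: ennreal_mult'[symmetric] ennreal_plus[symmetric] del: ennreal_plus)
    also have "\<dots> = ennreal (A * B * (1 / (p * J))) * ennreal J + ennreal (A * B * (1 / (q * I))) * ennreal I"
      by (simp add: nn_integral_add nn_integral_cmult J(1) I(1))
    also have "\<dots> = ennreal (A * B * (1 / (p * J)) * J + A * B * (1 / (q * I)) * I)"
      using AB p q 3 by (simp add: ennreal_mult'[symmetric] ennreal_plus[symmetric] del: ennreal_plus)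
    also have "A * B * (1 / (p * J)) * J + A * B * (1 / (q * I)) * I = A * B * (1 / p + 1 / q)"
      using 3 by (simp add: distrib_left)
    finally show ?thesis using q by (simp add: A_def B_def q')
  qed
qed

lemma poincare_kernelI:
  assumes inv: "invariant_distribution K \<mu>" and kernel: "markov_kernel K"
    and gap: "\<eta> = iterated_poincare_gap K \<mu>" "\<eta> > 0"
  shows "poincare_kernel K \<mu> \<eta>"
proof -
  interpret markov_operator K \<mu> by unfold_locales (fact kernel inv)+
  have L2n: "L2_norm \<mu> h = nrm h" for h
    by (simp add: L2_norm_def L2_inner_def nrm_def power2_eq_square)
  show ?thesis
  proof unfold_locales
    fix h assume h: "h \<in> bdd_borel" "E h = 0"
    show "\<eta> * nrm h \<le> nrm (\<lambda>x. P h x - h x)"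
    proof (cases "nrm h = 0")
      case False
      have "\<eta> \<le> L2_norm \<mu> (generator K h) / L2_norm \<mu> h"
        unfolding gap(1) iterated_poincare_gap_def
      proof (rule cINF_lower)
        show "bdd_below ((\<lambda>h. L2_norm \<mu> (generator K h) / L2_norm \<mu> h) ` {h \<in> L2_0 \<mu>. L2_norm \<mu> h \<noteq> 0})"
          by (intro bdd_belowI[of _ 0]) (auto simp: L2n)
        show "h \<in> {h \<in> L2_0 \<mu>. L2_norm \<mu> h \<noteq> 0}"
          using False h bdd_borel_L2 by (simp add: L2_0_def L2n)
      qed
      moreover have "nrm h > 0" using False nrm_nonneg[of h] by linarith
      moreover have "generator K h = (\<lambda>x. P h x - h x)" by (simp add: generator_def fun_eq_iff)
      ultimately show ?thesis by (simp add: L2n pos_le_divide_eq)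
    qed simp
  qed (rule gap(2))
qed

text \<open>\<open>P\<close> is non-expansive, so \<open>P h - h\<close> has at most twice the norm
  of \<open>h\<close>. The test function must be bounded, hence the centred indicator of
  \<open>h > 0\<close>: it is not almost surely constant, because \<open>h\<close> has mean 0
  without vanishing almost everywhere. This confines the numerical cells to a bounded range of
  gaps.\<close>

lemma (in poincare_kernel) gap_le_2:
  assumes "\<exists>h\<in>L2_0 \<mu>. L2_norm \<mu> h \<noteq> 0"
  shows "\<eta> \<le> 2"
proof -
  interpret prob_space \<mu> by (rule prob_mu)
  obtain h where h: "h \<in> L2 \<mu>" "E h = 0" "L2_norm \<mu> h \<noteq> 0"
    using assms by (auto simp: L2_0_def)
  have [measurable]: "h \<in> borel_measurable \<mu>" using h(1) by (simp add: L2_def)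
  have hb [measurable]: "h \<in> borel_measurable borel" using \<open>h \<in> borel_measurable \<mu>\<close> by (simp add: measurable_cong_sets[OF sets_mu refl])
  have int: "integrable \<mu> h"
    using h(1) by (auto simp: L2_def intro: square_integrable_imp_integrable)
  have not0: "\<not> (AE x in \<mu>. h x = 0)"
  proof
    assume "AE x in \<mu>. h x = 0"
    then have "(\<integral>x. h x * h x \<partial>\<mu>) = (\<integral>x. 0 \<partial>\<mu>)" by (intro integral_cong_AE) auto
    then show False using h(3) by (simp add: L2_norm_def L2_inner_def)
  qed
  have not_le: "\<not> (AE x in \<mu>. h x \<le> 0)"
  proof
    assume "AE x in \<mu>. h x \<le> 0"
    then have "AE x in \<mu>. - h x = 0"
      using integral_nonneg_eq_0_iff_AE[of \<mu> "\<lambda>x. - h x"] int h(2) by simp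
    then show False using not0 by simp
  qed
  have not_gt: "\<not> (AE x in \<mu>. h x > 0)"
  proof
    assume *: "AE x in \<mu>. h x > 0"
    then have "AE x in \<mu>. 0 \<le> h x" by eventually_elim simp
    then have "AE x in \<mu>. h x = 0"
      using integral_nonneg_eq_0_iff_AE[OF int] h(2) by simp
    then show False using not0 by simp
  qed
  define g where "g x = indicat_real {x. h x > 0} x" for x
  have [simp]: "g \<in> bdd_borel"
    unfolding g_def[abs_def] by (rule bdd_borelI[where B=1]) auto
  define c where "c = E g"
  have g: "(\<lambda>x. g x - c) \<in> bdd_borel" by simp
  have g0: "E (\<lambda>x. g x - c) = 0" by (simp add: c_def)
  have "nrm (\<lambda>x. g x - c) \<noteq> 0"
  proof
    assume "nrm (\<lambda>x. g x - c) = 0"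
    then have "E (\<lambda>x. (g x - c)\<^sup>2) = 0" by (simp add: nrm_def)
    then have ae: "AE x in \<mu>. (g x - c)\<^sup>2 = 0"
      by (subst (asm) integral_nonneg_eq_0_iff_AE) auto
    show False
    proof (cases "c = 1")
      case True
      then have "AE x in \<mu>. h x > 0" using ae by (auto simp: g_def indicator_def split: if_splits)
      then show False using not_gt by simp
    next
      case False
      then have "AE x in \<mu>. h x \<le> 0" using ae by (auto simp: g_def indicator_def not_less split: if_splits elim!: eventually_mono)
      then show False using not_le by simp
    qed
  qed
  then have pos: "nrm (\<lambda>x. g x - c) > 0" using nrm_nonneg[of "\<lambda>x. g x - c"] by linarith
  have "\<eta> * nrm (\<lambda>x. g x - c) \<le> nrm (\<lambda>x. P (\<lambda>x. g x - c) x - (g x - c))" by (rule gap[OF g g0])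
  also have "\<dots> \<le> nrm (P (\<lambda>x. g x - c)) + nrm (\<lambda>x. g x - c)" by (intro nrm_triangle_diff) auto
  also have "\<dots> \<le> 2 * nrm (\<lambda>x. g x - c)" using nrm_P[OF g] by simp
  finally show ?thesis using pos by simp
qed

lemma Lp_norm_change_of_measure:
  fixes \<mu> \<nu> :: "'a measure" and h :: "'a \<Rightarrow> real"
  assumes \<mu>: "prob_space \<mu>" and \<nu>: "prob_space \<nu>" "sets \<nu> = sets \<mu>" and ac: "absolutely_continuous \<mu> \<nu>"
    and h: "h \<in> borel_measurable \<mu>" "\<And>x. 0 \<le> h x" "\<And>x. h x \<le> 1"
    and p: "1 \<le> p" and moment: "Lp_norm p \<mu> (rn_density \<nu> \<mu>) < \<infinity>"
  defines "A \<equiv> enn2real (Lp_norm p \<mu> (rn_density \<nu> \<mu>))" and "q \<equiv> conj_exponent p"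
  shows "(\<integral>x. h x \<partial>\<nu>) \<le> A * (if q = \<infinity> then 1 else (\<integral>x. h x \<partial>\<mu>) powr (1 / enn2real q))"
    and "q \<noteq> \<infinity> \<Longrightarrow> 1 \<le> enn2real q"
proof -
  interpret \<mu>: prob_space \<mu> by fact
  interpret \<nu>: prob_space \<nu> by fact
  note [measurable] = h(1)
  have h\<nu>: "h \<in> borel_measurable \<nu>" using h(1) by (simp add: measurable_cong_sets[OF \<nu>(2) refl])
  let ?\<rho> = "rn_density \<nu> \<mu>"
  have \<rho>0: "0 \<le> ?\<rho> x" for x by (simp add: rn_density_def)
  have [measurable]: "?\<rho> \<in> borel_measurable \<mu>" unfolding rn_density_def[abs_def] by measurable
  have "AE x in \<mu>. RN_deriv \<mu> \<nu> x \<noteq> \<infinity>"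
    using \<nu>.sigma_finite_measure ac \<nu>(2) by (rule \<mu>.RN_deriv_finite)
  then have fin: "AE x in \<mu>. RN_deriv \<mu> \<nu> x = ennreal (?\<rho> x)"
    by eventually_elim (simp add: rn_density_def less_top)
  have cm: "(\<integral>\<^sup>+x. ennreal (g x) \<partial>\<nu>) = (\<integral>\<^sup>+x. ennreal (?\<rho> x * g x) \<partial>\<mu>)"
    if [measurable]: "g \<in> borel_measurable \<mu>" and g: "\<And>x. 0 \<le> g x" for g
  proof -
    have "(\<integral>\<^sup>+x. ennreal (g x) \<partial>\<nu>) = (\<integral>\<^sup>+x. RN_deriv \<mu> \<nu> x * ennreal (g x) \<partial>\<mu>)"
      using ac \<nu>(2) by (intro \<mu>.RN_deriv_nn_integral) auto
    also have "\<dots> = (\<integral>\<^sup>+x. ennreal (?\<rho> x * g x) \<partial>\<mu>)"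
    proof (rule nn_integral_cong_AE)
      show "AE x in \<mu>. RN_deriv \<mu> \<nu> x * ennreal (g x) = ennreal (?\<rho> x * g x)"
        using fin by eventually_elim (simp add: ennreal_mult \<rho>0 g)
    qed
    finally show ?thesis .
  qed
  have int\<mu>: "integrable \<mu> h" and int\<nu>: "integrable \<nu> h"
    using h h\<nu> by (auto intro!: \<mu>.integrable_const_bound[where B=1] \<nu>.integrable_const_bound[where B=1])
  let ?I = "\<integral>x. h x \<partial>\<mu>"
  have I: "(\<integral>\<^sup>+x. ennreal (h x) \<partial>\<mu>) = ennreal ?I" "0 \<le> ?I"
    using int\<mu> h by (auto intro!: nn_integral_eq_integral)
  have I\<nu>: "(\<integral>\<^sup>+x. ennreal (h x) \<partial>\<nu>) = ennreal (\<integral>x. h x \<partial>\<nu>)" "(\<integral>x. h x \<partial>\<nu>) \<le> 1"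
    using int\<nu> h \<nu>.integral_le_const[OF int\<nu>, of 1] by (auto intro!: nn_integral_eq_integral)
  have A0: "0 \<le> A" by (simp add: A_def)
  have normA: "Lp_norm p \<mu> ?\<rho> = ennreal A" using moment by (simp add: A_def less_top)
  consider "p = \<infinity>" | "p = 1" | p' where "p = ennreal p'" "1 < p'"
  proof -
    assume 1: "p = \<infinity> \<Longrightarrow> thesis" and 2: "p = 1 \<Longrightarrow> thesis" and 3: "\<And>p'. p = ennreal p' \<Longrightarrow> 1 < p' \<Longrightarrow> thesis"
    show thesis
    proof (cases p)
      case (real p')
      then have "1 \<le> p'" using p by simp
      then show thesis using 2 3 real by (cases "p' = 1") auto
    qed (use 1 in auto)
  qed
  then have "(\<integral>x. h x \<partial>\<nu>) \<le> A * (if q = \<infinity> then 1 else ?I powr (1 / enn2real q)) \<and> (q \<noteq> \<infinity> \<longrightarrow> 1 \<le> enn2real q)"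
  proof cases
    case 1
    then have q: "q = 1" by (simp add: q_def conj_exponent_def)
    have "AE x in \<mu>. ennreal \<bar>?\<rho> x\<bar> \<le> ennreal A"
      using esssup_AE[of "\<lambda>x. ennreal \<bar>?\<rho> x\<bar>" \<mu>] normA 1 by (simp add: Lp_norm_def)
    then have "AE x in \<mu>. ennreal (?\<rho> x * h x) \<le> ennreal A * ennreal (h x)"
      by eventually_elim (use h \<rho>0 A0 in \<open>auto simp: ennreal_mult[symmetric] intro!: mult_right_mono\<close>)
    then have "(\<integral>\<^sup>+x. ennreal (?\<rho> x * h x) \<partial>\<mu>) \<le> (\<integral>\<^sup>+x. ennreal A * ennreal (h x) \<partial>\<mu>)"
      by (rule nn_integral_mono_AE)
    also have "\<dots> = ennreal (A * ?I)" using A0 I by (simp add: nn_integral_cmult ennreal_mult)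
    finally have "ennreal (\<integral>x. h x \<partial>\<nu>) \<le> ennreal (A * ?I)"
      by (simp only: cm[OF h(1,2), symmetric] I\<nu>(1))
    then have "(\<integral>x. h x \<partial>\<nu>) \<le> A * ?I"
      by (rule ennreal_le_iff[THEN iffD1, rotated]) (use A0 I(2) in simp)
    then show ?thesis using q I(2) by simp
  next
    case 2
    then have q: "q = \<infinity>" by (simp add: q_def conj_exponent_def)
    have "(\<integral>\<^sup>+x. ennreal (?\<rho> x) \<partial>\<mu>) = 1"
      using cm[of "\<lambda>_. 1"] by (simp add: \<nu>.emeasure_space_1)
    \<comment> \<open>For \<open>p = 1\<close> the norm of the density is the total mass of \<nu>,
      and the trivial bound \<open>h \<le> 1\<close> suffices.\<close>
    then have "Lp_norm p \<mu> ?\<rho> = 1" using 2 \<rho>0 by (simp add: Lp_norm_def Let_def)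
    then have "A = 1" by (simp add: A_def)
    then show ?thesis using q I\<nu> by simp
  next
    case 3
    have "p - 1 = ennreal (p' - 1)" using 3 by (simp add: ennreal_minus[symmetric])
    then have q: "q = ennreal (p' / (p' - 1))"
      using 3 by (simp add: q_def conj_exponent_def divide_ennreal)
    then have q': "enn2real q = p' / (p' - 1)" "q \<noteq> \<infinity>" using 3 by auto
    define J where "J = enn2real (\<integral>\<^sup>+x. ennreal (?\<rho> x powr p') \<partial>\<mu>)"
    have pp: "p \<noteq> \<infinity>" "enn2real p = p'" using 3 by auto
    have nf: "(\<integral>\<^sup>+x. ennreal (?\<rho> x powr p') \<partial>\<mu>) \<noteq> \<infinity>"
      using moment pp \<rho>0 by (auto simp: Lp_norm_def Let_def split: if_splits)
    then have J: "(\<integral>\<^sup>+x. ennreal (?\<rho> x powr p') \<partial>\<mu>) = ennreal J"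
      by (simp add: J_def less_top)
    have "Lp_norm p \<mu> ?\<rho> = ennreal (J powr (1 / p'))"
      using pp \<rho>0 nf by (simp add: Lp_norm_def Let_def J_def)
    then have A: "A = J powr (1 / p')" by (simp add: A_def)
    have J0: "0 \<le> J" by (simp add: J_def)
    have "(\<integral>\<^sup>+x. ennreal (?\<rho> x * h x) \<partial>\<mu>) \<le> ennreal (J powr (1 / p') * ?I powr (1 - 1 / p'))"
      by (rule Holder_indicator[OF _ h(1) \<rho>0 h(2,3) 3(2) J J0 I]) measurable
    then have "ennreal (\<integral>x. h x \<partial>\<nu>) \<le> ennreal (A * ?I powr (1 - 1 / p'))"
      by (simp only: cm[OF h(1,2), symmetric] I\<nu>(1) A)
    then have "(\<integral>x. h x \<partial>\<nu>) \<le> A * ?I powr (1 - 1 / p')"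
      by (rule ennreal_le_iff[THEN iffD1, rotated]) (use A0 in simp)
    moreover have "1 - 1 / p' = 1 / enn2real q" using 3 by (simp add: q' field_simps)
    moreover have "1 \<le> enn2real q" using 3 by (simp add: q')
    ultimately show ?thesis using q'(2) by simp
  qed
  then show "(\<integral>x. h x \<partial>\<nu>) \<le> A * (if q = \<infinity> then 1 else ?I powr (1 / enn2real q))"
    "q \<noteq> \<infinity> \<Longrightarrow> 1 \<le> enn2real q" by auto
qed

lemma (in poincare_kernel) stationary_bernstein:
  assumes f: "f \<in> borel_measurable borel" "\<And>x. \<bar>f x\<bar> \<le> M" "E f = 0" "(nrm f)\<^sup>2 \<le> \<sigma>\<^sup>2"
    and pos: "0 < M" "0 < \<sigma>" "0 \<le> \<delta>" "\<delta> \<le> M" and n: "1 \<le> n" and \<eta>2: "\<eta> \<le> 2"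
  shows "E (stationary_tail f (real n * \<delta>) n)
    \<le> 2 * exp (- (real n * \<eta> * \<delta>\<^sup>2 / (4 * M * sqrt ((2 + 6 * \<eta>)\<^sup>2 * \<sigma>\<^sup>2 + \<delta>\<^sup>2))))"
proof (cases "\<delta> = 0")
  case True
  have "E (stationary_tail f (real n * \<delta>) n) \<le> E (\<lambda>_. 1)"
    by (intro E_mono stationary_tail_bdd f) auto
  then show ?thesis using True by simp
next
  case False
  \<comment> \<open>Since \<open>f\<close> is bounded by \<open>M\<close>, so is its norm, and
    replacing \<sigma> by the minimum can only increase the exponent. The cells rely on
    \<open>\<sigma> \<le> M\<close>.\<close>
  define \<sigma>' where "\<sigma>' = min \<sigma> M"
  have fb: "f \<in> bdd_borel" by (rule bdd_borelI[OF f(1,2)])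
  have "nrm f \<le> nrm (\<lambda>_. M)"
    using fb f(2) pos(1) by (intro nrm_mono) auto
  then have "nrm f \<le> M" using pos(1) by (simp add: nrm_const)
  moreover have "nrm f \<le> \<sigma>" using pos(2) by (intro power2_le_imp_le[OF f(4)]) simp
  ultimately have "nrm f \<le> \<sigma>'" by (simp add: \<sigma>'_def)
  then interpret bernstein_setting K \<mu> \<eta> f M \<sigma>' \<delta> n
    using f(1-3) pos n False by unfold_locales (simp_all add: \<sigma>'_def)
  have "x \<ge> real n * \<eta> * \<delta>\<^sup>2 / (4 * M * sqrt ((2 + 6 * \<eta>)\<^sup>2 * \<sigma>\<^sup>2 + \<delta>\<^sup>2))"
    unfolding x_def
  proof (rule divide_left_mono)
    have "\<sigma>'\<^sup>2 \<le> \<sigma>\<^sup>2" using \<sigma>(1) by (intro power_mono) (auto simp: \<sigma>'_def)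
    then have le: "R \<le> sqrt ((2 + 6 * \<eta>)\<^sup>2 * \<sigma>\<^sup>2 + \<delta>\<^sup>2)"
      unfolding R_def by (intro real_sqrt_le_mono add_right_mono mult_left_mono) auto
    then show "4 * M * R \<le> 4 * M * sqrt ((2 + 6 * \<eta>)\<^sup>2 * \<sigma>\<^sup>2 + \<delta>\<^sup>2)"
      using pos(1) by simp
    show "0 \<le> real n * \<eta> * \<delta>\<^sup>2" using \<eta>_pos by simp
    show "0 < (4 * M * sqrt ((2 + 6 * \<eta>)\<^sup>2 * \<sigma>\<^sup>2 + \<delta>\<^sup>2)) * (4 * M * R)"
      using less_le_trans[OF R_pos le] R_pos pos(1) by (intro mult_pos_pos) simp_all
  qed
  moreover have "tail \<le> 2 * exp (- x)"
    using tail_le_for_gap_1 tail_le_for_gap_2 tail_le_for_gap_3 tail_le_for_gap_4 \<eta>_pos \<eta>2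
    by (cases "\<eta> \<le> 1 / 20"; cases "\<eta> \<le> 2 / 5"; cases "\<eta> \<le> 6 / 5") auto
  ultimately show ?thesis by (smt (verit) exp_le_cancel_iff)
qed

theorem theorem2p4:
  fixes S :: "'w measure"
    and Z :: "nat \<Rightarrow> 'w \<Rightarrow> 'a::polish_space"
    and K :: "'a \<Rightarrow> 'a measure"
    and \<mu> \<nu> :: "'a measure"
    and p q :: ennreal
    and f :: "'a \<Rightarrow> real"
    and M \<sigma> \<delta> \<eta> :: real
    and n :: nat
  assumes chain: "markov_chain S Z K"
    and inv: "invariant_distribution K \<mu>"
    and nontrivial: "\<exists>h\<in>L2_0 \<mu>. L2_norm \<mu> h \<noteq> 0"
    and gap: "\<eta> = iterated_poincare_gap K \<mu>" "\<eta> > 0"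
    and init: "distr S borel (Z 1) = \<nu>"
    and ac: "absolutely_continuous \<mu> \<nu>"
    and p: "1 \<le> p"
    and q: "q = conj_exponent p"
    and moment: "Lp_norm p \<mu> (rn_density \<nu> \<mu>) < \<infinity>"
    and f_meas: "f \<in> borel_measurable borel"
    and f_mean: "(\<integral>x. f x \<partial>\<mu>) = 0"
    and M: "M > 0" "\<And>x. \<bar>f x\<bar> \<le> M"
    and \<sigma>: "\<sigma> > 0" "prob_space.variance \<mu> f \<le> \<sigma>\<^sup>2"
    and n: "n \<ge> 1"
    and \<delta>: "\<delta> \<ge> 0"
  shows "measure S {\<omega> \<in> space S. \<bar>1 / real n * (\<Sum>k=1..n. f (Z k \<omega>))\<bar> \<ge> \<delta>}
    \<le> 2 * enn2real (Lp_norm p \<mu> (rn_density \<nu> \<mu>)) *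
      (if q = \<infinity> then 1
       else exp (- (real n * \<eta> * \<delta>\<^sup>2 /
              (4 * enn2real q * M * sqrt ((2 + 6 * \<eta>)\<^sup>2 * \<sigma>\<^sup>2 + \<delta>\<^sup>2)))))"
proof -
  have kernel: "markov_kernel K" and S: "prob_space S" and Z: "\<And>k. 1 \<le> k \<Longrightarrow> Z k \<in> S \<rightarrow>\<^sub>M borel"
    using chain by (auto simp: markov_chain_def)
  interpret poincare_kernel K \<mu> \<eta> by (rule poincare_kernelI[OF inv kernel gap])
  interpret S: prob_space S by (rule S)
  note [measurable] = f_meas
  let ?event = "{\<omega> \<in> space S. \<bar>1 / real n * (\<Sum>k=1..n. f (Z k \<omega>))\<bar> \<ge> \<delta>}"
  let ?A = "enn2real (Lp_norm p \<mu> (rn_density \<nu> \<mu>))"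
  show ?thesis
  \<comment> \<open>For larger \<delta> the event is empty, because an average of values of
    \<open>f\<close> cannot exceed \<open>M\<close> in absolute value.\<close>
  proof (cases "\<delta> \<le> M")
    case False
    have "\<bar>1 / real n * (\<Sum>k=1..n. f (Z k \<omega>))\<bar> \<le> M" for \<omega>
    proof -
      have "\<bar>\<Sum>k=1..n. f (Z k \<omega>)\<bar> \<le> (\<Sum>k=1..n. M)"
        by (rule order_trans[OF sum_abs sum_mono]) (rule M)
      then show ?thesis using n by (simp add: abs_mult field_simps)
    qed
    then have "?event = {}" using False by (auto simp: not_le dest: order.strict_trans1)
    then show ?thesis by (simp only: measure_empty) simp
  next
    case True
    let ?F = "indicat_real {s. real n * \<delta> \<le> \<bar>s\<bar>}"
    define h where "h = stationary_tail f (real n * \<delta>) n"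
    have hb: "h \<in> bdd_borel" and h: "\<And>z. 0 \<le> h z" "\<And>z. h z \<le> 1"
      unfolding h_def by (rule stationary_tail_bdd[OF f_meas])+
    note [measurable] = bdd_borelD[OF hb] Z[OF order_refl]
    have h\<mu>: "h \<in> borel_measurable \<mu>"
      using bdd_borelD[OF hb] by (simp add: measurable_cong_sets[OF sets_mu refl])
    have Zm [measurable]: "(\<lambda>\<omega>. \<Sum>k=1..n. f (Z k \<omega>)) \<in> borel_measurable S"
      using Z by (intro borel_measurable_sum measurable_compose[OF _ f_meas]) auto
    have prob\<nu>: "prob_space \<nu>" unfolding init[symmetric] by (rule S.prob_space_distr) measurable
    interpret \<nu>: prob_space \<nu> by (rule prob\<nu>)
    have sets\<nu>: "sets \<nu> = sets \<mu>" unfolding init[symmetric] by (simp add: sets_mu)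
    have ev: "?event = (\<lambda>\<omega>. \<Sum>k=1..n. f (Z k \<omega>)) -` {s. real n * \<delta> \<le> \<bar>s\<bar>} \<inter> space S"
      using n by (auto simp: abs_mult field_simps)
    have "emeasure S ?event = (\<integral>\<^sup>+\<omega>. ennreal (?F (\<Sum>k=1..n. f (Z k \<omega>))) \<partial>S)"
    proof -
      have "emeasure S ?event = (\<integral>\<^sup>+\<omega>. indicator ?event \<omega> \<partial>S)"
        unfolding ev by (rule nn_integral_indicator[symmetric]) measurable
      also have "\<dots> = (\<integral>\<^sup>+\<omega>. ennreal (?F (\<Sum>k=1..n. f (Z k \<omega>))) \<partial>S)"
        unfolding ev by (intro nn_integral_cong) (auto simp: indicator_def)
      finally show ?thesis .
    qed
    also have "\<dots> = (\<integral>\<^sup>+\<omega>. ennreal (h (Z 1 \<omega>)) \<partial>S)"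
      unfolding h_def stationary_tail_def
      by (rule markov_chain_path_value[OF chain markov_operator_axioms n f_meas]) auto
    also have "\<dots> = (\<integral>\<^sup>+z. ennreal (h z) \<partial>\<nu>)"
      unfolding init[symmetric] by (rule nn_integral_distr[symmetric]) measurable
    also have "\<dots> = ennreal (\<integral>z. h z \<partial>\<nu>)"
      using bdd_borel_integrable[OF hb prob\<nu>] sets\<nu> sets_mu h by (intro nn_integral_eq_integral) auto
    finally have "measure S ?event = (\<integral>z. h z \<partial>\<nu>)"
      using h by (simp add: measure_def)
    also have "\<dots> \<le> ?A * (if q = \<infinity> then 1 else E h powr (1 / enn2real q))"
      unfolding q by (rule Lp_norm_change_of_measure(1)[OF prob_mu prob\<nu> sets\<nu> ac h\<mu> h p moment])
    also have "\<dots> \<le> ?A * (2 * (if q = \<infinity> then 1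
       else exp (- (real n * \<eta> * \<delta>\<^sup>2 /
              (4 * enn2real q * M * sqrt ((2 + 6 * \<eta>)\<^sup>2 * \<sigma>\<^sup>2 + \<delta>\<^sup>2))))))"
    proof (cases "q = \<infinity>")
      case False
      have q1: "1 \<le> enn2real q"
        using Lp_norm_change_of_measure(2)[OF prob_mu prob\<nu> sets\<nu> ac h\<mu> h p moment] False
        by (simp add: q)
      define x where "x = real n * \<eta> * \<delta>\<^sup>2 / (4 * M * sqrt ((2 + 6 * \<eta>)\<^sup>2 * \<sigma>\<^sup>2 + \<delta>\<^sup>2))"
      have "(nrm f)\<^sup>2 \<le> \<sigma>\<^sup>2"
        using \<sigma>(2) f_mean unfolding nrm_square by simp
      then have "E h \<le> 2 * exp (- x)"
        unfolding h_def x_def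
        by (intro stationary_bernstein f_meas M f_mean \<sigma>(1) \<delta> True n gap_le_2 nontrivial)
      moreover have "0 \<le> E h" using h(1) by (rule E_nonneg)
      ultimately have "E h powr (1 / enn2real q) \<le> (2 * exp (- x)) powr (1 / enn2real q)"
        using q1 by (intro powr_mono2) auto
      also have "\<dots> = 2 powr (1 / enn2real q) * exp (- x / enn2real q)"
        by (simp add: powr_mult exp_powr_real)
      \<comment> \<open>The root of order \<open>q\<close> from the Hoelder inequality divides the
        exponent by \<open>q\<close>; applied to the prefactor 2 it gives at most 2.\<close>
      also have "\<dots> \<le> 2 powr 1 * exp (- x / enn2real q)"
        using q1 by (intro mult_right_mono powr_mono) auto
      also have "- x / enn2real q = - (real n * \<eta> * \<delta>\<^sup>2 /
              (4 * enn2real q * M * sqrt ((2 + 6 * \<eta>)\<^sup>2 * \<sigma>\<^sup>2 + \<delta>\<^sup>2)))"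
        by (simp add: x_def mult_ac)
      finally show ?thesis using False by (simp add: mult_left_mono)
    qed (simp add: mult_left_mono)
    finally show ?thesis by (simp add: mult_ac)
  qed
qed

end
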